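(* Fix $3\le m<\infty$ and let $$\mathscr L_m=\Delta+2(m-1)\frac{x}{|x|^2}\cdot\nabla+\frac{(m-1)^2}{|x|^2},\qquad \mathfrak L_m=\partial_z^2+\frac{m-1}{z}\partial_z+\frac{(m-1)(m-3)}{4z^2}.$$ For all $0<\gamma<1$ and for all $\gamma/2\le\beta<\min\left\{\frac{m-1}4,1\right\}$, there exist constants $\Lambda_\gamma<\infty$ and $C_{m,\beta,\gamma}<\infty$ such that for all $0<a<b<\infty$ with $$\log\left(\frac ba\right)\ge\Lambda_\gamma,$$ setting $\Omega=B_b\setminus\overline B_a(0)\subset\mathbb R^2$, for all $u\in W^{2,2}(\Omega)$ we have $$\int_\Omega\frac1{|x|^2}\left|\nabla u+(m-1)\frac x{|x|^2}u\right|^2\left(\left(\frac{|x|}b\right)^{2\gamma}+\left(\frac a{|x|}\right)^{2\gamma}\right)dx\le C_{m,\beta,\gamma}\Bigg(\int_\Omega\frac{u^2}{|x|^4}\left(\left(\frac{|x|}b\right)^{4\beta}+\left(\frac a{|x|}\right)^{4\beta}\right)dx$$ $$+\int_\Omega(\mathscr L_mu)^2\left(\left(\frac{|x|}b\right)^{2\gamma}+\left(\frac a{|x|}\right)^{2\gamma}\right)dx+\int_\Omega|\mathfrak L_mu|^2\left(\left(\frac{|x|}b\right)^{2\gamma}+\left(\frac a{|x|}\right)^{2\gamma}\right)dx\Bigg).$$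
   Context: $B_r$ is the open disc of radius $r$ centred at $0$ in $\mathbb R^2\simeq\mathbb C$; $\partial_z=\frac12(\partial_{x_1}-i\partial_{x_2})$; $u$ is real-valued; $m$ is a real number. *)

theory Defs
  imports "HOL-Analysis.Analysis"
begin

section \<open>Test functions\<close>

fun iterated_partial :: "'a::euclidean_space list \<Rightarrow> ('a \<Rightarrow> real) \<Rightarrow> 'a \<Rightarrow> real" where
  "iterated_partial [] \<phi> = \<phi>"
| "iterated_partial (e # es) \<phi> = (\<lambda>x. frechet_derivative (iterated_partial es \<phi>) (at x) e)"

definition smooth :: "('a::euclidean_space \<Rightarrow> real) \<Rightarrow> bool" where
  "smooth \<phi> \<longleftrightarrow>
     (\<forall>es. set es \<subseteq> Basis \<longrightarrow> (\<forall>x. iterated_partial es \<phi> differentiable (at x)))"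

text \<open>\<open>C\<^sub>c\<^sup>\<infinity>(\<Omega>)\<close>, with each function extended by zero to the whole space.\<close>

definition test_functions :: "'a::euclidean_space set \<Rightarrow> ('a \<Rightarrow> real) set" where
  "test_functions \<Omega> =
     {\<phi>. smooth \<phi> \<and> compact (closure {x. \<phi> x \<noteq> 0}) \<and> closure {x. \<phi> x \<noteq> 0} \<subseteq> \<Omega>}"

section \<open>Weak derivatives and Sobolev spaces\<close>

definition locally_integrable_on ::
    "('a::euclidean_space \<Rightarrow> 'b::euclidean_space) \<Rightarrow> 'a set \<Rightarrow> bool" (infixr "locally'_integrable'_on" 46)
  where "f locally_integrable_on \<Omega> \<longleftrightarrow>
     (\<forall>K. compact K \<and> K \<subseteq> \<Omega> \<longrightarrow> set_integrable lebesgue K f)"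

text \<open>A list \<open>es\<close> of basis vectors plays the role of a multi-index \<open>\<alpha>\<close>, with
  \<open>|\<alpha>| = length es\<close>.\<close>

definition has_weak_partial ::
    "'a::euclidean_space set \<Rightarrow> 'a list \<Rightarrow> ('a \<Rightarrow> 'b::euclidean_space) \<Rightarrow> ('a \<Rightarrow> 'b) \<Rightarrow> bool" where
  "has_weak_partial \<Omega> es u v \<longleftrightarrow>
     u locally_integrable_on \<Omega> \<and> v locally_integrable_on \<Omega> \<and>
     (\<forall>\<phi>\<in>test_functions \<Omega>.
        (LINT x:\<Omega>|lebesgue. iterated_partial es \<phi> x *\<^sub>R u x) =
        (-1) ^ length es *\<^sub>R (LINT x:\<Omega>|lebesgue. \<phi> x *\<^sub>R v x))"

text \<open>Weak derivatives are unique only up to null sets; \<open>weak_partial\<close> picks a representative.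
  It is unspecified when no weak derivative exists.\<close>

definition weak_partial ::
    "'a::euclidean_space set \<Rightarrow> 'a list \<Rightarrow> ('a \<Rightarrow> 'b::euclidean_space) \<Rightarrow> 'a \<Rightarrow> 'b" where
  "weak_partial \<Omega> es u = (SOME v. has_weak_partial \<Omega> es u v)"

definition L2_on :: "'a::euclidean_space set \<Rightarrow> ('a \<Rightarrow> 'b::euclidean_space) set" where
  "L2_on \<Omega> = {u. set_borel_measurable lebesgue \<Omega> u \<and>
                 set_integrable lebesgue \<Omega> (\<lambda>x. (norm (u x))\<^sup>2)}"

text \<open>The Sobolev space \<open>W\<^sup>k\<^sup>,\<^sup>2(\<Omega>)\<close>.\<close>

definition sobolev_Wk2 :: "nat \<Rightarrow> 'a::euclidean_space set \<Rightarrow> ('a \<Rightarrow> 'b::euclidean_space) set" where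
  "sobolev_Wk2 k \<Omega> =
     {u \<in> L2_on \<Omega>. \<forall>es. set es \<subseteq> Basis \<and> length es \<le> k \<longrightarrow>
                      (\<exists>v \<in> L2_on \<Omega>. has_weak_partial \<Omega> es u v)}"

definition weak_grad :: "'a::euclidean_space set \<Rightarrow> ('a \<Rightarrow> real) \<Rightarrow> 'a \<Rightarrow> 'a" where
  "weak_grad \<Omega> u x = (\<Sum>e\<in>Basis. weak_partial \<Omega> [e] u x *\<^sub>R e)"

definition weak_laplacian :: "'a::euclidean_space set \<Rightarrow> ('a \<Rightarrow> real) \<Rightarrow> 'a \<Rightarrow> real" where
  "weak_laplacian \<Omega> u x = (\<Sum>e\<in>Basis. weak_partial \<Omega> [e, e] u x)"

section \<open>The differential operators on the plane\<close>

text \<open>The plane \<open>\<real>\<^sup>2\<close> is the type \<^typ>\<open>complex\<close>, whose orthonormal basis is \<open>{1, \<i>}\<close>: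
  \<open>\<partial>\<close> in direction \<open>1\<close> is \<open>\<partial>/\<partial>x\<^sub>1\<close> and in direction \<open>\<i>\<close> it is \<open>\<partial>/\<partial>x\<^sub>2\<close>.\<close>

definition weak_dz :: "complex set \<Rightarrow> (complex \<Rightarrow> complex) \<Rightarrow> complex \<Rightarrow> complex" where
  "weak_dz \<Omega> f z = (1/2) * (weak_partial \<Omega> [1] f z - \<i> * weak_partial \<Omega> [\<i>] f z)"

definition real_L_op :: "real \<Rightarrow> complex set \<Rightarrow> (complex \<Rightarrow> real) \<Rightarrow> complex \<Rightarrow> real" where
  "real_L_op m \<Omega> u x =
     weak_laplacian \<Omega> u x
     + 2 * (m - 1) * ((x /\<^sub>R (norm x)\<^sup>2) \<bullet> weak_grad \<Omega> u x)
     + (m - 1)\<^sup>2 / (norm x)\<^sup>2 * u x"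

definition complex_L_op :: "real \<Rightarrow> complex set \<Rightarrow> (complex \<Rightarrow> complex) \<Rightarrow> complex \<Rightarrow> complex" where
  "complex_L_op m \<Omega> f z =
     weak_dz \<Omega> (weak_dz \<Omega> f) z
     + of_real (m - 1) / z * weak_dz \<Omega> f z
     + of_real ((m - 1) * (m - 3)) / (4 * z\<^sup>2) * f z"

definition annulus :: "real \<Rightarrow> real \<Rightarrow> complex set" where
  "annulus a b = ball 0 b - cball 0 a"

definition neck_weight :: "real \<Rightarrow> real \<Rightarrow> real \<Rightarrow> complex \<Rightarrow> real" where
  "neck_weight s a b x = (norm x / b) powr s + (a / norm x) powr s"

end

theory Submission
  imports Defs
begin

text \<open>Put \<open>k = m - 1\<close>, \<open>r = |x|\<close> and \<open>v = r\<^sup>k u\<close>. The first-order expression is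
  \<open>r\<^sup>-\<^sup>k \<nabla>v\<close>, and the two operators are \<open>r\<^sup>-\<^sup>k \<Delta>v\<close> and \<open>r\<^sup>-\<^sup>k \<partial>\<^sub>z\<^sup>2 v\<close>, which together
  determine the full Hessian of \<open>v\<close>. Since \<open>k \<ge> 2\<close>, the weight
  \<open>r\<^sup>-\<^sup>2\<^sup>-\<^sup>2\<^sup>k\<close> decays so fast that comparing \<open>\<nabla>v(2x)\<close> with \<open>\<nabla>v(x)\<close> gives a Hardy
  inequality: \<open>\<nabla>v\<close> is controlled by the Hessian and by its values on the inner annulus
  \<open>a < r \<le> 2a\<close>. There the zeroth-order weight is bounded below, and a Taylor
  expansion in outward coordinate directions bounds \<open>\<nabla>v\<close> by \<open>v\<close> and its second derivatives.
  Mollification on slightly smaller annuli carries the estimate over to weak derivatives.\<close>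

text \<open>The arithmetic of the Hardy step: passing from y to 2y multiplies the gradient weight by
  at most 2^(-6) * 4 = 1/16, the first factor by k >= 2, the second by \<gamma> <= 1 in the neck
  weight. The Jacobian in the plane contributes 4 and the square of a sum 2, so the outer part
  returns with factor 1/2 and is absorbed; no term at the outer boundary arises and no constant sees
  b/a. Absorption is legitimate only for a finite left side, which smoothness guarantees on annuli
  away from 0; this is why weak derivatives are treated by a limit in the function and a limit in
  the annulus instead of directly. Inequalities live in \<open>ennreal\<close>. Real integrals
  return only at the end, where finiteness must be checked, because a Bochner integral that does not
  converge has value 0. Weak derivatives are arbitrary choices of representatives, so a fundamental
  lemma of the calculus of variations is needed before the operators can be computed at all.\<close>

abbreviation set_int :: "'a::euclidean_space set \<Rightarrow> ('a \<Rightarrow> real) \<Rightarrow> ennreal" where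
  "set_int S f \<equiv> \<integral>\<^sup>+x. ennreal (f x) * indicator S x \<partial>lborel"

abbreviation dxy :: "real \<Rightarrow> real \<Rightarrow> complex \<Rightarrow> real" where
  "dxy p q \<equiv> \<lambda>h. p * Re h + q * Im h"

abbreviation shell :: "real \<Rightarrow> real \<Rightarrow> complex set" where
  "shell A c \<equiv> {x. A < norm x \<and> norm x \<le> c * A}"

section \<open>Smooth compactly supported functions on the plane\<close>

text \<open>The classical flat function exp(-1/t), multiplied by a power of 1/t. The powers are
  carried along because differentiation sends the k-th member to a combination of the members k+1
  and k+2, so all derivatives stay inside one explicit family.\<close>

definition flat_exp :: "nat \<Rightarrow> real \<Rightarrow> real" where
  "flat_exp k t = (if t > 0 then inverse t ^ k * exp (- inverse t) else 0)"

text \<open>A single term of the exponential series, s^(k+2)/(k+2)! <= exp s, read at s = 1/t.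
  Quadratic decay at 0 is what makes the difference quotient there vanish in the limit.\<close>

lemma flat_exp_bound:
  assumes "t > 0"
  shows "flat_exp k t \<le> fact (k + 2) * t\<^sup>2"
proof -
  define s where "s = inverse t"
  have s: "s > 0" "t = inverse s" using assms by (auto simp: s_def)
  have "s ^ (k+2) /\<^sub>R fact (k+2) \<le> exp s"
    unfolding exp_def using s
    by (intro order_trans[OF _ sum_le_suminf[of _ "{k+2}"]] summable_exp_generic) auto
  then have "s ^ (k+2) / fact (k+2) \<le> exp s"
    by (simp only: real_scaleR_def divide_inverse mult.commute)
  then have "s ^ (k+2) \<le> fact (k+2) * exp s"
    by (simp only: pos_divide_le_eq fact_gt_zero mult.commute)
  then have "s ^ k * s\<^sup>2 * exp (- s) \<le> fact (k+2)"
    by (simp only: power_add[symmetric] exp_minus divide_inverse[symmetric] pos_divide_le_eq exp_gt_zero)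
  then have "(s ^ k * exp (- s)) * s\<^sup>2 \<le> fact (k+2)" by (simp only: mult_ac)
  then have "s ^ k * exp (- s) \<le> fact (k+2) / s\<^sup>2"
    using s by (simp only: pos_le_divide_eq zero_less_power)
  then show ?thesis
    using assms by (simp only: flat_exp_def s_def[symmetric] if_True) (simp only: s(2) power_inverse divide_inverse)
qed

lemma flat_exp_nonneg: "flat_exp k t \<ge> 0"
  by (simp add: flat_exp_def)

lemma flat_exp_deriv: "(flat_exp k has_real_derivative (flat_exp (k + 2) t - real k * flat_exp (k + 1) t)) (at t)"
proof -
  consider "t > 0" | "t < 0" | "t = 0" by linarith
  then show ?thesis
  proof cases
    case 1
    have "((\<lambda>s. s ^ k * exp (- s)) has_real_derivative
        (real k * s ^ (k - 1) * exp (- s) - s ^ k * exp (- s))) (at s)" for s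
      by (auto intro!: derivative_eq_intros)
    moreover have "(inverse has_real_derivative - (inverse t * inverse t)) (at t)"
      using DERIV_inverse[of t UNIV] 1 by (simp add: power2_eq_square)
    ultimately have "((\<lambda>t. inverse t ^ k * exp (- inverse t)) has_real_derivative
        (real k * inverse t ^ (k - 1) * exp (- inverse t) - inverse t ^ k * exp (- inverse t))
          * - (inverse t * inverse t)) (at t)"
      by (rule DERIV_chain2)
    also have "(real k * inverse t ^ (k - 1) * exp (- inverse t) - inverse t ^ k * exp (- inverse t))
          * - (inverse t * inverse t) = flat_exp (k + 2) t - real k * flat_exp (k + 1) t"
      using 1 by (cases k) (simp_all add: flat_exp_def algebra_simps)
    finally have "((\<lambda>t. inverse t ^ k * exp (- inverse t)) has_real_derivative
        (flat_exp (k + 2) t - real k * flat_exp (k + 1) t)) (at t)" .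
    then show ?thesis
      by (rule has_field_derivative_transform_within_open[where S = "{0<..}"])
         (use 1 in \<open>auto simp: flat_exp_def\<close>)
  next
    case 2
    have "((\<lambda>t. 0) has_real_derivative (flat_exp (k + 2) t - real k * flat_exp (k + 1) t)) (at t)"
      using 2 by (simp add: flat_exp_def)
    then show ?thesis
      by (rule has_field_derivative_transform_within_open[where S = "{..<0}"])
         (use 2 in \<open>auto simp: flat_exp_def\<close>)
  next
    case 3
    \<comment> \<open>At 0 the claimed derivative is 0, since every member of the family vanishes
      there; the quotient is at most a constant times |h|.\<close>
    have "((\<lambda>h. flat_exp k h / h) \<longlongrightarrow> 0) (at 0)"
    proof (rule Lim_null_comparison)
      show "eventually (\<lambda>h. norm (flat_exp k h / h) \<le> fact (k+2) * \<bar>h\<bar>) (at 0)"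
      proof (rule always_eventually, rule allI)
        fix h :: real
        show "norm (flat_exp k h / h) \<le> fact (k+2) * \<bar>h\<bar>"
        proof (cases "h > 0")
          case True
          then show ?thesis using flat_exp_bound[OF True, of k] flat_exp_nonneg[of k h]
            by (simp add: divide_simps power2_eq_square mult_ac)
        next
          case False
          then have "flat_exp k h = 0" by (simp add: flat_exp_def)
          then show ?thesis by simp
        qed
      qed
      show "((\<lambda>h::real. fact (k+2) * \<bar>h\<bar>) \<longlongrightarrow> 0) (at 0)"
        by (auto intro!: tendsto_eq_intros)
    qed
    then show ?thesis using 3 by (simp add: DERIV_def flat_exp_def)
  qed
qed

text \<open>A linear space of functions vanishing off (-1, 1) that is stable under differentiation;
  smoothness of the bump then follows by induction on the order.\<close>

inductive bumpfun :: "(real \<Rightarrow> real) \<Rightarrow> bool" where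
  gen: "bumpfun (\<lambda>t. flat_exp j (1 - t) * flat_exp l (1 + t))"
| add: "bumpfun f \<Longrightarrow> bumpfun g \<Longrightarrow> bumpfun (\<lambda>t. f t + g t)"
| cmul: "bumpfun f \<Longrightarrow> bumpfun (\<lambda>t. c * f t)"

lemma bumpfun_deriv:
  "bumpfun f \<Longrightarrow> \<exists>f'. bumpfun f' \<and> (\<forall>t. (f has_real_derivative f' t) (at t))"
proof (induction rule: bumpfun.induct)
  case (gen j l)
  define f' where "f' = (\<lambda>t. ((- 1) * (flat_exp (j+2) (1-t) * flat_exp l (1+t)) + real j * (flat_exp (j+1) (1-t) * flat_exp l (1+t))) +
    (flat_exp j (1-t) * flat_exp (l+2) (1+t) + (- real l) * (flat_exp j (1-t) * flat_exp (l+1) (1+t))))"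
  have "bumpfun f'" unfolding f'_def by (intro bumpfun.intros)
  moreover have "((\<lambda>t. flat_exp j (1 - t) * flat_exp l (1 + t)) has_real_derivative f' t) (at t)" for t
  proof -
    have "((\<lambda>t. flat_exp j (1 - t)) has_real_derivative
        ((flat_exp (j + 2) (1-t) - real j * flat_exp (j + 1) (1-t)) * (-1))) (at t)"
      by (rule DERIV_chain2[OF flat_exp_deriv]) (auto intro!: derivative_eq_intros)
    moreover have "((\<lambda>t. flat_exp l (1 + t)) has_real_derivative
        ((flat_exp (l + 2) (1+t) - real l * flat_exp (l + 1) (1+t)) * 1)) (at t)"
      by (rule DERIV_chain2[OF flat_exp_deriv]) (auto intro!: derivative_eq_intros)
    ultimately show ?thesis
      unfolding f'_def by (rule DERIV_cong[OF DERIV_mult]) (simp add: algebra_simps)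
  qed
  ultimately show ?case by blast
next
  case (add f g)
  then obtain f' g' where "bumpfun f'" "bumpfun g'"
    "\<And>t. (f has_real_derivative f' t) (at t)" "\<And>t. (g has_real_derivative g' t) (at t)" by blast
  then show ?case
    by (intro exI[of _ "\<lambda>t. f' t + g' t"]) (auto intro: bumpfun.intros DERIV_add)
next
  case (cmul f c)
  then obtain f' where "bumpfun f'" "\<And>t. (f has_real_derivative f' t) (at t)" by blast
  then show ?case
    by (intro exI[of _ "\<lambda>t. c * f' t"]) (auto intro: bumpfun.intros DERIV_cmult)
qed

lemma bumpfun_zero: "bumpfun f \<Longrightarrow> \<bar>t\<bar> \<ge> 1 \<Longrightarrow> f t = 0"
  by (induction rule: bumpfun.induct) (auto simp: flat_exp_def)

text \<open>The undifferentiated product is the standard bump exp(-2/(1 - t^2)) on (-1, 1), because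
  1/(1-t) + 1/(1+t) = 2/(1-t^2).\<close>

definition psi :: "nat \<Rightarrow> real \<Rightarrow> real" where
  "psi n = (deriv ^^ n) (\<lambda>t. flat_exp 0 (1 - t) * flat_exp 0 (1 + t))"

text \<open>Membership in \<open>bumpfun\<close> supplies the existence of the next derivative, so
  \<open>deriv\<close> returns a genuine derivative at every stage of the iteration.\<close>

lemma bumpfun_psi: "bumpfun (psi n)"
proof (induction n)
  case 0
  show ?case by (simp add: psi_def gen)
next
  case (Suc n)
  then obtain f' where f': "bumpfun f'" "\<And>t. (psi n has_real_derivative f' t) (at t)"
    using bumpfun_deriv by blast
  then have "psi (Suc n) = f'" by (auto simp: psi_def intro!: DERIV_imp_deriv)
  with f' show ?case by simp
qed

lemma psi_deriv: "(psi n has_real_derivative psi (Suc n) t) (at t)"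
proof -
  obtain f' where f': "\<And>t. (psi n has_real_derivative f' t) (at t)"
    using bumpfun_deriv[OF bumpfun_psi] by blast
  then have "psi (Suc n) = f'" by (auto simp: psi_def intro!: DERIV_imp_deriv)
  with f' show ?thesis by simp
qed

lemma psi_zero: "\<bar>t\<bar> \<ge> 1 \<Longrightarrow> psi n t = 0"
  using bumpfun_psi bumpfun_zero by blast

lemma psi_0: "psi 0 t \<ge> 0" "\<bar>t\<bar> < 1 \<Longrightarrow> psi 0 t > 0"
  by (auto simp: psi_def flat_exp_def)

lemma psi_continuous: "continuous_on S (psi n)"
  by (meson DERIV_isCont continuous_at_imp_continuous_on psi_deriv)

lemma psi_bounded: obtains M where "M > 0" "\<And>t. \<bar>psi n t\<bar> \<le> M"
proof -
  have "compact (psi n ` {-1..1})"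
    by (intro compact_continuous_image psi_continuous) auto
  then obtain M where "M > 0" "\<forall>y \<in> psi n ` {-1..1}. norm y \<le> M"
    using compact_imp_bounded bounded_pos by metis
  then have "\<bar>psi n t\<bar> \<le> M" for t
  proof (cases "\<bar>t\<bar> \<ge> 1")
    case False
    then have "t \<in> {-1..1}" by auto
    then show ?thesis using \<open>\<forall>y \<in> psi n ` {-1..1}. norm y \<le> M\<close> by simp
  qed (use \<open>M > 0\<close> psi_zero in auto)
  with that \<open>M > 0\<close> show ?thesis by blast
qed

text \<open>Partial derivatives of a product of one-variable bumps are again such products, so
  that mixed partials of these test functions commute by construction.\<close>

definition prod_bump :: "real \<Rightarrow> complex \<Rightarrow> nat \<Rightarrow> nat \<Rightarrow> complex \<Rightarrow> real" where
  "prod_bump s p i j y = psi i (s * Re y + Re p) * psi j (s * Im y + Im p)"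

lemma prod_bump_has_derivative:
  "(prod_bump s p i j has_derivative
     (dxy (s * prod_bump s p (Suc i) j y) (s * prod_bump s p i (Suc j) y))) (at y)"
proof -
  have 1: "((\<lambda>y. psi i (s * Re y + Re p)) has_derivative
     (\<lambda>h. (s * Re h) * psi (Suc i) (s * Re y + Re p))) (at y)" for i p
    by (rule DERIV_compose_FDERIV[OF psi_deriv]) (auto intro!: derivative_eq_intros)
  have 2: "((\<lambda>y. psi j (s * Im y + Im p)) has_derivative
     (\<lambda>h. (s * Im h) * psi (Suc j) (s * Im y + Im p))) (at y)" for j p
    by (rule DERIV_compose_FDERIV[OF psi_deriv]) (auto intro!: derivative_eq_intros)
  have eq: "prod_bump s p i j = (\<lambda>y. psi i (s * Re y + Re p) * psi j (s * Im y + Im p))"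
    by (rule ext) (rule prod_bump_def)
  show ?thesis
    unfolding eq by (rule has_derivative_eq_rhs[OF has_derivative_mult[OF 1 2]],
      simp add: prod_bump_def algebra_simps)
qed

lemma prod_bump_continuous: "continuous_on S (prod_bump s p i j)"
  by (intro continuous_at_imp_continuous_on ballI has_derivative_continuous[OF prod_bump_has_derivative])

text \<open>Only the multiplicities of 1 and \<i> in the list survive. This is what later identifies
  the two mixed weak derivatives.\<close>

lemma iterated_partial_prod_bump:
  assumes "set es \<subseteq> Basis"
  shows "iterated_partial es (prod_bump s p i j) =
    (\<lambda>y. s ^ length es * prod_bump s p (i + count_list es 1) (j + count_list es \<i>) y)"
  using assms
proof (induction es)
  case (Cons e es)
  have d: "((\<lambda>y. s ^ length es * prod_bump s p a b y) has_derivative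
     (\<lambda>h. s ^ length es * (s * prod_bump s p (Suc a) b y * Re h + s * prod_bump s p a (Suc b) y * Im h))) (at y)" for y a b
    by (intro has_derivative_mult_right prod_bump_has_derivative)
  have "e = 1 \<or> e = \<i>" using Cons.prems by (auto simp: Basis_complex_def)
  moreover have "iterated_partial es (prod_bump s p i j) =
      (\<lambda>y. s ^ length es * prod_bump s p (i + count_list es 1) (j + count_list es \<i>) y)"
    using Cons by simp
  ultimately show ?case
    by (elim disjE) (simp_all add: frechet_derivative_at[OF d, symmetric] mult.left_commute mult.assoc)
qed simp

text \<open>The scale may be negative because the function actually tested is y -> B(x - y), which
  is a product bump in y with scale -1/e.\<close>

lemma prod_bump_test_function:
  assumes s: "s \<noteq> 0" and sub: "{y. \<bar>s * Re y + Re p\<bar> \<le> 1 \<and> \<bar>s * Im y + Im p\<bar> \<le> 1} \<subseteq> \<Omega>"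
  shows "prod_bump s p 0 0 \<in> test_functions \<Omega>"
proof -
  let ?K = "{y. \<bar>s * Re y + Re p\<bar> \<le> 1 \<and> \<bar>s * Im y + Im p\<bar> \<le> 1}"
  have "smooth (prod_bump s p 0 0)"
    unfolding smooth_def
  proof (intro allI impI)
    fix es :: "complex list" and x assume "set es \<subseteq> Basis"
    show "iterated_partial es (prod_bump s p 0 0) differentiable at x"
      unfolding iterated_partial_prod_bump[OF \<open>set es \<subseteq> Basis\<close>]
      by (intro differentiableI[OF has_derivative_mult_right[OF prod_bump_has_derivative]])
  qed
  moreover have "closed ?K"
    by (intro closed_Collect_conj closed_Collect_le continuous_intros)
  moreover have "{y. prod_bump s p 0 0 y \<noteq> 0} \<subseteq> ?K"
  proof (rule subsetI, rule ccontr)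
    fix y assume "y \<in> {y. prod_bump s p 0 0 y \<noteq> 0}" "y \<notin> ?K"
    then show False using psi_zero[of "s * Re y + Re p" 0] psi_zero[of "s * Im y + Im p" 0]
      by (auto simp: prod_bump_def not_le)
  qed
  moreover have "bounded ?K"
  proof (rule boundedI)
    fix y assume y: "y \<in> ?K"
    have "\<bar>s\<bar> * \<bar>Re y\<bar> \<le> 1 + \<bar>Re p\<bar>" "\<bar>s\<bar> * \<bar>Im y\<bar> \<le> 1 + \<bar>Im p\<bar>"
      using y unfolding abs_mult[symmetric] by auto
    then have "\<bar>Re y\<bar> \<le> (1 + \<bar>Re p\<bar>) / \<bar>s\<bar>" "\<bar>Im y\<bar> \<le> (1 + \<bar>Im p\<bar>) / \<bar>s\<bar>"
      using s by (auto simp: field_simps)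
    then show "norm y \<le> (1 + \<bar>Re p\<bar>) / \<bar>s\<bar> + (1 + \<bar>Im p\<bar>) / \<bar>s\<bar>"
      using cmod_le[of y] by linarith
  qed
  ultimately have sub2: "closure {y. prod_bump s p 0 0 y \<noteq> 0} \<subseteq> ?K" and "bounded ?K"
    by (simp_all only: closure_minimal)
  then have "compact (closure {y. prod_bump s p 0 0 y \<noteq> 0})"
    unfolding compact_eq_bounded_closed by (intro conjI closed_closure bounded_subset[OF _ sub2])
  with sub2 sub \<open>smooth _\<close> show ?thesis by (auto simp: test_functions_def)
qed

section \<open>Mollification in \<open>L\<^sup>1\<close> and \<open>L\<^sup>2\<close>\<close>

lemma nn_integral_lborel_translate:
  fixes h :: "'a::euclidean_space \<Rightarrow> ennreal"
  assumes [measurable]: "h \<in> borel_measurable borel"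
  shows "(\<integral>\<^sup>+x. h (x + t) \<partial>lborel) = (\<integral>\<^sup>+x. h x \<partial>lborel)"
  by (subst (2) lborel_distr_plus[symmetric, of t]) (simp add: nn_integral_distr add.commute)

lemma nn_integral_lborel_reflect:
  fixes h :: "'a::euclidean_space \<Rightarrow> ennreal"
  assumes [measurable]: "h \<in> borel_measurable borel"
  shows "(\<integral>\<^sup>+y. h (x - y) \<partial>lborel) = (\<integral>\<^sup>+x. h x \<partial>lborel)"
  by (subst (2) lborel_affine[of "-1" x]) (simp_all add: nn_integral_density nn_integral_distr)

lemma nn_integral_lborel_scale:
  fixes h :: "'a::euclidean_space \<Rightarrow> ennreal"
  assumes [measurable]: "h \<in> borel_measurable borel" and c: "c > 0"
  shows "(\<integral>\<^sup>+x. h x \<partial>lborel) = ennreal (c ^ DIM('a)) * (\<integral>\<^sup>+x. h (c *\<^sub>R x) \<partial>lborel)"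
  using c by (subst lborel_affine[of c 0])
     (simp_all add: nn_integral_density nn_integral_distr nn_integral_cmult)

section \<open>Density of continuous functions and continuity of translations\<close>

lemma pow12_triangle:
  fixes x y :: real
  assumes "p = 1 \<or> p = (2::nat)"
  shows "\<bar>x + y\<bar> ^ p \<le> 2 * (\<bar>x\<bar> ^ p + \<bar>y\<bar> ^ p)"
  using assms
proof
  assume "p = 2"
  then show ?thesis
    using sum_squares_bound[of x y] by (simp add: power2_eq_square algebra_simps)
qed auto

text \<open>The p-th power of the L^p norm; without the root, the triangle inequality costs a factor
  2. Exponent 1 serves the fundamental lemma, exponent 2 the approximation of u and its
  derivatives.\<close>

definition Lp_int :: "nat \<Rightarrow> ('a::euclidean_space \<Rightarrow> real) \<Rightarrow> ennreal" where
  "Lp_int p f = (\<integral>\<^sup>+x. ennreal (\<bar>f x\<bar> ^ p) \<partial>lborel)"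

lemma Lp_int_add:
  assumes p: "p = 1 \<or> p = 2" and [measurable]: "f \<in> borel_measurable borel" "g \<in> borel_measurable borel"
  shows "Lp_int p (\<lambda>x. f x + g x) \<le> 2 * (Lp_int p f + Lp_int p g)"
proof -
  have "Lp_int p (\<lambda>x. f x + g x) \<le> (\<integral>\<^sup>+x. 2 * (ennreal (\<bar>f x\<bar> ^ p) + ennreal (\<bar>g x\<bar> ^ p)) \<partial>lborel)"
    unfolding Lp_int_def
  proof (rule nn_integral_mono)
    fix x
    have "ennreal (\<bar>f x + g x\<bar> ^ p) \<le> ennreal (2 * (\<bar>f x\<bar> ^ p + \<bar>g x\<bar> ^ p))"
      by (rule ennreal_leI[OF pow12_triangle[OF p]])
    then show "ennreal (\<bar>f x + g x\<bar> ^ p) \<le> 2 * (ennreal (\<bar>f x\<bar> ^ p) + ennreal (\<bar>g x\<bar> ^ p))"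
      by (simp add: ennreal_mult)
  qed
  also have "\<dots> = 2 * (Lp_int p f + Lp_int p g)"
    unfolding Lp_int_def by (simp add: nn_integral_cmult nn_integral_add)
  finally show ?thesis .
qed

text \<open>A Lebesgue measurable function is almost everywhere a limit of continuous ones. Clipping
  to [-M, M] and multiplying by a tent function gives the approximants a common bound and a common
  bounded support, and dominated convergence applies.\<close>

lemma Lp_int_Cc_approx_bounded:
  fixes f :: "'a::euclidean_space \<Rightarrow> real"
  assumes [measurable]: "f \<in> borel_measurable borel" and p: "p > 0"
    and M: "\<And>x. \<bar>f x\<bar> \<le> M" "\<And>x. norm x > R \<Longrightarrow> f x = 0" and e: "e > 0"
  shows "\<exists>g R. continuous_on UNIV g \<and> (\<forall>x. norm x > R \<longrightarrow> g x = 0)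
    \<and> Lp_int p (\<lambda>x. f x - g x) < ennreal e"
proof -
  have "f measurable_on UNIV"
    using lebesgue_measurable_imp_measurable_on[of f UNIV] by (simp add: measurable_completion)
  then obtain N g where N: "negligible N" and g: "\<And>n. continuous_on UNIV (g n)"
    and lim: "\<And>x. x \<notin> N \<Longrightarrow> (\<lambda>n. g n x) \<longlonglongrightarrow> f x"
    unfolding measurable_on_def by auto
  have M0: "M \<ge> 0" using M(1)[of 0] by linarith
  \<comment> \<open>Equal to 1 for norm x <= R and to 0 beyond R + 1, so it leaves the limit f,
    which vanishes beyond R, unchanged.\<close>
  define cut where "cut = (\<lambda>x::'a. max 0 (min 1 (R + 1 - norm x)))"
  define G where "G = (\<lambda>n x. max (- M) (min M (g n x)) * cut x)"
  have cG: "continuous_on UNIV (G n)" for n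
    unfolding G_def cut_def by (intro continuous_intros g)
  have [measurable]: "G n \<in> borel_measurable borel" for n
    using cG borel_measurable_continuous_onI by blast
  have G0: "norm x > R + 1 \<Longrightarrow> G n x = 0" for n x
    by (simp add: G_def cut_def)
  have cut: "0 \<le> cut x" "cut x \<le> 1" for x by (auto simp: cut_def)
  have Gb: "\<bar>G n x\<bar> \<le> M" for n x
    using mult_mono[of "\<bar>max (- M) (min M (g n x))\<bar>" M "cut x" 1] cut[of x] M0
    by (auto simp: G_def abs_mult)
  have [measurable]: "cball (0::'a) (R + 1) \<in> sets borel" by (intro borel_closed) auto
  have "(\<lambda>n. Lp_int p (\<lambda>x. f x - G n x)) \<longlonglongrightarrow> (\<integral>\<^sup>+x. 0 \<partial>(lborel::'a measure))"
    unfolding Lp_int_def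
  proof (rule nn_integral_dominated_convergence[where w = "\<lambda>x. ennreal ((2 * M) ^ p) * indicator (cball 0 (R + 1)) x"])
    show "(set_int (cball (0::'a) (R + 1)) (\<lambda>x. (2 * M) ^ p)) < \<infinity>"
      using emeasure_bounded_finite[OF bounded_cball, of "0::'a" "R + 1"]
      by (subst nn_integral_cmult_indicator) (auto simp: ennreal_mult_less_top)
    show "AE x in lborel. ennreal (\<bar>f x - G n x\<bar> ^ p) \<le> ennreal ((2 * M) ^ p) * indicator (cball 0 (R + 1)) x" for n
    proof (rule AE_I2)
      fix x
      show "ennreal (\<bar>f x - G n x\<bar> ^ p) \<le> ennreal ((2 * M) ^ p) * indicator (cball 0 (R + 1)) x"
      proof (cases "norm x > R + 1")
        case True
        then show ?thesis using G0[OF True] M(2)[of x] p by (simp add: power_0_left)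
      next
        case False
        have "\<bar>f x - G n x\<bar> \<le> 2 * M" using M(1)[of x] Gb[of n x] by linarith
        then have "\<bar>f x - G n x\<bar> ^ p \<le> (2 * M) ^ p" by (intro power_mono) auto
        then show ?thesis using False by (simp add: indicator_def ennreal_leI del: power_mult_distrib)
      qed
    qed
    show "AE x in lborel. (\<lambda>n. ennreal (\<bar>f x - G n x\<bar> ^ p)) \<longlonglongrightarrow> 0"
    proof -
      have "AE x in lborel. x \<notin> N"
        using N AE_not_in[of N lebesgue] unfolding negligible_iff_null_sets
        by (simp add: AE_completion_iff)
      then show ?thesis
      proof eventually_elim
        fix x assume "x \<notin> N"
        have "(\<lambda>n. G n x) \<longlonglongrightarrow> max (- M) (min M (f x)) * cut x"
          unfolding G_def by (intro tendsto_intros lim \<open>x \<notin> N\<close>)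
        also have "max (- M) (min M (f x)) = f x"
          using M(1)[of x] by linarith
        also have "f x * cut x = f x"
          using M(2)[of x] by (cases "norm x > R") (auto simp: cut_def)
        finally have "(\<lambda>n. \<bar>f x - G n x\<bar> ^ p) \<longlonglongrightarrow> \<bar>f x - f x\<bar> ^ p"
          by (intro tendsto_intros)
        then show "(\<lambda>n. ennreal (\<bar>f x - G n x\<bar> ^ p)) \<longlonglongrightarrow> 0"
          using p tendsto_ennrealI by (fastforce simp: power_0_left)
      qed
    qed
  qed auto
  then have "eventually (\<lambda>n. Lp_int p (\<lambda>x. f x - G n x) < ennreal e) sequentially"
    using e by (intro order_tendstoD(2)[of _ 0]) auto
  then obtain n where "Lp_int p (\<lambda>x. f x - G n x) < ennreal e"
    using eventually_happens by fastforce
  then show ?thesis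
    using cG G0 by blast
qed

text \<open>Truncation in value and in space reduces to the bounded case, with |f|^p itself as
  dominating function. Two errors e/4 and the factor 2 of \<open>Lp_int_add\<close> make e.\<close>

lemma Lp_int_Cc_approx:
  fixes f :: "'a::euclidean_space \<Rightarrow> real"
  assumes p: "p = 1 \<or> p = 2" and f[measurable]: "f \<in> borel_measurable borel"
    and fin: "Lp_int p f < \<infinity>" and e: "e > 0"
  shows "\<exists>g R. continuous_on UNIV g \<and> (\<forall>x. norm x > R \<longrightarrow> g x = 0)
    \<and> Lp_int p (\<lambda>x. f x - g x) < ennreal e"
proof -
  define F where "F = (\<lambda>n::nat. \<lambda>x. if \<bar>f x\<bar> \<le> real n \<and> norm x \<le> real n then f x else 0)"
  have [measurable]: "F n \<in> borel_measurable borel" for n unfolding F_def by measurable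
  have "(\<lambda>n. Lp_int p (\<lambda>x. f x - F n x)) \<longlonglongrightarrow> (\<integral>\<^sup>+x. 0 \<partial>(lborel::'a measure))"
    unfolding Lp_int_def
  proof (rule nn_integral_dominated_convergence[where w = "\<lambda>x. ennreal (\<bar>f x\<bar> ^ p)"])
    show "AE x in lborel. ennreal (\<bar>f x - F n x\<bar> ^ p) \<le> ennreal (\<bar>f x\<bar> ^ p)" for n
      by (auto simp: F_def intro!: ennreal_leI power_mono)
    show "AE x in lborel. (\<lambda>n. ennreal (\<bar>f x - F n x\<bar> ^ p)) \<longlonglongrightarrow> 0"
    proof (rule AE_I2)
      fix x
      obtain n0 :: nat where n0: "max \<bar>f x\<bar> (norm x) \<le> real n0" using real_arch_simple by blast
      have "eventually (\<lambda>n. ennreal (\<bar>f x - F n x\<bar> ^ p) = 0) sequentially"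
        using eventually_ge_at_top[of n0]
      proof eventually_elim
        case (elim n)
        then have "real n0 \<le> real n" by simp
        then have "F n x = f x" using n0 by (simp add: F_def)
        then show ?case using p by auto
      qed
      then show "(\<lambda>n. ennreal (\<bar>f x - F n x\<bar> ^ p)) \<longlonglongrightarrow> 0"
        by (rule tendsto_eventually)
    qed
    show "(\<integral>\<^sup>+x. ennreal (\<bar>f x\<bar> ^ p) \<partial>lborel) < \<infinity>" using fin by (simp add: Lp_int_def)
  qed auto
  then have "eventually (\<lambda>n. Lp_int p (\<lambda>x. f x - F n x) < ennreal (e / 4)) sequentially"
    using e by (intro order_tendstoD(2)[of _ 0]) auto
  then obtain n where n: "Lp_int p (\<lambda>x. f x - F n x) < ennreal (e / 4)"
    using eventually_happens by fastforce
  have "\<exists>g R. continuous_on UNIV g \<and> (\<forall>x. norm x > R \<longrightarrow> g x = 0)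
    \<and> Lp_int p (\<lambda>x. F n x - g x) < ennreal (e / 4)"
    by (rule Lp_int_Cc_approx_bounded[where M = n and R = n])
       (use p e in \<open>auto simp: F_def\<close>)
  then obtain g R where g: "continuous_on UNIV g" "\<And>x. norm x > R \<Longrightarrow> g x = 0"
    "Lp_int p (\<lambda>x. F n x - g x) < ennreal (e / 4)" by blast
  have [measurable]: "g \<in> borel_measurable borel"
    using g(1) borel_measurable_continuous_onI by blast
  have "Lp_int p (\<lambda>x. f x - g x) = Lp_int p (\<lambda>x. (f x - F n x) + (F n x - g x))" by simp
  also have "\<dots> \<le> 2 * (Lp_int p (\<lambda>x. f x - F n x) + Lp_int p (\<lambda>x. F n x - g x))"
    by (rule Lp_int_add[OF p]) auto
  also have "\<dots> < 2 * (ennreal (e / 4) + ennreal (e / 4))"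
    using add_strict_mono[OF n g(3)] by (intro ennreal_mult_strict_left_mono) auto
  also have "\<dots> = ennreal e" using e by (simp flip: ennreal_plus ennreal_numeral ennreal_mult)
  finally show ?thesis using g by blast
qed

lemma Lp_int_translate:
  fixes f :: "'a::euclidean_space \<Rightarrow> real"
  assumes [measurable]: "f \<in> borel_measurable borel"
  shows "Lp_int p (\<lambda>x. f (x - z)) = Lp_int p f"
  unfolding Lp_int_def
  using nn_integral_lborel_translate[of "\<lambda>x. ennreal (\<bar>f x\<bar> ^ p)" "- z"] by simp

lemma Lp_int_uminus: "Lp_int p (\<lambda>x. f x - g x) = Lp_int p (\<lambda>x. g x - f x)"
  unfolding Lp_int_def by (simp add: abs_minus_commute)

lemma Lp_int_translation_continuous:
  fixes f :: "'a::euclidean_space \<Rightarrow> real"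
  assumes p: "p = 1 \<or> p = 2" and f[measurable]: "f \<in> borel_measurable borel"
    and fin: "Lp_int p f < \<infinity>" and e: "e > 0"
  shows "\<exists>d>0. \<forall>z. norm z < d \<longrightarrow> Lp_int p (\<lambda>x. f (x - z) - f x) \<le> ennreal e"
proof -
  \<comment> \<open>Two nested uses of \<open>Lp_int_add\<close> on three errors give 2 * (1 + 2 *
    (1 + 1)) = 10 twelfths of e.\<close>
  have "e / 12 > 0" using e by simp
  from Lp_int_Cc_approx[OF p f fin this] obtain g R where g: "continuous_on UNIV g"
    "\<And>x. norm x > R \<Longrightarrow> g x = 0" "Lp_int p (\<lambda>x. f x - g x) < ennreal (e / 12)" by blast
  have [measurable]: "g \<in> borel_measurable borel"
    using g(1) borel_measurable_continuous_onI by blast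
  define V where "V = measure lborel (cball (0::'a) (R + 1))"
  \<comment> \<open>The cap 1 yields |h|^p <= |h| for increments below \<eta>, and the second bound
    makes \<eta> times the volume V at most e/12.\<close>
  define \<eta> where "\<eta> = min 1 (e / (12 * (V + 1)))"
  have V: "V \<ge> 0" by (simp add: V_def)
  have \<eta>: "\<eta> > 0" using V e by (auto simp: \<eta>_def)
  have "uniformly_continuous_on (cball 0 (R + 2)) g"
    using g(1) by (intro compact_uniformly_continuous) (auto intro: continuous_on_subset)
  then obtain d where d: "d > 0" "\<And>x y. x \<in> cball 0 (R+2) \<Longrightarrow> y \<in> cball 0 (R+2) \<Longrightarrow> dist x y < d
      \<Longrightarrow> dist (g x) (g y) < \<eta>"
    unfolding uniformly_continuous_on_def using \<eta> by metis
  have gz: "Lp_int p (\<lambda>x. g (x - z) - g x) \<le> ennreal (e / 12)" if z: "norm z < min d 1" for z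
  proof -
    have "Lp_int p (\<lambda>x. g (x - z) - g x) \<le> (\<integral>\<^sup>+x. ennreal \<eta> * indicator (cball (0::'a) (R + 1)) x \<partial>lborel)"
      unfolding Lp_int_def
    proof (rule nn_integral_mono)
      fix x
      show "ennreal (\<bar>g (x - z) - g x\<bar> ^ p) \<le> ennreal \<eta> * indicator (cball 0 (R + 1)) x"
      proof (cases "norm x > R + 1")
        case True
        have "norm (x - z) > R" using norm_triangle_ineq2[of x z] True z by linarith
        then show ?thesis using True g(2) p by auto
      next
        case False
        have "norm (x - z) \<le> R + 2" using norm_triangle_ineq4[of x z] False z by linarith
        then have lt: "\<bar>g (x - z) - g x\<bar> < \<eta>"
          using d(2)[of "x - z" x] False z by (auto simp: dist_norm norm_minus_commute[of z x])
        have "\<bar>g (x - z) - g x\<bar> ^ p \<le> \<bar>g (x - z) - g x\<bar>"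
          using p lt power_decreasing[of 1 p "\<bar>g (x - z) - g x\<bar>"] by (auto simp: \<eta>_def)
        then show ?thesis using False lt by (auto simp: indicator_def intro!: ennreal_leI)
      qed
    qed
    also have "\<dots> = ennreal \<eta> * emeasure lborel (cball (0::'a) (R + 1))"
      by (subst nn_integral_cmult_indicator) auto
    also have "\<dots> = ennreal (\<eta> * V)"
      unfolding V_def using \<eta> emeasure_bounded_finite[OF bounded_cball, of "0::'a" "R + 1"]
      by (subst emeasure_eq_ennreal_measure) (auto simp: ennreal_mult)
    also have "\<dots> \<le> ennreal (e / 12)"
    proof (rule ennreal_leI)
      have "\<eta> * V \<le> e / (12 * (V + 1)) * V" using V by (intro mult_right_mono) (auto simp: \<eta>_def)
      also have "\<dots> \<le> e / 12" using V e by (simp add: field_simps)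
      finally show "\<eta> * V \<le> e / 12" .
    qed
    finally show ?thesis .
  qed
  have "Lp_int p (\<lambda>x. f (x - z) - f x) \<le> ennreal e" if z: "norm z < min d 1" for z
  proof -
    have "Lp_int p (\<lambda>x. f (x - z) - f x) =
        Lp_int p (\<lambda>x. (f (x - z) - g (x - z)) + ((g (x - z) - g x) + (g x - f x)))" by simp
    also have "\<dots> \<le> 2 * (Lp_int p (\<lambda>x. f (x - z) - g (x - z)) + Lp_int p (\<lambda>x. (g (x - z) - g x) + (g x - f x)))"
      by (rule Lp_int_add[OF p]) auto
    also have "\<dots> \<le> 2 * (Lp_int p (\<lambda>x. f (x - z) - g (x - z)) +
       2 * (Lp_int p (\<lambda>x. g (x - z) - g x) + Lp_int p (\<lambda>x. g x - f x)))"
      by (intro mult_left_mono add_left_mono Lp_int_add[OF p]) auto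
    also have "\<dots> \<le> 2 * (ennreal (e / 12) + 2 * (ennreal (e / 12) + ennreal (e / 12)))"
      using g(3) gz[OF z] Lp_int_translate[of "\<lambda>x. f x - g x" p z] Lp_int_uminus[of p g f]
      by (intro mult_left_mono add_mono) auto
    also have "\<dots> \<le> ennreal e"
      using e by (simp flip: ennreal_plus ennreal_numeral ennreal_mult)
    finally show ?thesis .
  qed
  then show ?thesis using d(1) by (intro exI[of _ "min d 1"]) auto
qed

section \<open>Convolution with mollifiers\<close>

definition mollifier :: "real \<Rightarrow> ('a::euclidean_space \<Rightarrow> real) \<Rightarrow> bool" where
  "mollifier d \<kappa> \<longleftrightarrow> continuous_on UNIV \<kappa> \<and> (\<forall>z. 0 \<le> \<kappa> z) \<and> (\<forall>z. norm z \<ge> d \<longrightarrow> \<kappa> z = 0) \<and>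
     (\<exists>M. \<forall>z. \<kappa> z \<le> M) \<and> (\<integral>\<^sup>+z. ennreal (\<kappa> z) \<partial>lborel) = 1"

definition convol :: "('a::euclidean_space \<Rightarrow> real) \<Rightarrow> ('a \<Rightarrow> real) \<Rightarrow> 'a \<Rightarrow> real" where
  "convol \<kappa> f x = (\<integral>y. \<kappa> (x - y) * f y \<partial>lborel)"

lemma convol_integrable:
  fixes f :: "'a::euclidean_space \<Rightarrow> real"
  assumes "continuous_on UNIV \<kappa>" "\<And>z. \<bar>\<kappa> z\<bar> \<le> M" "integrable lborel f"
  shows "integrable lborel (\<lambda>y. \<kappa> (x - y) * f y)"
proof (rule Bochner_Integration.integrable_bound[where f = "\<lambda>y. M * f y"])
  have [measurable]: "\<kappa> \<in> borel_measurable borel" "f \<in> borel_measurable borel"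
    using assms borel_measurable_continuous_onI by auto
  show "(\<lambda>y. \<kappa> (x - y) * f y) \<in> borel_measurable lborel" by simp
  have "M \<ge> 0" using assms(2)[of 0] by linarith
  then show "AE y in lborel. norm (\<kappa> (x - y) * f y) \<le> norm (M * f y)"
    using assms(2) by (auto simp: abs_mult intro!: mult_right_mono)
qed (use assms in auto)

text \<open>For p = 2 the kernel is written as sqrt \<kappa> times sqrt \<kappa>, and Cauchy-Schwarz
  together with the total mass 1 gives the bound; for p = 1 it is the triangle inequality for
  integrals.\<close>

lemma jensen_mollifier:
  fixes f :: "'a::euclidean_space \<Rightarrow> real"
  assumes p: "p = 1 \<or> p = 2" and int: "integrable lborel f" and \<kappa>: "mollifier d \<kappa>"
  shows "ennreal (\<bar>convol \<kappa> f x - f x\<bar> ^ p) \<le> (\<integral>\<^sup>+z. ennreal (\<kappa> z) * ennreal (\<bar>f (x - z) - f x\<bar> ^ p) \<partial>lborel)"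
proof -
  have [measurable]: "f \<in> borel_measurable borel" using int by auto
  have c: "continuous_on UNIV \<kappa>" and nn: "\<And>z. 0 \<le> \<kappa> z" and one: "(\<integral>\<^sup>+z. ennreal (\<kappa> z) \<partial>lborel) = 1"
    using \<kappa> by (auto simp: mollifier_def)
  have [measurable]: "\<kappa> \<in> borel_measurable borel" using c borel_measurable_continuous_onI by blast
  obtain M where M: "\<And>z. \<bar>\<kappa> z\<bar> \<le> M" using \<kappa> by (auto simp: mollifier_def)
  have one': "(\<integral>\<^sup>+y. ennreal (\<kappa> (x - y)) \<partial>lborel) = 1"
    using nn_integral_lborel_reflect[of "\<lambda>z. ennreal (\<kappa> z)" x] one by simp
  have hb: "has_bochner_integral lborel (\<lambda>y. \<kappa> (x - y)) 1"
    by (rule has_bochner_integral_nn_integral) (use one' nn in auto)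
  then have \<kappa>i: "integrable lborel (\<lambda>y. \<kappa> (x - y))" "(\<integral>y. \<kappa> (x - y) \<partial>lborel) = 1"
    by (auto simp: has_bochner_integral_iff)
  note ci = convol_integrable[OF c M int, of x]
  have "convol \<kappa> f x - f x = (\<integral>y. \<kappa> (x - y) * f y - \<kappa> (x - y) * f x \<partial>lborel)"
    unfolding convol_def using ci \<kappa>i by (subst Bochner_Integration.integral_diff) auto
  also have "\<dots> = (\<integral>y. \<kappa> (x - y) * (f y - f x) \<partial>lborel)" by (simp add: algebra_simps)
  finally have eq: "convol \<kappa> f x - f x = (\<integral>y. \<kappa> (x - y) * (f y - f x) \<partial>lborel)" .
  have ii: "integrable lborel (\<lambda>y. \<kappa> (x - y) * (f y - f x))"
    using Bochner_Integration.integrable_diff[OF ci, of "\<lambda>y. \<kappa> (x - y) * f x"] \<kappa>i by (simp add: algebra_simps)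
  have "ennreal \<bar>convol \<kappa> f x - f x\<bar> \<le> (\<integral>\<^sup>+y. norm (\<kappa> (x - y) * (f y - f x)) \<partial>lborel)"
    unfolding eq using integral_norm_bound_ennreal[OF ii] by simp
  also have "\<dots> = (\<integral>\<^sup>+y. ennreal (\<kappa> (x - y)) * ennreal \<bar>f y - f x\<bar> \<partial>lborel)"
    using nn by (simp add: abs_mult ennreal_mult)
  finally have b1: "ennreal \<bar>convol \<kappa> f x - f x\<bar> \<le> (\<integral>\<^sup>+y. ennreal (\<kappa> (x - y)) * ennreal \<bar>f y - f x\<bar> \<partial>lborel)" .
  have "ennreal (\<bar>convol \<kappa> f x - f x\<bar> ^ p) \<le> (\<integral>\<^sup>+y. ennreal (\<kappa> (x - y)) * ennreal (\<bar>f y - f x\<bar> ^ p) \<partial>lborel)"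
    using p
  proof
    assume p2: "p = 2"
    have "ennreal (\<bar>convol \<kappa> f x - f x\<bar> ^ p) = (ennreal \<bar>convol \<kappa> f x - f x\<bar>)\<^sup>2"
      unfolding p2 by (subst ennreal_power) auto
    also have "\<dots> \<le> (\<integral>\<^sup>+y. ennreal (\<kappa> (x - y)) * ennreal \<bar>f y - f x\<bar> \<partial>lborel)\<^sup>2"
      by (intro power_mono_ennreal b1)
    also have "(\<integral>\<^sup>+y. ennreal (\<kappa> (x - y)) * ennreal \<bar>f y - f x\<bar> \<partial>lborel) =
        (\<integral>\<^sup>+y. ennreal (sqrt (\<kappa> (x - y))) * ennreal (sqrt (\<kappa> (x - y)) * \<bar>f y - f x\<bar>) \<partial>lborel)"
      using nn by (simp flip: ennreal_mult add: mult.assoc[symmetric])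
    also have "\<dots>\<^sup>2 \<le> (\<integral>\<^sup>+y. (ennreal (sqrt (\<kappa> (x - y))))\<^sup>2 \<partial>lborel) * (\<integral>\<^sup>+y. (ennreal (sqrt (\<kappa> (x - y)) * \<bar>f y - f x\<bar>))\<^sup>2 \<partial>lborel)"
      by (rule Cauchy_Schwarz_nn_integral) auto
    also have "\<dots> = (\<integral>\<^sup>+y. ennreal (\<kappa> (x - y)) * ennreal (\<bar>f y - f x\<bar> ^ p) \<partial>lborel)"
      using nn one' unfolding p2 by (simp add: ennreal_power power_mult_distrib ennreal_mult)
    finally show ?thesis .
  qed (use b1 in simp)
  also have "\<dots> = (\<integral>\<^sup>+z. ennreal (\<kappa> z) * ennreal (\<bar>f (x - z) - f x\<bar> ^ p) \<partial>lborel)"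
    using nn_integral_lborel_reflect[of "\<lambda>z. ennreal (\<kappa> z) * ennreal (\<bar>f (x - z) - f x\<bar> ^ p)" x] by simp
  finally show ?thesis .
qed

text \<open>The radius d depends on f and e but not on the shape of the kernel, so one kernel can
  serve finitely many functions at once. Jensen and Fubini turn the error into an average of
  translation errors over norm z < d.\<close>

lemma mollifier_convergence:
  fixes f :: "'a::euclidean_space \<Rightarrow> real"
  assumes p: "p = 1 \<or> p = 2" and int: "integrable lborel f"
    and fin: "Lp_int p f < \<infinity>" and e: "e > 0"
  shows "\<exists>d>0. \<forall>\<kappa>. mollifier d \<kappa> \<longrightarrow> Lp_int p (\<lambda>x. convol \<kappa> f x - f x) \<le> ennreal e"
proof -
  have f[measurable]: "f \<in> borel_measurable borel" using int by auto
  obtain d where d: "d > 0" "\<And>z. norm z < d \<Longrightarrow> Lp_int p (\<lambda>x. f (x - z) - f x) \<le> ennreal e"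
    using Lp_int_translation_continuous[OF p f fin e] by blast
  have "Lp_int p (\<lambda>x. convol \<kappa> f x - f x) \<le> ennreal e" if \<kappa>: "mollifier d \<kappa>" for \<kappa>
  proof -
    have nn: "\<And>z. 0 \<le> \<kappa> z" and one: "(\<integral>\<^sup>+z. ennreal (\<kappa> z) \<partial>lborel) = 1"
      and supp: "\<And>z. norm z \<ge> d \<Longrightarrow> \<kappa> z = 0" and c: "continuous_on UNIV \<kappa>"
      using \<kappa> by (auto simp: mollifier_def)
    have [measurable]: "\<kappa> \<in> borel_measurable borel" using c borel_measurable_continuous_onI by blast
    have "Lp_int p (\<lambda>x. convol \<kappa> f x - f x) \<le>
        (\<integral>\<^sup>+x. (\<integral>\<^sup>+z. ennreal (\<kappa> z) * ennreal (\<bar>f (x - z) - f x\<bar> ^ p) \<partial>lborel) \<partial>lborel)"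
      unfolding Lp_int_def by (intro nn_integral_mono jensen_mollifier[OF p int \<kappa>])
    also have "\<dots> = (\<integral>\<^sup>+z. (\<integral>\<^sup>+x. ennreal (\<kappa> z) * ennreal (\<bar>f (x - z) - f x\<bar> ^ p) \<partial>lborel) \<partial>lborel)"
      by (rule lborel_pair.Fubini') measurable
    also have "\<dots> = (\<integral>\<^sup>+z. ennreal (\<kappa> z) * Lp_int p (\<lambda>x. f (x - z) - f x) \<partial>lborel)"
      unfolding Lp_int_def by (simp add: nn_integral_cmult)
    also have "\<dots> \<le> (\<integral>\<^sup>+z. ennreal (\<kappa> z) * ennreal e \<partial>lborel)"
    proof (rule nn_integral_mono)
      fix z
      show "ennreal (\<kappa> z) * Lp_int p (\<lambda>x. f (x - z) - f x) \<le> ennreal (\<kappa> z) * ennreal e"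
        using d(2)[of z] supp[of z] by (cases "norm z < d") (auto intro: mult_left_mono)
    qed
    also have "\<dots> = ennreal e" using one by (simp add: nn_integral_multc)
    finally show ?thesis .
  qed
  with d(1) show ?thesis by blast
qed

section \<open>Mollification with product bumps\<close>

lemma prod_bump_bounded: obtains M where "M \<ge> 0" "\<And>y. \<bar>prod_bump s p i j y\<bar> \<le> M"
proof -
  obtain M1 where M1: "M1 > 0" "\<And>t. \<bar>psi i t\<bar> \<le> M1" using psi_bounded[of i] by blast
  obtain M2 where M2: "M2 > 0" "\<And>t. \<bar>psi j t\<bar> \<le> M2" using psi_bounded[of j] by blast
  note M = M1 M2
  show ?thesis
  proof (rule that[of "M1 * M2"])
    show "\<bar>prod_bump s p i j y\<bar> \<le> M1 * M2" for y
      unfolding prod_bump_def abs_mult using M by (intro mult_mono) auto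
  qed (use M in simp)
qed

lemma taylor1_bound:
  fixes f g h :: "real \<Rightarrow> real"
  assumes f: "\<And>t. (f has_real_derivative g t) (at t)" and g: "\<And>t. (g has_real_derivative h t) (at t)"
    and M: "\<And>t. \<bar>h t\<bar> \<le> M"
  shows "\<bar>f 1 - f 0 - g 0\<bar> \<le> M"
proof -
  have M0: "M \<ge> 0" using M[of 0] by linarith
  have gl: "\<bar>g t - g 0\<bar> \<le> M" if "t \<in> {0..1}" for t
  proof -
    have "norm (g t - g 0) \<le> M * norm (t - 0)"
      by (rule field_differentiable_bound[where S = UNIV and f' = h]) (use g M in auto)
    also have "\<dots> \<le> M * 1" using that M0 by (intro mult_left_mono) auto
    finally show ?thesis by simp
  qed
  have "norm ((f 1 - 1 * g 0) - (f 0 - 0 * g 0)) \<le> M * norm (1 - 0 :: real)"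
  proof (rule field_differentiable_bound[where S = "{0..1}" and f' = "\<lambda>t. g t - g 0"])
    show "((\<lambda>t. f t - t * g 0) has_real_derivative g t - g 0) (at t within {0..1})" for t
      by (auto intro!: derivative_eq_intros DERIV_subset[OF f])
    show "norm (g t - g 0) \<le> M" if "t \<in> {0..1}" for t using gl[OF that] by simp
  qed auto
  then show ?thesis by simp
qed

text \<open>The quadratic remainder is uniform in the base point z, since all second derivatives of
  the bump are bounded. Uniformity is what allows integration against an f that is merely
  integrable.\<close>

lemma prod_bump_remainder:
  "\<exists>M\<ge>0. \<forall>z h. \<bar>prod_bump s p i j (z + h) - prod_bump s p i j z -
      (s * prod_bump s p (Suc i) j z * Re h + s * prod_bump s p i (Suc j) z * Im h)\<bar> \<le> M * (norm h)\<^sup>2"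
proof -
  let ?B = "prod_bump s p"
  obtain M1 where M1: "M1 \<ge> 0" "\<And>y. \<bar>?B (Suc (Suc i)) j y\<bar> \<le> M1" using prod_bump_bounded[of s p "Suc (Suc i)" j] by blast
  obtain M2 where M2: "M2 \<ge> 0" "\<And>y. \<bar>?B (Suc i) (Suc j) y\<bar> \<le> M2" using prod_bump_bounded[of s p "Suc i" "Suc j"] by blast
  obtain M3 where M3: "M3 \<ge> 0" "\<And>y. \<bar>?B i (Suc (Suc j)) y\<bar> \<le> M3" using prod_bump_bounded[of s p i "Suc (Suc j)"] by blast
  note M = M1(2) M2(2) M3(2) M1(1) M2(1) M3(1)
  define M where "M = s\<^sup>2 * (M1 + 2 * M2 + M3)"
  have line: "((\<lambda>t. ?B i j (z + t *\<^sub>R h)) has_real_derivative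
      (s * Re h * ?B (Suc i) j (z + t *\<^sub>R h) + s * Im h * ?B i (Suc j) (z + t *\<^sub>R h))) (at t)" for i j z h t
  proof -
    have "((\<lambda>t. ?B i j (z + t *\<^sub>R h)) has_derivative
      (\<lambda>d. s * ?B (Suc i) j (z + t *\<^sub>R h) * Re (d *\<^sub>R h) + s * ?B i (Suc j) (z + t *\<^sub>R h) * Im (d *\<^sub>R h))) (at t)"
      using prod_bump_has_derivative
      by (intro has_derivative_compose[of "\<lambda>t. z + t *\<^sub>R h" "\<lambda>d. d *\<^sub>R h" t UNIV "?B i j"
          "\<lambda>k. s * ?B (Suc i) j (z + t *\<^sub>R h) * Re k + s * ?B i (Suc j) (z + t *\<^sub>R h) * Im k"])
         (auto intro!: derivative_eq_intros)
    then show ?thesis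
      by (rule has_derivative_imp_has_field_derivative) (simp add: algebra_simps)
  qed
  have "\<bar>?B i j (z + h) - ?B i j z - (s * ?B (Suc i) j z * Re h + s * ?B i (Suc j) z * Im h)\<bar> \<le> M * (norm h)\<^sup>2" for z h
  proof -
    define g where "g = (\<lambda>t. s * Re h * ?B (Suc i) j (z + t *\<^sub>R h) + s * Im h * ?B i (Suc j) (z + t *\<^sub>R h))"
    define k where "k = (\<lambda>t. s * Re h * (s * Re h * ?B (Suc (Suc i)) j (z + t *\<^sub>R h) + s * Im h * ?B (Suc i) (Suc j) (z + t *\<^sub>R h))
      + s * Im h * (s * Re h * ?B (Suc i) (Suc j) (z + t *\<^sub>R h) + s * Im h * ?B i (Suc (Suc j)) (z + t *\<^sub>R h)))"
    have "\<bar>?B i j (z + 1 *\<^sub>R h) - ?B i j (z + 0 *\<^sub>R h) - g 0\<bar> \<le> M * (norm h)\<^sup>2"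
    proof (rule taylor1_bound)
      show "((\<lambda>t. ?B i j (z + t *\<^sub>R h)) has_real_derivative g t) (at t)" for t
        unfolding g_def by (rule line)
      show "(g has_real_derivative k t) (at t)" for t
        unfolding g_def k_def by (intro DERIV_add DERIV_cmult line)
      show "\<bar>k t\<bar> \<le> M * (norm h)\<^sup>2" for t
      proof -
        let ?z = "z + t *\<^sub>R h"
        have n: "\<bar>Re h\<bar> \<le> norm h" "\<bar>Im h\<bar> \<le> norm h" by (auto simp: abs_Re_le_cmod abs_Im_le_cmod)
        have b: "\<bar>u * v * w\<bar> \<le> norm h * norm h * N" if "\<bar>u\<bar> \<le> norm h" "\<bar>v\<bar> \<le> norm h" "\<bar>w\<bar> \<le> N" for u v w N :: real
          unfolding abs_mult using that by (intro mult_mono) auto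
        have "k t = s\<^sup>2 * (Re h * Re h * ?B (Suc (Suc i)) j ?z + 2 * (Re h * Im h * ?B (Suc i) (Suc j) ?z) + Im h * Im h * ?B i (Suc (Suc j)) ?z)"
          unfolding k_def by (simp add: power2_eq_square algebra_simps)
        then have "\<bar>k t\<bar> = s\<^sup>2 * \<bar>Re h * Re h * ?B (Suc (Suc i)) j ?z + 2 * (Re h * Im h * ?B (Suc i) (Suc j) ?z) + Im h * Im h * ?B i (Suc (Suc j)) ?z\<bar>"
          by (simp add: abs_mult)
        also have "\<dots> \<le> s\<^sup>2 * (norm h * norm h * M1 + 2 * (norm h * norm h * M2) + norm h * norm h * M3)"
          using b[OF n(1) n(1) M(1), of ?z] b[OF n(1) n(2) M(2), of ?z] b[OF n(2) n(2) M(3), of ?z]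
          by (intro mult_left_mono) auto
        also have "\<dots> = M * (norm h)\<^sup>2" by (simp add: M_def power2_eq_square algebra_simps)
        finally show ?thesis .
      qed
    qed
    then show ?thesis by (simp add: g_def algebra_simps)
  qed
  moreover have "M \<ge> 0" using M by (simp add: M_def)
  ultimately show ?thesis by blast
qed

text \<open>Integrating the uniform remainder against |f| gives an error of order (norm h)^2, which
  is differentiation under the integral sign.\<close>

lemma convol_prod_bump_has_derivative:
  assumes f: "integrable lborel f"
  shows "(convol (prod_bump s 0 i j) f has_derivative
     (dxy (s * convol (prod_bump s 0 (Suc i) j) f x) (s * convol (prod_bump s 0 i (Suc j)) f x))) (at x)"
proof -
  let ?B = "prod_bump s 0"
  let ?L = "\<lambda>h. s * convol (?B (Suc i) j) f x * Re h + s * convol (?B i (Suc j)) f x * Im h"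
  obtain M where M: "M \<ge> 0" "\<And>z h. \<bar>?B i j (z + h) - ?B i j z - (s * ?B (Suc i) j z * Re h + s * ?B i (Suc j) z * Im h)\<bar> \<le> M * (norm h)\<^sup>2"
    using prod_bump_remainder by blast
  have ci: "integrable lborel (\<lambda>y. ?B i j (x - y) * f y)" for i j x
  proof -
    obtain M where "\<And>y. \<bar>?B i j y\<bar> \<le> M" using prod_bump_bounded[of s 0 i j] by blast
    then show ?thesis by (rule convol_integrable[OF prod_bump_continuous _ f])
  qed
  have hb: "has_bochner_integral lborel (\<lambda>y. ?B i j (x - y) * f y) (convol (?B i j) f x)" for i j x
    unfolding convol_def using ci by (rule has_bochner_integral_integrable)
  define N where "N = (\<integral>y. \<bar>f y\<bar> \<partial>lborel)"
  have rem: "norm (convol (?B i j) f (x + h) - convol (?B i j) f x - ?L h) \<le> M * N * (norm h)\<^sup>2" for h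
  proof -
    let ?r = "\<lambda>y. ?B i j (x + h - y) - ?B i j (x - y) - (s * ?B (Suc i) j (x - y) * Re h + s * ?B i (Suc j) (x - y) * Im h)"
    have fe: "(\<lambda>y. ?r y * f y) = (\<lambda>y. (?B i j (x + h - y) * f y - ?B i j (x - y) * f y) -
          (s * Re h * (?B (Suc i) j (x - y) * f y) + s * Im h * (?B i (Suc j) (x - y) * f y)))"
      by (intro ext) algebra
    have "has_bochner_integral lborel (\<lambda>y. ?r y * f y) ((convol (?B i j) f (x + h) - convol (?B i j) f x) -
        (s * Re h * convol (?B (Suc i) j) f x + s * Im h * convol (?B i (Suc j)) f x))"
      unfolding fe
      by (intro has_bochner_integral_diff has_bochner_integral_add has_bochner_integral_mult_right hb)
    then have i1: "integrable lborel (\<lambda>y. ?r y * f y)"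
      and eq: "convol (?B i j) f (x + h) - convol (?B i j) f x - ?L h = (\<integral>y. ?r y * f y \<partial>lborel)"
      by (auto simp: has_bochner_integral_iff mult.commute mult.left_commute)
    have "norm (\<integral>y. ?r y * f y \<partial>lborel) \<le> (\<integral>y. norm (?r y * f y) \<partial>lborel)"
      by (rule integral_norm_bound)
    also have "\<dots> \<le> (\<integral>y. M * (norm h)\<^sup>2 * \<bar>f y\<bar> \<partial>lborel)"
    proof (rule integral_mono)
      show "integrable lborel (\<lambda>y. norm (?r y * f y))" using i1 by (rule integrable_norm)
      show "integrable lborel (\<lambda>y. M * (norm h)\<^sup>2 * \<bar>f y\<bar>)" using f by simp
      show "norm (?r y * f y) \<le> M * (norm h)\<^sup>2 * \<bar>f y\<bar>" for y
      proof -
        have "\<bar>?r y\<bar> \<le> M * (norm h)\<^sup>2" using M(2)[of "x - y" h] by (simp add: algebra_simps)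
        then show ?thesis unfolding real_norm_def abs_mult by (intro mult_right_mono) auto
      qed
    qed
    also have "\<dots> = M * N * (norm h)\<^sup>2" by (simp add: N_def)
    finally show ?thesis unfolding eq .
  qed
  show ?thesis unfolding has_derivative_at
  proof
    show "bounded_linear ?L"
      by (intro bounded_linear_add bounded_linear_const_mult bounded_linear_Re bounded_linear_Im)
    show "(\<lambda>h. norm (convol (?B i j) f (x + h) - convol (?B i j) f x - ?L h) / norm h) \<midarrow>0\<rightarrow> 0"
    proof (rule Lim_null_comparison)
      show "eventually (\<lambda>h. norm (norm (convol (?B i j) f (x + h) - convol (?B i j) f x - ?L h) / norm h) \<le> M * N * norm h) (at 0)"
      proof (rule always_eventually, rule allI)
        fix h :: complex
        show "norm (norm (convol (?B i j) f (x + h) - convol (?B i j) f x - ?L h) / norm h) \<le> M * N * norm h"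
          using rem[of h] by (cases "h = 0") (simp_all add: divide_simps power2_eq_square mult_ac)
      qed
      show "((\<lambda>h::complex. M * N * norm h) \<longlongrightarrow> 0) (at 0)"
        by (auto intro!: tendsto_eq_intros)
    qed
  qed
qed

abbreviation bump :: "real \<Rightarrow> nat \<Rightarrow> nat \<Rightarrow> complex \<Rightarrow> real" where
  "bump e \<equiv> prod_bump (1 / e) 0"

text \<open>The square where |Re z| and |Im z| are below e lies in the disc of radius 2e; this is
  the origin of the conditions \<open>cball x (2 * e) \<subseteq> \<Omega>\<close> below.\<close>

lemma prod_bump_support:
  assumes "e > 0" "norm z \<ge> 2 * e"
  shows "bump e i j z = 0"
proof -
  have "\<bar>Re z\<bar> \<ge> e \<or> \<bar>Im z\<bar> \<ge> e" using cmod_le[of z] assms by linarith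
  then have "\<bar>1 / e * Re z + Re 0\<bar> \<ge> 1 \<or> \<bar>1 / e * Im z + Im 0\<bar> \<ge> 1"
    using assms by (auto simp: abs_mult field_simps)
  then show ?thesis unfolding prod_bump_def using psi_zero by auto
qed

section \<open>The normalised bump as a mollifier\<close>

definition bump_mass :: "real \<Rightarrow> real" where
  "bump_mass e = (\<integral>z. bump e 0 0 z \<partial>lborel)"

definition bump_kernel :: "real \<Rightarrow> complex \<Rightarrow> real" where
  "bump_kernel e z = bump e 0 0 z / bump_mass e"

lemma prod_bump_nonneg: "prod_bump s p 0 0 z \<ge> 0"
  using psi_0 by (simp add: prod_bump_def)

lemma prod_bump_integrable:
  assumes e: "e > 0"
  shows "integrable lborel (bump e i j)"
proof -
  have "integrable lborel (\<lambda>x. indicator (cball 0 (2 * e)) x *\<^sub>R bump e i j x)"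
    by (intro borel_integrable_compact prod_bump_continuous) auto
  moreover have "(\<lambda>x. indicator (cball 0 (2 * e)) x *\<^sub>R bump e i j x) = bump e i j"
    using prod_bump_support[OF e] by (intro ext) (auto simp: indicator_def)
  ultimately show ?thesis by (simp only:)
qed

text \<open>A nonnegative integrable function with integral 0 vanishes almost everywhere, but this
  one is positive on the disc of radius e, which is not negligible.\<close>

lemma bump_mass_pos:
  assumes e: "e > 0"
  shows "bump_mass e > 0"
proof -
  have [measurable]: "bump e 0 0 \<in> borel_measurable borel"
    using prod_bump_continuous borel_measurable_continuous_onI by blast
  have "bump_mass e \<noteq> 0"
  proof
    assume "bump_mass e = 0"
    then have ae: "AE z in lborel. bump e 0 0 z = 0"
      unfolding bump_mass_def
      using integral_nonneg_eq_0_iff_AE[OF prod_bump_integrable[OF e, of 0 0]] prod_bump_nonneg by auto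
    have "ball (0::complex) e \<subseteq> {z. bump e 0 0 z \<noteq> 0}"
    proof
      fix z :: complex assume "z \<in> ball 0 e"
      then have "\<bar>Re z\<bar> < e" "\<bar>Im z\<bar> < e"
        using abs_Re_le_cmod[of z] abs_Im_le_cmod[of z] by auto
      then have "\<bar>1 / e * Re z + Re 0\<bar> < 1" "\<bar>1 / e * Im z + Im 0\<bar> < 1"
        using e by (auto simp: abs_mult field_simps)
      then have "bump e 0 0 z > 0"
        unfolding prod_bump_def by (intro mult_pos_pos psi_0(2))
      then show "z \<in> {z. bump e 0 0 z \<noteq> 0}" by simp
    qed
    moreover have "negligible {z. bump e 0 0 z \<noteq> 0}"
    proof -
      have "{z \<in> space lborel. bump e 0 0 z \<noteq> 0} \<in> sets lborel" by measurable
      then have "{z. bump e 0 0 z \<noteq> 0} \<in> null_sets lborel"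
        using ae by (subst AE_iff_null_sets) auto
      then show ?thesis
        unfolding negligible_iff_null_sets by (rule null_sets_completionI)
    qed
    ultimately show False using negligible_subset open_not_negligible[of "ball (0::complex) e"] e by auto
  qed
  moreover have "bump_mass e \<ge> 0" unfolding bump_mass_def by (intro integral_nonneg_AE) (simp add: prod_bump_nonneg)
  ultimately show ?thesis by simp
qed

lemma mollifier_bump_kernel:
  assumes e: "e > 0"
  shows "mollifier (2 * e) (bump_kernel e)"
  unfolding mollifier_def
proof (intro conjI allI impI)
  note m = bump_mass_pos[OF e]
  show "continuous_on UNIV (bump_kernel e)"
    unfolding bump_kernel_def using m by (intro continuous_intros prod_bump_continuous) auto
  show "0 \<le> bump_kernel e z" for z using m prod_bump_nonneg by (simp add: bump_kernel_def)
  show "bump_kernel e z = 0" if "2 * e \<le> norm z" for z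
    using prod_bump_support[OF e that] by (simp add: bump_kernel_def)
  obtain M where "\<And>y. \<bar>bump e 0 0 y\<bar> \<le> M" using prod_bump_bounded[of "1/e" 0 0 0] by blast
  then have "bump_kernel e z \<le> M / bump_mass e" for z
    unfolding bump_kernel_def using m abs_le_D1 by (intro divide_right_mono) auto
  then show "\<exists>M. \<forall>z. bump_kernel e z \<le> M" by blast
  have "(\<integral>\<^sup>+z. ennreal (bump_kernel e z) \<partial>lborel) = ennreal (\<integral>z. bump_kernel e z \<partial>lborel)"
    using m prod_bump_nonneg prod_bump_integrable[OF e]
    by (intro nn_integral_eq_integral) (auto simp: bump_kernel_def)
  also have "(\<integral>z. bump_kernel e z \<partial>lborel) = 1"
    using m unfolding bump_kernel_def by (simp add: bump_mass_def)
  finally show "(\<integral>\<^sup>+z. ennreal (bump_kernel e z) \<partial>lborel) = 1" by simp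
qed

lemma convol_bump_kernel:
  "convol (bump_kernel e) f x = convol (bump e 0 0) f x / bump_mass e"
  unfolding convol_def bump_kernel_def by simp

section \<open>The weighted estimate for smooth functions\<close>

text \<open>The fundamental theorem of calculus and Cauchy-Schwarz on an interval of length 1, so no
  length factor appears. It serves dilations on [1, 2] and Taylor remainders on [0, 1].\<close>

lemma ftc_square_bound:
  fixes F g :: "real \<Rightarrow> real"
  assumes F: "\<And>t. s \<le> t \<Longrightarrow> t \<le> s + 1 \<Longrightarrow> (F has_real_derivative g t) (at t)"
    and g: "\<And>t. s \<le> t \<Longrightarrow> t \<le> s + 1 \<Longrightarrow> isCont g t"
  shows "ennreal ((F (s + 1) - F s)\<^sup>2) \<le> (set_int {s..s + 1} (\<lambda>t. (g t)\<^sup>2))"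
proof -
  let ?g = "\<lambda>t. g t * indicator {s..s+1} t"
  have hb: "has_bochner_integral lborel ?g (F (s + 1) - F s)"
    by (rule has_bochner_integral_FTC_Icc_real) (use F g in auto)
  then have i: "integrable lborel ?g" and eq: "F (s + 1) - F s = (\<integral>t. ?g t \<partial>lborel)"
    by (auto simp: has_bochner_integral_iff)
  have [measurable]: "?g \<in> borel_measurable borel" using i by auto
  have "ennreal \<bar>F (s + 1) - F s\<bar> \<le> (\<integral>\<^sup>+t. norm (?g t) \<partial>lborel)"
    unfolding eq using integral_norm_bound_ennreal[OF i] by simp
  also have "\<dots> = (set_int {s..s+1} (\<lambda>t. \<bar>?g t\<bar>))"
    by (intro nn_integral_cong) (auto simp: indicator_def)
  finally have "(ennreal \<bar>F (s + 1) - F s\<bar>)\<^sup>2 \<le> (set_int {s..s+1} (\<lambda>t. \<bar>?g t\<bar>))\<^sup>2"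
    by (intro power_mono_ennreal)
  also have "\<dots> \<le> (\<integral>\<^sup>+t. (ennreal \<bar>?g t\<bar>)\<^sup>2 \<partial>lborel) * (\<integral>\<^sup>+t. (indicator {s..s+1} t)\<^sup>2 \<partial>lborel)"
    by (rule Cauchy_Schwarz_nn_integral) auto
  also have "(\<integral>\<^sup>+t. (indicator {s..s+1} t)\<^sup>2 \<partial>(lborel::real measure)) = (\<integral>\<^sup>+t. indicator {s..s+1} t \<partial>(lborel::real measure))"
    by (intro nn_integral_cong) (auto simp: indicator_def)
  also have "\<dots> = 1" by simp
  also have "(\<integral>\<^sup>+t. (ennreal \<bar>?g t\<bar>)\<^sup>2 \<partial>lborel) = (set_int {s..s + 1} (\<lambda>t. (g t)\<^sup>2))"
    by (intro nn_integral_cong) (auto simp: indicator_def ennreal_power)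
  finally show ?thesis by (simp add: ennreal_power)
qed

text \<open>Finiteness of x is essential: for x infinite the second hypothesis holds for every
  y.\<close>

lemma ennreal_absorb_half:
  assumes "x < (\<infinity>::ennreal)" "x \<le> y + ennreal (1/2) * x"
  shows "x \<le> 2 * y"
proof (cases y)
  case (real r)
  obtain u where u: "x = ennreal u" "u \<ge> 0" using assms(1) by (cases x) auto
  have h: "ennreal (1/2 * u) = ennreal (1/2) * ennreal u" by (rule ennreal_mult) (use u in auto)
  have "ennreal u \<le> ennreal (r + 1/2 * u)"
    using assms(2) u real by (subst ennreal_plus) (auto simp only: h)
  then have "u \<le> 2 * r" using u real by (subst (asm) ennreal_le_iff) auto
  then have "ennreal u \<le> ennreal (2 * r)" by (rule ennreal_leI)
  then show ?thesis using u real by (simp add: ennreal_mult)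
next
  case top
  then show ?thesis by (simp add: ennreal_mult_top)
qed

lemma ennreal_lincomb:
  assumes "0 \<le> c" "0 \<le> x" "0 \<le> y"
  shows "ennreal (c * x + c * y) = ennreal c * ennreal x + ennreal c * ennreal y"
  using assms by (simp only: ennreal_plus mult_nonneg_nonneg ennreal_mult)

section \<open>Size and scaling of the weights\<close>

lemma neck_weight_nonneg [simp]: "0 \<le> neck_weight s a b x"
  by (simp add: neck_weight_def)

lemma neck_weight_le_2:
  assumes "0 < a" "a \<le> norm x" "norm x \<le> b" "0 \<le> s"
  shows "neck_weight s a b x \<le> 2"
proof -
  have "norm x > 0" using assms by linarith
  then have "(norm x / b) powr s \<le> 1" "(a / norm x) powr s \<le> 1"
    using assms by (auto intro!: powr_le1)
  then show ?thesis by (simp add: neck_weight_def)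
qed

text \<open>The summand (a / norm x)^s alone suffices: it does not degenerate near the inner
  boundary. Hence the weight is comparable to a constant there, whatever the ratio b/a.\<close>

lemma neck_weight_ge:
  assumes "0 < a" "0 < norm x" "norm x \<le> c * a" "0 \<le> s"
  shows "c powr (- s) \<le> neck_weight s a b x"
proof -
  have c: "c > 0" using assms by (metis mult_nonpos_nonneg not_le less_imp_le order.strict_trans2)
  have "c powr (- s) = (1 / c) powr s" using c by (simp add: powr_minus powr_divide inverse_eq_divide)
  also have "\<dots> \<le> (a / norm x) powr s"
    using assms c by (intro powr_mono2) (auto simp: field_simps)
  also have "\<dots> \<le> neck_weight s a b x" by (simp add: neck_weight_def)
  finally show ?thesis .
qed

text \<open>Under dilation by t one summand gains t^s and the other loses t^s, so in either
  direction the sum changes by at most the factor t^s.\<close>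

lemma neck_weight_scale:
  assumes "0 < a" "0 < b" "1 \<le> t" "0 \<le> s"
  shows "neck_weight s a b (t *\<^sub>R x) \<le> t powr s * neck_weight s a b x"
    and "neck_weight s a b x \<le> t powr s * neck_weight s a b (t *\<^sub>R x)"
proof -
  have 1: "(norm (t *\<^sub>R x) / b) powr s = t powr s * (norm x / b) powr s"
    using assms by (simp add: powr_mult powr_divide)
  have 2: "(a / norm x) powr s = t powr s * (a / norm (t *\<^sub>R x)) powr s"
    using assms by (simp add: powr_mult powr_divide)
  have t: "t powr s \<ge> 1" using assms ge_one_powr_ge_zero by blast
  have t2: "A \<le> t powr s * A" if "A \<ge> 0" for A using mult_right_mono[OF t that] by simp
  show "neck_weight s a b (t *\<^sub>R x) \<le> t powr s * neck_weight s a b x"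
    using t2[of "(a / norm (t *\<^sub>R x)) powr s"] t2[of "t powr s * (a / norm (t *\<^sub>R x)) powr s"]
    unfolding neck_weight_def 1 2 distrib_left by auto
  show "neck_weight s a b x \<le> t powr s * neck_weight s a b (t *\<^sub>R x)"
    using t2[of "(norm x / b) powr s"] t2[of "t powr s * (norm x / b) powr s"]
    unfolding neck_weight_def 1 2 distrib_left by auto
qed

lemma neck_weight_measurable[measurable]: "neck_weight s a b \<in> borel_measurable borel"
  unfolding neck_weight_def by measurable

text \<open>The exponent e is separate from s because conjugation by norm x powr k shifts e by -2k
  and leaves s alone. The function r^k u, its gradient and its Hessian carry e = -4-2k, -2-2k and
  -2k.\<close>

definition radial_weight :: "real \<Rightarrow> real \<Rightarrow> real \<Rightarrow> real \<Rightarrow> complex \<Rightarrow> real" where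
  "radial_weight e s a b x = norm x powr e * neck_weight s a b x"

lemma radial_weight_measurable[measurable]: "radial_weight e s a b \<in> borel_measurable borel"
  unfolding radial_weight_def by measurable

lemma radial_weight_nonneg: "radial_weight e s a b x \<ge> 0"
  by (simp add: radial_weight_def)

lemma annulus_open: "open (annulus a b)"
  by (simp add: annulus_def open_Diff)

lemma annulus_measurable[measurable]: "annulus a b \<in> sets borel"
  using annulus_open by simp

lemma mem_annulus: "x \<in> annulus a b \<longleftrightarrow> a < norm x \<and> norm x < b"
  by (auto simp: annulus_def)

lemma isCont_off_zero:
  fixes f :: "'a::real_normed_vector \<Rightarrow> real"
  assumes "continuous_on (- {0}) f" "x \<noteq> 0"
  shows "isCont f x"
proof -
  have "open (- {0::'a})" by (simp add: open_Compl)
  then show ?thesis using assms continuous_on_eq_continuous_at by blast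
qed

text \<open>On norm x > 2a' substitute x = 2y and write P(2y) as P(y) plus the increment along the
  ray. The first part returns at most half of the left side; the increment is a ray integral of the
  gradient of P and is paid for by the last term. The shell next to a' is all that remains.\<close>

lemma hardy_dilation:
  fixes P P1 P2 :: "complex \<Rightarrow> real"
  assumes ab: "0 < a" "0 < b" "0 < a'" "a' < b'" and \<gamma>: "0 \<le> \<gamma>" "\<gamma> \<le> 1" and k: "2 \<le> k"
    and P: "\<And>x. x \<noteq> 0 \<Longrightarrow> (P has_derivative (dxy (P1 x) (P2 x))) (at x)"
    and c: "continuous_on (- {0}) P1" "continuous_on (- {0}) P2"
    and [measurable]: "P \<in> borel_measurable borel" "P1 \<in> borel_measurable borel" "P2 \<in> borel_measurable borel"
  defines "\<rho> \<equiv> radial_weight (- 2 - 2 * k) (2 * \<gamma>) a b" and "\<sigma> \<equiv> radial_weight (- 2 * k) (2 * \<gamma>) a b"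
  shows "(set_int (annulus a' b') (\<lambda>x. (P x)\<^sup>2 * \<rho> x)) \<le>
      2 * ((set_int (shell a' 2) (\<lambda>x. (P x)\<^sup>2 * \<rho> x)) +
      ennreal (2 * 4 powr k) * (set_int (annulus a' b') (\<lambda>x. ((P1 x)\<^sup>2 + (P2 x)\<^sup>2) * \<sigma> x)))"
    (is "?I \<le> 2 * (?Inner + ennreal (2 * 4 powr k) * ?H)")
proof (rule ennreal_absorb_half)
  have [measurable]: "\<rho> \<in> borel_measurable borel" "\<sigma> \<in> borel_measurable borel"
    by (auto simp: \<rho>_def \<sigma>_def)
  have nn: "\<rho> x \<ge> 0" "\<sigma> x \<ge> 0" for x by (auto simp: \<rho>_def \<sigma>_def radial_weight_nonneg)
  have Pc: "continuous_on (- {0}) P"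
    by (intro continuous_at_imp_continuous_on ballI has_derivative_continuous[OF P]) auto
  have \<rho>c: "continuous_on (- {0}) \<rho>"
    unfolding \<rho>_def radial_weight_def neck_weight_def using ab
    by (intro continuous_intros) auto
  \<comment> \<open>Required by the absorption: on the closed annulus, compact and away from 0, the
    integrand is continuous and therefore bounded.\<close>
  show "?I < \<infinity>"
  proof -
    let ?K = "cball 0 b' - ball 0 a' :: complex set"
    have K: "compact ?K" "?K \<subseteq> - {0}" using ab by (auto intro: compact_diff)
    have "compact ((\<lambda>x. (P x)\<^sup>2 * \<rho> x) ` ?K)"
      by (intro compact_continuous_image continuous_intros continuous_on_subset[OF Pc] continuous_on_subset[OF \<rho>c] K)
    then obtain M where M: "\<forall>y \<in> (\<lambda>x. (P x)\<^sup>2 * \<rho> x) ` ?K. norm y \<le> M"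
      using compact_imp_bounded bounded_iff by metis
    have "?I \<le> (set_int (ball (0::complex) b') (\<lambda>x. M))"
    proof (rule nn_integral_mono)
      fix x :: complex
      show "ennreal ((P x)\<^sup>2 * \<rho> x) * indicator (annulus a' b') x \<le> ennreal M * indicator (ball (0::complex) b') x"
      proof (cases "x \<in> annulus a' b'")
        case True
        then have "x \<in> ?K" "x \<in> ball 0 b'" by (auto simp: mem_annulus)
        then have "norm ((P x)\<^sup>2 * \<rho> x) \<le> M" using M by blast
        then have "(P x)\<^sup>2 * \<rho> x \<le> M" by simp
        then show ?thesis using \<open>x \<in> ball 0 b'\<close> by (simp add: indicator_def ennreal_leI)
      qed simp
    qed
    also have "\<dots> < \<infinity>"
      using emeasure_bounded_finite[OF bounded_ball, of "0::complex" b']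
      by (subst nn_integral_cmult_indicator) (auto simp: ennreal_mult_less_top)
    finally show ?thesis .
  qed
  let ?B = "annulus a' (b' / 2)"
  let ?O = "annulus (2 * a') b'"
  define H0 where "H0 = (\<lambda>x. ennreal (((P1 x)\<^sup>2 + (P2 x)\<^sup>2) * \<sigma> x) * indicator (annulus a' b') x)"
  have [measurable]: "H0 \<in> borel_measurable borel" unfolding H0_def by measurable
  \<comment> \<open>2^(-2-2k) <= 1/64 by k >= 2, while the neck weight grows by at most
    2^(2\<gamma>) <= 4.\<close>
  have \<rho>2: "\<rho> (2 *\<^sub>R x) \<le> \<rho> x / 16" for x
  proof -
    have "neck_weight (2 * \<gamma>) a b (2 *\<^sub>R x) \<le> 2 powr (2 * \<gamma>) * neck_weight (2 * \<gamma>) a b x"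
      using ab \<gamma> by (intro neck_weight_scale) auto
    also have "\<dots> \<le> 4 * neck_weight (2 * \<gamma>) a b x"
      using \<gamma> powr_mono[of "2 * \<gamma>" 2 "2::real"] by (intro mult_right_mono) auto
    finally have n: "neck_weight (2 * \<gamma>) a b (2 *\<^sub>R x) \<le> 4 * neck_weight (2 * \<gamma>) a b x" .
    have "norm (2 *\<^sub>R x) powr (- 2 - 2 * k) = 2 powr (- 2 - 2 * k) * norm x powr (- 2 - 2 * k)"
      by (simp add: powr_mult)
    also have "\<dots> \<le> (1 / 64) * norm x powr (- 2 - 2 * k)"
      using k powr_mono[of "- 2 - 2 * k" "- 6" "2::real"]
      by (intro mult_right_mono) (auto simp: powr_minus powr_numeral)
    finally show ?thesis
      unfolding \<rho>_def radial_weight_def using mult_mono[OF _ n, of "norm (2 *\<^sub>R x) powr (- 2 - 2 * k)" "(1 / 64) * norm x powr (- 2 - 2 * k)"]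
      by (simp add: mult_ac)
  qed
  \<comment> \<open>The comparison in the opposite direction along the ray: the radial power loses
    t^(2k) <= 4^k and the neck weight t^(2\<gamma>) <= 4.\<close>
  have \<sigma>t: "\<sigma> x \<le> 4 * 4 powr k * \<sigma> (t *\<^sub>R x)" if t: "1 \<le> t" "t \<le> 2" for t x
  proof -
    have "neck_weight (2 * \<gamma>) a b x \<le> t powr (2 * \<gamma>) * neck_weight (2 * \<gamma>) a b (t *\<^sub>R x)"
      using ab \<gamma> t by (intro neck_weight_scale) auto
    also have "\<dots> \<le> 4 * neck_weight (2 * \<gamma>) a b (t *\<^sub>R x)"
    proof (intro mult_right_mono)
      have "t powr (2 * \<gamma>) \<le> 2 powr (2 * \<gamma>)" using t \<gamma> by (intro powr_mono2) auto
      also have "\<dots> \<le> 4" using \<gamma> powr_mono[of "2 * \<gamma>" 2 "2::real"] by simp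
      finally show "t powr (2 * \<gamma>) \<le> 4" .
    qed simp
    finally have n: "neck_weight (2 * \<gamma>) a b x \<le> 4 * neck_weight (2 * \<gamma>) a b (t *\<^sub>R x)" .
    have "norm x powr (- 2 * k) = t powr (2 * k) * norm (t *\<^sub>R x) powr (- 2 * k)"
      using t by (simp add: powr_mult powr_minus)
    also have "\<dots> \<le> 4 powr k * norm (t *\<^sub>R x) powr (- 2 * k)"
    proof (intro mult_right_mono)
      have "t powr (2 * k) \<le> 2 powr (2 * k)" using t k by (intro powr_mono2) auto
      also have "\<dots> = 4 powr k" by (simp add: powr_powr[symmetric])
      finally show "t powr (2 * k) \<le> 4 powr k" .
    qed simp
    finally show ?thesis
      unfolding \<sigma>_def radial_weight_def using mult_mono[OF _ n, of "norm x powr (- 2 * k)" "4 powr k * norm (t *\<^sub>R x) powr (- 2 * k)"]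
      by (simp add: mult_ac)
  qed
  \<comment> \<open>The t-derivative of P(ty) is the gradient paired with y; the resulting factor
    (norm y)^2 turns the gradient weight into the Hessian weight.\<close>
  have \<rho>\<sigma>: "(norm x)\<^sup>2 * \<rho> x = \<sigma> x" if "x \<noteq> 0" for x
  proof -
    have "(norm x)\<^sup>2 * norm x powr (- 2 - 2 * k) = norm x powr (- 2 * k)"
      using that powr_add[of "norm x" 2 "- 2 - 2 * k"] by (simp add: powr_numeral)
    then show ?thesis by (simp add: \<rho>_def \<sigma>_def radial_weight_def flip: mult.assoc)
  qed
  have diff: "ennreal ((P (2 *\<^sub>R y) - P y)\<^sup>2 * \<rho> y) * indicator ?B y \<le>
      ennreal (4 * 4 powr k) * (\<integral>\<^sup>+t. H0 (t *\<^sub>R y) * indicator {1..2} t \<partial>lborel)" for y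
  proof (cases "y \<in> ?B")
    case True
    then have y: "a' < norm y" "2 * norm y < b'" "y \<noteq> 0" using ab by (auto simp: mem_annulus)
    define g where "g = (\<lambda>t. P1 (t *\<^sub>R y) * Re y + P2 (t *\<^sub>R y) * Im y)"
    have "ennreal ((P ((1 + 1) *\<^sub>R y) - P (1 *\<^sub>R y))\<^sup>2) \<le> (set_int {1..1+1} (\<lambda>t. (g t)\<^sup>2))"
    proof (rule ftc_square_bound)
      fix t :: real assume t: "1 \<le> t" "t \<le> 1 + 1"
      have "((\<lambda>t. P (t *\<^sub>R y)) has_derivative (\<lambda>h. P1 (t *\<^sub>R y) * Re (h *\<^sub>R y) + P2 (t *\<^sub>R y) * Im (h *\<^sub>R y))) (at t)"
        by (rule has_derivative_compose[OF _ P, of "\<lambda>t. t *\<^sub>R y" "\<lambda>h. h *\<^sub>R y"])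
           (use t y in \<open>auto intro!: derivative_eq_intros\<close>)
      then show "((\<lambda>t. P (t *\<^sub>R y)) has_real_derivative g t) (at t)"
        by (rule has_derivative_imp_has_field_derivative) (auto simp: g_def algebra_simps)
      have ct: "isCont (\<lambda>t. t *\<^sub>R y) t" by (intro continuous_intros)
      have nz: "t *\<^sub>R y \<noteq> 0" using t y by simp
      show "isCont g t" unfolding g_def
        by (intro continuous_intros isCont_o2[OF ct isCont_off_zero[OF c(1) nz]] isCont_o2[OF ct isCont_off_zero[OF c(2) nz]])
    qed
    then have "ennreal ((P (2 *\<^sub>R y) - P y)\<^sup>2 * \<rho> y) \<le> ennreal (\<rho> y) * (set_int {1..2} (\<lambda>t. (g t)\<^sup>2))"
      using nn(1)[of y] by (subst mult.commute, subst ennreal_mult) (auto intro!: mult_left_mono)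
    also have "\<dots> = (\<integral>\<^sup>+t. ennreal (\<rho> y) * (ennreal ((g t)\<^sup>2) * indicator {1..2} t) \<partial>lborel)"
      unfolding g_def by (intro nn_integral_cmult[symmetric]) measurable
    also have "\<dots> \<le> (\<integral>\<^sup>+t. ennreal (4 * 4 powr k) * (H0 (t *\<^sub>R y) * indicator {1..2} t) \<partial>lborel)"
    proof (rule nn_integral_mono)
      fix t :: real
      show "ennreal (\<rho> y) * (ennreal ((g t)\<^sup>2) * indicator {1..2} t) \<le> ennreal (4 * 4 powr k) * (H0 (t *\<^sub>R y) * indicator {1..2} t)"
      proof (cases "t \<in> {1..2}")
        case t: True
        let ?G = "(P1 (t *\<^sub>R y))\<^sup>2 + (P2 (t *\<^sub>R y))\<^sup>2"
        \<comment> \<open>Cauchy-Schwarz in the plane; the square supplied as a fact is exactly its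
          defect.\<close>
        have "(g t)\<^sup>2 \<le> ?G * (norm y)\<^sup>2"
          using zero_le_power2[of "P1 (t *\<^sub>R y) * Im y - P2 (t *\<^sub>R y) * Re y"]
          unfolding g_def cmod_power2 by (simp add: power2_eq_square algebra_simps)
        then have "\<rho> y * (g t)\<^sup>2 \<le> ?G * \<sigma> y"
          using mult_left_mono[OF _ nn(1)[of y]] \<rho>\<sigma>[OF y(3)] by (metis mult.assoc mult.commute)
        also have "\<dots> \<le> ?G * (4 * 4 powr k * \<sigma> (t *\<^sub>R y))"
          using \<sigma>t[of t y] t by (intro mult_left_mono) auto
        finally have "\<rho> y * (g t)\<^sup>2 \<le> 4 * 4 powr k * (?G * \<sigma> (t *\<^sub>R y))" by (simp add: mult_ac)
        then have "ennreal (\<rho> y * (g t)\<^sup>2) \<le> ennreal (4 * 4 powr k * (?G * \<sigma> (t *\<^sub>R y)))"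
          by (rule ennreal_leI)
        moreover have "t *\<^sub>R y \<in> annulus a' b'"
        proof -
          have "norm y \<le> t * norm y" "t * norm y \<le> 2 * norm y"
            using t mult_right_mono[of 1 t "norm y"] mult_right_mono[of t 2 "norm y"] by auto
          moreover have "norm (t *\<^sub>R y) = t * norm y" using t by simp
          ultimately show ?thesis unfolding mem_annulus using y by linarith
        qed
        ultimately show ?thesis using t nn by (simp add: H0_def ennreal_mult[symmetric])
      qed simp
    qed
    also have "\<dots> = ennreal (4 * 4 powr k) * (\<integral>\<^sup>+t. H0 (t *\<^sub>R y) * indicator {1..2} t \<partial>lborel)"
      by (rule nn_integral_cmult) measurable
    finally show ?thesis using True by simp
  qed simp
  have "(\<integral>\<^sup>+y. (\<integral>\<^sup>+t. H0 (t *\<^sub>R y) * indicator {1..2} t \<partial>lborel) \<partial>lborel) =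
      (\<integral>\<^sup>+t. (\<integral>\<^sup>+y. H0 (t *\<^sub>R y) * indicator {1..2} t \<partial>lborel) \<partial>lborel)"
    by (rule lborel_pair.Fubini') measurable
  also have "\<dots> \<le> (\<integral>\<^sup>+t. ?H * indicator {1..2::real} t \<partial>lborel)"
  proof (rule nn_integral_mono)
    fix t :: real
    show "(\<integral>\<^sup>+y. H0 (t *\<^sub>R y) * indicator {1..2} t \<partial>lborel) \<le> ?H * indicator {1..2::real} t"
    proof (cases "t \<in> {1..2}")
      case True
      \<comment> \<open>For t >= 1 the Jacobian t^2 is at least 1, so it may be inserted; the
        substitution then removes the dependence on t.\<close>
      have "(\<integral>\<^sup>+y. H0 (t *\<^sub>R y) \<partial>lborel) \<le> ennreal (t ^ 2) * (\<integral>\<^sup>+y. H0 (t *\<^sub>R y) \<partial>lborel)"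
        using True mult_right_mono[of 1 "ennreal (t\<^sup>2)"] by (auto simp: ennreal_ge_1)
      also have "\<dots> = (\<integral>\<^sup>+y. H0 y \<partial>lborel)"
        using nn_integral_lborel_scale[of H0 t] True by simp
      finally show ?thesis using True by (simp add: H0_def)
    qed simp
  qed
  also have "\<dots> = ?H" by (simp add: nn_integral_cmult_indicator)
  finally have fub: "(\<integral>\<^sup>+y. (\<integral>\<^sup>+t. H0 (t *\<^sub>R y) * indicator {1..2} t \<partial>lborel) \<partial>lborel) \<le> ?H" .
  have "(set_int ?B (\<lambda>y. (P (2 *\<^sub>R y) - P y)\<^sup>2 * \<rho> y)) \<le>
     (\<integral>\<^sup>+y. ennreal (4 * 4 powr k) * (\<integral>\<^sup>+t. H0 (t *\<^sub>R y) * indicator {1..2} t \<partial>lborel) \<partial>lborel)"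
    by (intro nn_integral_mono diff)
  also have "\<dots> = ennreal (4 * 4 powr k) * (\<integral>\<^sup>+y. (\<integral>\<^sup>+t. H0 (t *\<^sub>R y) * indicator {1..2} t \<partial>lborel) \<partial>lborel)"
    by (rule nn_integral_cmult) measurable
  also have "\<dots> \<le> ennreal (4 * 4 powr k) * ?H" by (intro mult_left_mono fub) auto
  finally have D: "(set_int ?B (\<lambda>y. (P (2 *\<^sub>R y) - P y)\<^sup>2 * \<rho> y)) \<le> ennreal (4 * 4 powr k) * ?H" .
  \<comment> \<open>The 4 is the Jacobian of x = 2y. With 1/16 from \<open>\<rho>2\<close> and 2
    from \<open>sq\<close> it produces the coefficient 1/2.\<close>
  have "(set_int ?O (\<lambda>x. (P x)\<^sup>2 * \<rho> x)) =
      4 * (\<integral>\<^sup>+y. ennreal ((P (2 *\<^sub>R y))\<^sup>2 * \<rho> (2 *\<^sub>R y)) * indicator ?O (2 *\<^sub>R y) \<partial>lborel)"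
    by (subst nn_integral_lborel_scale[of _ 2]) auto
  also have "\<dots> = (\<integral>\<^sup>+y. 4 * (ennreal ((P (2 *\<^sub>R y))\<^sup>2 * \<rho> (2 *\<^sub>R y)) * indicator ?O (2 *\<^sub>R y)) \<partial>lborel)"
    by (rule nn_integral_cmult[symmetric]) measurable
  also have "\<dots> \<le> (\<integral>\<^sup>+y. ennreal (1/2) * (ennreal ((P y)\<^sup>2 * \<rho> y) * indicator ?B y) +
      ennreal (1/2) * (ennreal ((P (2 *\<^sub>R y) - P y)\<^sup>2 * \<rho> y) * indicator ?B y) \<partial>lborel)"
  proof (rule nn_integral_mono)
    fix y :: complex
    show "4 * (ennreal ((P (2 *\<^sub>R y))\<^sup>2 * \<rho> (2 *\<^sub>R y)) * indicator ?O (2 *\<^sub>R y)) \<le> ennreal (1/2) * (ennreal ((P y)\<^sup>2 * \<rho> y) * indicator ?B y) +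
      ennreal (1/2) * (ennreal ((P (2 *\<^sub>R y) - P y)\<^sup>2 * \<rho> y) * indicator ?B y)"
    proof (cases "y \<in> ?B")
      case True
      then have O: "2 *\<^sub>R y \<in> ?O" by (simp add: mem_annulus)
      have sq: "(P (2 *\<^sub>R y))\<^sup>2 \<le> 2 * (P y)\<^sup>2 + 2 * (P (2 *\<^sub>R y) - P y)\<^sup>2"
        using zero_le_power2[of "P (2 *\<^sub>R y) - 2 * P y"] by (simp add: power2_eq_square algebra_simps)
      have "4 * ((P (2 *\<^sub>R y))\<^sup>2 * \<rho> (2 *\<^sub>R y)) \<le> 4 * ((P (2 *\<^sub>R y))\<^sup>2 * (\<rho> y / 16))"
        using \<rho>2[of y] by (intro mult_left_mono) auto
      also have "\<dots> \<le> 4 * ((2 * (P y)\<^sup>2 + 2 * (P (2 *\<^sub>R y) - P y)\<^sup>2) * (\<rho> y / 16))"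
        using nn(1)[of y] sq by (intro mult_left_mono mult_right_mono) auto
      also have "\<dots> = 1/2 * ((P y)\<^sup>2 * \<rho> y) + 1/2 * ((P (2 *\<^sub>R y) - P y)\<^sup>2 * \<rho> y)"
        by (simp add: algebra_simps)
      finally have "ennreal (4 * ((P (2 *\<^sub>R y))\<^sup>2 * \<rho> (2 *\<^sub>R y))) \<le>
          ennreal (1/2 * ((P y)\<^sup>2 * \<rho> y) + 1/2 * ((P (2 *\<^sub>R y) - P y)\<^sup>2 * \<rho> y))"
        by (rule ennreal_leI)
      also have "\<dots> = ennreal (1/2) * ennreal ((P y)\<^sup>2 * \<rho> y) + ennreal (1/2) * ennreal ((P (2 *\<^sub>R y) - P y)\<^sup>2 * \<rho> y)"
        using nn(1)[of y] by (intro ennreal_lincomb) auto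
      also have "ennreal (4 * ((P (2 *\<^sub>R y))\<^sup>2 * \<rho> (2 *\<^sub>R y))) = 4 * ennreal ((P (2 *\<^sub>R y))\<^sup>2 * \<rho> (2 *\<^sub>R y))"
        by (subst ennreal_mult') auto
      finally show ?thesis using O True by simp
    next
      case False
      then have O: "2 *\<^sub>R y \<notin> ?O" by (auto simp: mem_annulus)
      then show ?thesis by simp
    qed
  qed
  also have "\<dots> = ennreal (1/2) * (set_int ?B (\<lambda>y. (P y)\<^sup>2 * \<rho> y)) +
      ennreal (1/2) * (set_int ?B (\<lambda>y. (P (2 *\<^sub>R y) - P y)\<^sup>2 * \<rho> y))"
    by (subst nn_integral_add) (auto simp: nn_integral_cmult)
  also have "\<dots> \<le> ennreal (1/2) * ?I + ennreal (1/2) * (ennreal (4 * 4 powr k) * ?H)"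
    using ab by (intro add_mono mult_left_mono D nn_integral_mono) (auto simp: indicator_def mem_annulus)
  also have "ennreal (1/2) * (ennreal (4 * 4 powr k) * ?H) = ennreal (2 * 4 powr k) * ?H"
  proof -
    have "ennreal (1/2) * ennreal (4 * 4 powr k) = ennreal (1/2 * (4 * 4 powr k))"
      by (rule ennreal_mult[symmetric]) auto
    then show ?thesis by (simp only: mult.assoc[symmetric]) simp
  qed
  finally have O: "(set_int ?O (\<lambda>x. (P x)\<^sup>2 * \<rho> x)) \<le> ennreal (1/2) * ?I + ennreal (2 * 4 powr k) * ?H" .
  have "?I \<le> (\<integral>\<^sup>+x. ennreal ((P x)\<^sup>2 * \<rho> x) * indicator (shell a' 2) x
      + ennreal ((P x)\<^sup>2 * \<rho> x) * indicator ?O x \<partial>lborel)"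
    by (intro nn_integral_mono) (auto simp: indicator_def mem_annulus)
  also have "\<dots> = ?Inner + (set_int ?O (\<lambda>x. (P x)\<^sup>2 * \<rho> x))"
    by (rule nn_integral_add) measurable
  also have "\<dots> \<le> ?Inner + (ennreal (1/2) * ?I + ennreal (2 * 4 powr k) * ?H)"
    by (intro add_left_mono O)
  finally show "?I \<le> (?Inner + ennreal (2 * 4 powr k) * ?H) + ennreal (1/2) * ?I"
    by (simp add: ac_simps)
qed

text \<open>If x . d >= 0, then moving from x in direction d does not decrease the norm, so the
  segment of length A stays outside the small disc and inside radius 3A. Taylor's formula on it
  expresses p(x) through two values of V and an average of q. Only directional derivatives are
  assumed, so that d can be reversed.\<close>

lemma taylor_inner:
  fixes V p q :: "complex \<Rightarrow> real"
  assumes d: "norm d = 1" and A: "A > 0"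
    and V: "\<And>x. x \<noteq> 0 \<Longrightarrow> \<exists>L. (V has_derivative L) (at x) \<and> L d = p x"
    and p: "\<And>x. x \<noteq> 0 \<Longrightarrow> \<exists>L. (p has_derivative L) (at x) \<and> L d = q x"
    and c: "continuous_on (- {0}) q"
    and [measurable]: "V \<in> borel_measurable borel" "p \<in> borel_measurable borel" "q \<in> borel_measurable borel"
  defines "E3 \<equiv> (shell A 3)"
  shows "(set_int {x. A < norm x \<and> norm x \<le> 2 * A \<and> 0 \<le> x \<bullet> d} (\<lambda>x. (p x)\<^sup>2)) \<le>
    ennreal (6 / A\<^sup>2) * (set_int E3 (\<lambda>x. (V x)\<^sup>2)) +
    ennreal (3 * A\<^sup>2) * (set_int E3 (\<lambda>x. (q x)\<^sup>2))"
    (is "?L \<le> _ * ?V + _ * ?Q")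
proof -
  have [measurable]: "E3 \<in> sets borel" unfolding E3_def by measurable
  define v where "v = (\<lambda>x. ennreal ((V x)\<^sup>2) * indicator E3 x)"
  define r where "r = (\<lambda>x. ennreal ((q x)\<^sup>2) * indicator E3 x)"
  have [measurable]: "v \<in> borel_measurable borel" "r \<in> borel_measurable borel"
    unfolding v_def r_def by measurable
  have line: "((\<lambda>t. f (x + (t * A) *\<^sub>R d)) has_real_derivative A * g (x + (t * A) *\<^sub>R d)) (at t)"
    if "\<exists>L. (f has_derivative L) (at (x + (t * A) *\<^sub>R d)) \<and> L d = g (x + (t * A) *\<^sub>R d)" for f g :: "complex \<Rightarrow> real" and x t
  proof -
    from that obtain L where L: "(f has_derivative L) (at (x + (t * A) *\<^sub>R d))" "L d = g (x + (t * A) *\<^sub>R d)" by blast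
    have "((\<lambda>t. f (x + (t * A) *\<^sub>R d)) has_derivative (\<lambda>h. L ((h * A) *\<^sub>R d))) (at t)"
      using L(1)
      by (intro has_derivative_compose[of "\<lambda>t. x + (t * A) *\<^sub>R d" "\<lambda>h. (h * A) *\<^sub>R d" t UNIV f L])
         (auto intro!: derivative_eq_intros)
    then show ?thesis
      by (rule has_derivative_imp_has_field_derivative)
        (simp add: linear_cmul[OF has_derivative_linear[OF L(1)]] L(2))
  qed
  have pt: "ennreal ((p x)\<^sup>2) * indicator {x. A < norm x \<and> norm x \<le> 2 * A \<and> 0 \<le> x \<bullet> d} x \<le>
      ennreal (3 / A\<^sup>2) * (v (x + A *\<^sub>R d) + v x) + ennreal (3 * A\<^sup>2) * (\<integral>\<^sup>+t. r (x + (t * A) *\<^sub>R d) * indicator {0..1} t \<partial>lborel)" for x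
  proof (cases "A < norm x \<and> norm x \<le> 2 * A \<and> 0 \<le> x \<bullet> d")
    case True
    have E3: "x + (t * A) *\<^sub>R d \<in> E3" if t: "0 \<le> t" "t \<le> 1" for t
    proof -
      have dd: "d \<bullet> d = 1" using d by (simp add: norm_eq_1)
      have "(norm (x + (t * A) *\<^sub>R d))\<^sup>2 = (norm x)\<^sup>2 + 2 * (t * A) * (x \<bullet> d) + (t * A)\<^sup>2"
        unfolding power2_norm_eq_inner
        by (simp add: inner_add_left inner_add_right inner_commute dd power2_eq_square algebra_simps)
      also have "\<dots> \<ge> (norm x)\<^sup>2" using True t A by (simp add: add_nonneg_nonneg)
      finally have "norm x \<le> norm (x + (t * A) *\<^sub>R d)"
        using power2_le_imp_le norm_ge_zero by blast
      moreover have "norm (x + (t * A) *\<^sub>R d) \<le> norm x + t * A"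
        using norm_triangle_ineq[of x "(t * A) *\<^sub>R d"] d t A by simp
      moreover have "t * A \<le> A" using mult_right_mono[of t 1 A] t A by simp
      ultimately show ?thesis using True unfolding E3_def mem_Collect_eq by linarith
    qed
    have nz: "x + (t * A) *\<^sub>R d \<noteq> 0" if t: "0 \<le> t" "t \<le> 1" for t
      using E3[OF t] A unfolding E3_def by (metis (mono_tags, lifting) mem_Collect_eq norm_zero not_less_iff_gr_or_eq order_less_trans)
    \<comment> \<open>Integral form of the remainder: F(1) = V(x + Ad), F(0) = V(x) + A p(x), and in
      the derivative the terms with p cancel, leaving (1 - t) A^2 q.\<close>
    define F where "F = (\<lambda>t. V (x + (t * A) *\<^sub>R d) + (1 - t) * (A * p (x + (t * A) *\<^sub>R d)))"
    define g where "g = (\<lambda>t. (1 - t) * (A\<^sup>2 * q (x + (t * A) *\<^sub>R d)))"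
    have "ennreal ((F (0 + 1) - F 0)\<^sup>2) \<le> (set_int {0..0+1} (\<lambda>t. (g t)\<^sup>2))"
    proof (rule ftc_square_bound)
      fix t :: real assume "0 \<le> t" "t \<le> 0 + 1"
      then have t: "0 \<le> t" "t \<le> 1" by auto
      note dV = line[where f = V and g = p, OF V[OF nz[OF t]]] and dp = line[where f = p and g = q, OF p[OF nz[OF t]]]
      show "(F has_real_derivative g t) (at t)"
        unfolding F_def g_def
        by (rule derivative_eq_intros dV dp refl | simp add: power2_eq_square algebra_simps)+
      have ct: "isCont (\<lambda>t. x + (t * A) *\<^sub>R d) t" by (intro continuous_intros)
      show "isCont g t" unfolding g_def
        by (intro continuous_intros isCont_o2[OF ct isCont_off_zero[OF c nz[OF t]]])
    qed
    also have "\<dots> \<le> (\<integral>\<^sup>+t. ennreal (A ^ 4) * (r (x + (t * A) *\<^sub>R d) * indicator {0..1} t) \<partial>lborel)"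
    proof (rule nn_integral_mono)
      fix t :: real
      show "ennreal ((g t)\<^sup>2) * indicator {0..0+1} t \<le> ennreal (A ^ 4) * (r (x + (t * A) *\<^sub>R d) * indicator {0..1} t)"
      proof (cases "t \<in> {0..1}")
        case t: True
        have "(1 - t)\<^sup>2 \<le> 1" using t by (simp add: power_le_one)
        then have "(g t)\<^sup>2 \<le> A ^ 4 * (q (x + (t * A) *\<^sub>R d))\<^sup>2"
        proof -
          have "(g t)\<^sup>2 = (1 - t)\<^sup>2 * (A ^ 4 * (q (x + (t * A) *\<^sub>R d))\<^sup>2)"
            by (simp add: g_def power_mult_distrib flip: power_mult)
          also have "\<dots> \<le> 1 * (A ^ 4 * (q (x + (t * A) *\<^sub>R d))\<^sup>2)"
            using \<open>(1 - t)\<^sup>2 \<le> 1\<close> by (intro mult_right_mono) auto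
          finally show ?thesis by simp
        qed
        then have "ennreal ((g t)\<^sup>2) \<le> ennreal (A ^ 4) * ennreal ((q (x + (t * A) *\<^sub>R d))\<^sup>2)"
          by (subst ennreal_mult[symmetric]) (auto intro: ennreal_leI)
        then show ?thesis using t E3[of t] by (simp add: r_def)
      qed simp
    qed
    also have "\<dots> = ennreal (A ^ 4) * (\<integral>\<^sup>+t. r (x + (t * A) *\<^sub>R d) * indicator {0..1} t \<partial>lborel)"
      by (rule nn_integral_cmult) measurable
    finally have R: "ennreal ((V (x + A *\<^sub>R d) - (V x + A * p x))\<^sup>2) \<le>
        ennreal (A ^ 4) * (\<integral>\<^sup>+t. r (x + (t * A) *\<^sub>R d) * indicator {0..1} t \<partial>lborel)" (is "ennreal (?R\<^sup>2) \<le> _ * ?J")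
      by (simp add: F_def)
    \<comment> \<open>The square of three terms gives the 3. V occurs at x and at its translate,
      which doubles 3/A^2 to the final 6/A^2; the remainder carries A^4, hence 3A^2.\<close>
    have "(A * p x)\<^sup>2 \<le> 3 * ((V (x + A *\<^sub>R d))\<^sup>2 + (V x)\<^sup>2 + ?R\<^sup>2)"
    proof -
      have *: "(u - v - w)\<^sup>2 \<le> 3 * (u\<^sup>2 + v\<^sup>2 + w\<^sup>2)" for u v w :: real
        using zero_le_power2[of "u + v"] zero_le_power2[of "u + w"] zero_le_power2[of "v - w"]
        by (simp add: power2_eq_square algebra_simps)
      show ?thesis using *[of "V (x + A *\<^sub>R d)" "V x" ?R] by (simp add: algebra_simps)
    qed
    then have "(p x)\<^sup>2 \<le> 3 / A\<^sup>2 * ((V (x + A *\<^sub>R d))\<^sup>2 + (V x)\<^sup>2) + 3 / A\<^sup>2 * ?R\<^sup>2"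
      using A by (simp add: power_mult_distrib field_simps)
    then have "ennreal ((p x)\<^sup>2) \<le> ennreal (3 / A\<^sup>2 * ((V (x + A *\<^sub>R d))\<^sup>2 + (V x)\<^sup>2) + 3 / A\<^sup>2 * ?R\<^sup>2)"
      by (rule ennreal_leI)
    also have "\<dots> = ennreal (3 / A\<^sup>2) * (ennreal ((V (x + A *\<^sub>R d))\<^sup>2) + ennreal ((V x)\<^sup>2)) + ennreal (3 / A\<^sup>2) * ennreal (?R\<^sup>2)"
      by (subst ennreal_lincomb) (auto simp: ennreal_plus)
    also have "\<dots> \<le> ennreal (3 / A\<^sup>2) * (v (x + A *\<^sub>R d) + v x) + ennreal (3 / A\<^sup>2) * (ennreal (A ^ 4) * ?J)"
      using E3[of 0] E3[of 1] by (intro add_mono mult_left_mono R) (auto simp: v_def)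
    also have "ennreal (3 / A\<^sup>2) * (ennreal (A ^ 4) * ?J) = ennreal (3 / A\<^sup>2 * A ^ 4) * ?J"
      using A by (subst ennreal_mult) (auto simp: mult.assoc)
    also have "3 / A\<^sup>2 * A ^ 4 = 3 * A\<^sup>2"
      using A by (simp add: field_simps flip: power_add)
    finally show ?thesis using True by simp
  qed simp
  have fub: "(\<integral>\<^sup>+x. (\<integral>\<^sup>+t. r (x + (t * A) *\<^sub>R d) * indicator {0..1} t \<partial>lborel) \<partial>lborel) = ?Q"
  proof -
    have "(\<integral>\<^sup>+x. (\<integral>\<^sup>+t. r (x + (t * A) *\<^sub>R d) * indicator {0..1} t \<partial>lborel) \<partial>lborel) =
       (\<integral>\<^sup>+t. (\<integral>\<^sup>+x. r (x + (t * A) *\<^sub>R d) * indicator {0..1} t \<partial>lborel) \<partial>lborel)"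
      by (rule lborel_pair.Fubini') measurable
    also have "\<dots> = (\<integral>\<^sup>+t. ?Q * indicator {0..1::real} t \<partial>lborel)"
      by (simp add: nn_integral_multc nn_integral_lborel_translate) (simp add: r_def)
    also have "\<dots> = ?Q" by (simp add: nn_integral_cmult_indicator)
    finally show ?thesis .
  qed
  have "?L \<le> (\<integral>\<^sup>+x. ennreal (3 / A\<^sup>2) * (v (x + A *\<^sub>R d) + v x) + ennreal (3 * A\<^sup>2) * (\<integral>\<^sup>+t. r (x + (t * A) *\<^sub>R d) * indicator {0..1} t \<partial>lborel) \<partial>lborel)"
    by (intro nn_integral_mono pt)
  also have "\<dots> = (\<integral>\<^sup>+x. ennreal (3 / A\<^sup>2) * (v (x + A *\<^sub>R d) + v x) \<partial>lborel) + (\<integral>\<^sup>+x. ennreal (3 * A\<^sup>2) * (\<integral>\<^sup>+t. r (x + (t * A) *\<^sub>R d) * indicator {0..1} t \<partial>lborel) \<partial>lborel)"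
    by (rule nn_integral_add) measurable
  also have "(\<integral>\<^sup>+x. ennreal (3 * A\<^sup>2) * (\<integral>\<^sup>+t. r (x + (t * A) *\<^sub>R d) * indicator {0..1} t \<partial>lborel) \<partial>lborel) = ennreal (3 * A\<^sup>2) * ?Q"
    unfolding fub[symmetric] by (rule nn_integral_cmult) measurable
  also have "(\<integral>\<^sup>+x. ennreal (3 / A\<^sup>2) * (v (x + A *\<^sub>R d) + v x) \<partial>lborel) = ennreal (3 / A\<^sup>2) * (?V + ?V)"
    by (simp add: nn_integral_cmult nn_integral_add nn_integral_lborel_translate) (simp add: v_def)
  also have "?V + ?V = 2 * ?V" by (simp add: mult_2)
  also have "ennreal (3 / A\<^sup>2) * (2 * ?V) = ennreal (3 / A\<^sup>2 * 2) * ?V"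
    by (subst ennreal_mult') (auto simp: mult.assoc)
  also have "3 / A\<^sup>2 * 2 = 6 / A\<^sup>2" by simp
  finally show ?thesis .
qed

text \<open>The base 3 comes from norm x <= 3A, the base 6 from norm x <= 3A <= 6a.\<close>

lemma radial_weight_inner_bound:
  assumes a: "0 < a" "0 < b" "a \<le> A" "A \<le> 2 * a" and x: "A < norm x" "norm x \<le> 3 * A" and e: "e \<le> 0" "0 \<le> s"
  shows "A powr e \<le> 3 powr (- e) * 6 powr s * radial_weight e s a b x"
proof -
  have "6 powr (- s) \<le> neck_weight s a b x"
    using assms by (intro neck_weight_ge) auto
  then have 1: "1 \<le> 6 powr s * neck_weight s a b x"
    by (simp add: powr_minus field_simps)
  have "(3 * A) powr e \<le> norm x powr e"
    using assms by (intro powr_mono2') auto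
  then have "A powr e \<le> 3 powr (- e) * norm x powr e"
    using a by (simp add: powr_mult powr_minus field_simps)
  from mult_mono[OF this 1] show ?thesis by (simp add: radial_weight_def mult_ac)
qed

text \<open>The half planes x . d >= 0 and x . (-d) >= 0 cover the shell, and in each of them one of
  the two directions points outward. Near the inner radius all weights are comparable to powers of
  A, so the unweighted Taylor bound becomes a weighted one.\<close>

lemma inner_estimate:
  fixes V p q :: "complex \<Rightarrow> real"
  assumes ab: "0 < a" "0 < b" "a \<le> A" "A \<le> 2 * a" "3 * A < B" "B \<le> b"
    and \<gamma>: "0 \<le> \<gamma>" and \<beta>: "0 \<le> \<beta>" and k: "0 \<le> k"
    and d: "norm d = 1"
    and V: "\<And>x. x \<noteq> 0 \<Longrightarrow> \<exists>L. (V has_derivative L) (at x) \<and> L d = p x"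
    and p: "\<And>x. x \<noteq> 0 \<Longrightarrow> \<exists>L. (p has_derivative L) (at x) \<and> L d = q x"
    and c: "continuous_on (- {0}) q"
    and [measurable]: "V \<in> borel_measurable borel" "p \<in> borel_measurable borel" "q \<in> borel_measurable borel"
  shows "(set_int (shell A 2) (\<lambda>x. (p x)\<^sup>2 * radial_weight (- 2 - 2 * k) (2 * \<gamma>) a b x)) \<le>
      ennreal (24 * 3 powr (4 + 2 * k) * 6 powr (4 * \<beta>)) * (set_int (annulus A B) (\<lambda>x. (V x)\<^sup>2 * radial_weight (- 4 - 2 * k) (4 * \<beta>) a b x))
    + ennreal (12 * 3 powr (2 * k) * 6 powr (2 * \<gamma>)) * (set_int (annulus A B) (\<lambda>x. (q x)\<^sup>2 * radial_weight (- 2 * k) (2 * \<gamma>) a b x))"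
    (is "?L \<le> ennreal ?K1 * ?X + ennreal ?K2 * ?Y")
proof -
  have A: "A > 0" using ab by linarith
  define T where "T = (\<lambda>d. set_int {x. A < norm x \<and> norm x \<le> 2 * A \<and> 0 \<le> x \<bullet> d} (\<lambda>x. (p x)\<^sup>2))"
  define E3 where "E3 = (shell A 3)"
  have [measurable]: "E3 \<in> sets borel" unfolding E3_def by measurable
  let ?V = "set_int E3 (\<lambda>x. (V x)\<^sup>2)"
  let ?Q = "set_int E3 (\<lambda>x. (q x)\<^sup>2)"
  have T1: "T d \<le> ennreal (6 / A\<^sup>2) * ?V + ennreal (3 * A\<^sup>2) * ?Q"
    unfolding T_def E3_def by (rule taylor_inner[OF d A V p c]) auto
  \<comment> \<open>Reversing d changes the sign of the first derivative and preserves the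
    second.\<close>
  have T2: "T (- d) \<le> ennreal (6 / A\<^sup>2) * ?V + ennreal (3 * A\<^sup>2) * ?Q"
  proof -
    have m: "(\<lambda>x. - p x) \<in> borel_measurable borel" by measurable
    have 1: "\<exists>L. (V has_derivative L) (at x) \<and> L (- d) = - p x" if "x \<noteq> 0" for x
      using V[OF that] linear_neg[OF has_derivative_linear] by metis
    have 2: "\<exists>L. ((\<lambda>x. - p x) has_derivative L) (at x) \<and> L (- d) = q x" if x: "x \<noteq> 0" for x
    proof -
      obtain L where L: "(p has_derivative L) (at x)" "L d = q x" using p[OF x] by blast
      then show ?thesis
        using has_derivative_minus[OF L(1)] linear_neg[OF has_derivative_linear[OF L(1)], of d]
        by (intro exI[of _ "\<lambda>h. - L h"]) simp
    qed
    show ?thesis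
      unfolding T_def E3_def using taylor_inner[OF _ A 1 2 c _ m] d by simp
  qed
  have "?L \<le> (\<integral>\<^sup>+x. ennreal (2 * A powr (- 2 - 2 * k)) *
      (ennreal ((p x)\<^sup>2) * indicator {x. A < norm x \<and> norm x \<le> 2 * A \<and> 0 \<le> x \<bullet> d} x +
       ennreal ((p x)\<^sup>2) * indicator {x. A < norm x \<and> norm x \<le> 2 * A \<and> 0 \<le> x \<bullet> (- d)} x) \<partial>lborel)"
  proof (rule nn_integral_mono)
    fix x :: complex
    show "ennreal ((p x)\<^sup>2 * radial_weight (- 2 - 2 * k) (2 * \<gamma>) a b x) * indicator (shell A 2) x \<le>
      ennreal (2 * A powr (- 2 - 2 * k)) *
      (ennreal ((p x)\<^sup>2) * indicator {x. A < norm x \<and> norm x \<le> 2 * A \<and> 0 \<le> x \<bullet> d} x +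
       ennreal ((p x)\<^sup>2) * indicator {x. A < norm x \<and> norm x \<le> 2 * A \<and> 0 \<le> x \<bullet> (- d)} x)"
    proof (cases "A < norm x \<and> norm x \<le> 2 * A")
      case True
      have "norm x powr (- 2 - 2 * k) \<le> A powr (- 2 - 2 * k)"
        using True A k by (intro powr_mono2') auto
      moreover have "neck_weight (2 * \<gamma>) a b x \<le> 2"
        using True ab \<gamma> by (intro neck_weight_le_2) auto
      ultimately have "radial_weight (- 2 - 2 * k) (2 * \<gamma>) a b x \<le> A powr (- 2 - 2 * k) * 2"
        unfolding radial_weight_def by (intro mult_mono) auto
      then have "(p x)\<^sup>2 * radial_weight (- 2 - 2 * k) (2 * \<gamma>) a b x \<le> (p x)\<^sup>2 * (A powr (- 2 - 2 * k) * 2)"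
        by (intro mult_left_mono) auto
      then have "ennreal ((p x)\<^sup>2 * radial_weight (- 2 - 2 * k) (2 * \<gamma>) a b x) \<le> ennreal (2 * A powr (- 2 - 2 * k) * (p x)\<^sup>2)"
        by (intro ennreal_leI) (simp add: mult_ac)
      also have "\<dots> = ennreal (2 * A powr (- 2 - 2 * k)) * (ennreal ((p x)\<^sup>2) * 1)"
        by (simp add: ennreal_mult')
      also have "\<dots> \<le> ennreal (2 * A powr (- 2 - 2 * k)) *
      (ennreal ((p x)\<^sup>2) * indicator {x. A < norm x \<and> norm x \<le> 2 * A \<and> 0 \<le> x \<bullet> d} x +
       ennreal ((p x)\<^sup>2) * indicator {x. A < norm x \<and> norm x \<le> 2 * A \<and> 0 \<le> x \<bullet> (- d)} x)"
      proof (rule mult_left_mono)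
        show "ennreal ((p x)\<^sup>2) * 1 \<le> ennreal ((p x)\<^sup>2) * indicator {x. A < norm x \<and> norm x \<le> 2 * A \<and> 0 \<le> x \<bullet> d} x +
       ennreal ((p x)\<^sup>2) * indicator {x. A < norm x \<and> norm x \<le> 2 * A \<and> 0 \<le> x \<bullet> (- d)} x"
          using True by (cases "0 \<le> x \<bullet> d") auto
      qed simp
      finally show ?thesis using True by simp
    qed simp
  qed
  also have "\<dots> = ennreal (2 * A powr (- 2 - 2 * k)) * (T d + T (- d))"
    unfolding T_def by (subst nn_integral_cmult) (auto simp: nn_integral_add)
  also have "\<dots> \<le> ennreal (2 * A powr (- 2 - 2 * k)) * (2 * (ennreal (6 / A\<^sup>2) * ?V + ennreal (3 * A\<^sup>2) * ?Q))"
    unfolding mult_2[of "ennreal (6 / A\<^sup>2) * ?V + ennreal (3 * A\<^sup>2) * ?Q"]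
    by (intro mult_left_mono add_mono T1 T2) auto
  also have "\<dots> = ennreal (2 * A powr (- 2 - 2 * k)) * 2 * ennreal (6 / A\<^sup>2) * ?V + ennreal (2 * A powr (- 2 - 2 * k)) * 2 * ennreal (3 * A\<^sup>2) * ?Q"
    by (simp add: distrib_left mult.assoc)
  \<comment> \<open>A factor 2 bounds the neck weight and another counts the half planes: 2 * 2 * 6
    = 24 here and 2 * 2 * 3 = 12 for the second derivatives.\<close>
  also have "ennreal (2 * A powr (- 2 - 2 * k)) * 2 * ennreal (6 / A\<^sup>2) = ennreal (24 * A powr (- 4 - 2 * k))"
  proof -
    have "A powr (- 4 - 2 * k) = A powr (- 2 - 2 * k) * A powr (- 2)"
      by (simp flip: powr_add)
    also have "A powr (- 2) = 1 / A\<^sup>2" using A by (simp add: powr_minus powr_numeral divide_inverse)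
    finally show ?thesis
      using A by (simp add: ennreal_mult[symmetric] flip: ennreal_numeral)
  qed
  also have "ennreal (2 * A powr (- 2 - 2 * k)) * 2 * ennreal (3 * A\<^sup>2) = ennreal (12 * A powr (- 2 * k))"
  proof -
    have "A powr (- 2 * k) = A powr (- 2 - 2 * k) * A powr 2"
      by (simp flip: powr_add)
    also have "A powr 2 = A\<^sup>2" using A by (simp add: powr_numeral)
    finally show ?thesis
      using A by (simp add: ennreal_mult[symmetric] flip: ennreal_numeral)
  qed
  also have "ennreal (24 * A powr (- 4 - 2 * k)) * ?V = (\<integral>\<^sup>+x. ennreal (24 * A powr (- 4 - 2 * k)) * (ennreal ((V x)\<^sup>2) * indicator E3 x) \<partial>lborel)"
    by (rule nn_integral_cmult[symmetric]) measurable
  also have "ennreal (12 * A powr (- 2 * k)) * ?Q = (\<integral>\<^sup>+x. ennreal (12 * A powr (- 2 * k)) * (ennreal ((q x)\<^sup>2) * indicator E3 x) \<partial>lborel)"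
    by (rule nn_integral_cmult[symmetric]) measurable
  also have "(\<integral>\<^sup>+x. ennreal (24 * A powr (- 4 - 2 * k)) * (ennreal ((V x)\<^sup>2) * indicator E3 x) \<partial>lborel) + (\<integral>\<^sup>+x. ennreal (12 * A powr (- 2 * k)) * (ennreal ((q x)\<^sup>2) * indicator E3 x) \<partial>lborel)
     \<le> (\<integral>\<^sup>+x. ennreal ?K1 * (ennreal ((V x)\<^sup>2 * radial_weight (- 4 - 2 * k) (4 * \<beta>) a b x) * indicator (annulus A B) x) \<partial>lborel) +
       (\<integral>\<^sup>+x. ennreal ?K2 * (ennreal ((q x)\<^sup>2 * radial_weight (- 2 * k) (2 * \<gamma>) a b x) * indicator (annulus A B) x) \<partial>lborel)"
  proof (intro add_mono nn_integral_mono)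
    fix x
    show "ennreal (24 * A powr (- 4 - 2 * k)) * (ennreal ((V x)\<^sup>2) * indicator E3 x) \<le>
      ennreal ?K1 * (ennreal ((V x)\<^sup>2 * radial_weight (- 4 - 2 * k) (4 * \<beta>) a b x) * indicator (annulus A B) x)"
    proof (cases "x \<in> E3")
      case True
      then have x: "A < norm x" "norm x \<le> 3 * A" "x \<in> annulus A B" using ab by (auto simp: E3_def mem_annulus)
      have "24 * A powr (- 4 - 2 * k) * (V x)\<^sup>2 \<le> 24 * (3 powr (4 + 2 * k) * 6 powr (4 * \<beta>) * radial_weight (- 4 - 2 * k) (4 * \<beta>) a b x) * (V x)\<^sup>2"
        using radial_weight_inner_bound[OF ab(1-4) x(1,2), of "- 4 - 2 * k" "4 * \<beta>"] k \<beta>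
        by (intro mult_right_mono mult_left_mono) (auto simp: add.commute)
      then have "ennreal (24 * A powr (- 4 - 2 * k) * (V x)\<^sup>2) \<le> ennreal (?K1 * ((V x)\<^sup>2 * radial_weight (- 4 - 2 * k) (4 * \<beta>) a b x))"
        by (intro ennreal_leI) (simp add: mult_ac)
      then show ?thesis using True x(3) radial_weight_nonneg by (simp add: ennreal_mult')
    qed simp
    show "ennreal (12 * A powr (- 2 * k)) * (ennreal ((q x)\<^sup>2) * indicator E3 x) \<le>
      ennreal ?K2 * (ennreal ((q x)\<^sup>2 * radial_weight (- 2 * k) (2 * \<gamma>) a b x) * indicator (annulus A B) x)"
    proof (cases "x \<in> E3")
      case True
      then have x: "A < norm x" "norm x \<le> 3 * A" "x \<in> annulus A B" using ab by (auto simp: E3_def mem_annulus)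
      have "12 * A powr (- 2 * k) * (q x)\<^sup>2 \<le> 12 * (3 powr (2 * k) * 6 powr (2 * \<gamma>) * radial_weight (- 2 * k) (2 * \<gamma>) a b x) * (q x)\<^sup>2"
        using radial_weight_inner_bound[OF ab(1-4) x(1,2), of "- 2 * k" "2 * \<gamma>"] k \<gamma>
        by (intro mult_right_mono mult_left_mono) auto
      then have "ennreal (12 * A powr (- 2 * k) * (q x)\<^sup>2) \<le> ennreal (?K2 * ((q x)\<^sup>2 * radial_weight (- 2 * k) (2 * \<gamma>) a b x))"
        by (intro ennreal_leI) (simp add: mult_ac)
      then show ?thesis using True x(3) radial_weight_nonneg by (simp add: ennreal_mult')
    qed simp
  qed
  also have "\<dots> = ennreal ?K1 * ?X + ennreal ?K2 * ?Y"
    by (intro arg_cong2[where f = "(+)"] nn_integral_cmult) measurable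
  finally show ?thesis .
qed

text \<open>The first summand is the coefficient of the zeroth-order term, the other two together
  that of the Hessian; their sum serves for both. Neither a, b nor the intermediate radii
  enter.\<close>

definition neck_const :: "real \<Rightarrow> real \<Rightarrow> real \<Rightarrow> real" where
  "neck_const k \<beta> \<gamma> = 4 * (24 * 3 powr (4 + 2 * k) * 6 powr (4 * \<beta>)) + 4 * (12 * 3 powr (2 * k) * 6 powr (2 * \<gamma>)) + 4 * 4 powr k"

text \<open>The Hardy inequality is applied to both gradient components, and each shell term is
  bounded with the pure second derivative in its own direction, 1 or \<i>. The shared
  \<open>q12\<close> encodes the symmetry of the Hessian.\<close>

lemma smooth_neck_estimate:
  fixes V p1 p2 q11 q12 q22 :: "complex \<Rightarrow> real"
  assumes ab: "0 < a" "0 < b" "a \<le> A" "A \<le> 2 * a" "3 * A < B" "B \<le> b"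
    and \<gamma>: "0 \<le> \<gamma>" "\<gamma> \<le> 1" and \<beta>: "0 \<le> \<beta>" and k: "2 \<le> k"
    and V: "\<And>x. x \<noteq> 0 \<Longrightarrow> (V has_derivative (dxy (p1 x) (p2 x))) (at x)"
    and p1: "\<And>x. x \<noteq> 0 \<Longrightarrow> (p1 has_derivative (dxy (q11 x) (q12 x))) (at x)"
    and p2: "\<And>x. x \<noteq> 0 \<Longrightarrow> (p2 has_derivative (dxy (q12 x) (q22 x))) (at x)"
    and c: "continuous_on (- {0}) q11" "continuous_on (- {0}) q12" "continuous_on (- {0}) q22"
    and [measurable]: "V \<in> borel_measurable borel" "p1 \<in> borel_measurable borel" "p2 \<in> borel_measurable borel"
      "q11 \<in> borel_measurable borel" "q12 \<in> borel_measurable borel" "q22 \<in> borel_measurable borel"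
  shows "(set_int (annulus A B) (\<lambda>x. ((p1 x)\<^sup>2 + (p2 x)\<^sup>2) * radial_weight (- 2 - 2 * k) (2 * \<gamma>) a b x)) \<le>
      ennreal (neck_const k \<beta> \<gamma>) *
      ((set_int (annulus A B) (\<lambda>x. (V x)\<^sup>2 * radial_weight (- 4 - 2 * k) (4 * \<beta>) a b x))
      + (set_int (annulus A B) (\<lambda>x. ((q11 x)\<^sup>2 + 2 * (q12 x)\<^sup>2 + (q22 x)\<^sup>2) * radial_weight (- 2 * k) (2 * \<gamma>) a b x)))"
    (is "?L \<le> _ * (?X + ?Y)")
proof -
  let ?K1 = "24 * 3 powr (4 + 2 * k) * 6 powr (4 * \<beta>)"
  let ?K2 = "12 * 3 powr (2 * k) * 6 powr (2 * \<gamma>)"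
  let ?S = "\<lambda>f. set_int (annulus A B) (\<lambda>x. f x * radial_weight (- 2 * k) (2 * \<gamma>) a b x)"
  let ?R = "\<lambda>p. set_int (annulus A B) (\<lambda>x. (p x)\<^sup>2 * radial_weight (- 2 - 2 * k) (2 * \<gamma>) a b x)"
  let ?N = "\<lambda>p. set_int (shell A 2) (\<lambda>x. (p x)\<^sup>2 * radial_weight (- 2 - 2 * k) (2 * \<gamma>) a b x)"
  have AB: "0 < A" "A < B" using ab by linarith+
  have mono: "?S f \<le> ?S g" if "\<And>x. f x \<le> g x" for f g
    using that radial_weight_nonneg by (intro nn_integral_mono mult_right_mono ennreal_leI) auto
  have N1: "?N p1 \<le> ennreal ?K1 * ?X + ennreal ?K2 * ?S (\<lambda>x. (q11 x)\<^sup>2)"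
  proof (rule inner_estimate[OF ab \<gamma>(1) \<beta> _ _ _ _ c(1), where d = 1])
    fix x :: complex assume "x \<noteq> 0"
    note V = V[OF this] and p = p1[OF this]
    show "\<exists>L. (V has_derivative L) (at x) \<and> L 1 = p1 x" by (rule exI, rule conjI, rule V) simp
    show "\<exists>L. (p1 has_derivative L) (at x) \<and> L 1 = q11 x" by (rule exI, rule conjI, rule p) simp
  qed (use k in auto)
  have N2: "?N p2 \<le> ennreal ?K1 * ?X + ennreal ?K2 * ?S (\<lambda>x. (q22 x)\<^sup>2)"
  proof (rule inner_estimate[OF ab \<gamma>(1) \<beta> _ _ _ _ c(3), where d = \<i>])
    fix x :: complex assume "x \<noteq> 0"
    note V = V[OF this] and p = p2[OF this]
    show "\<exists>L. (V has_derivative L) (at x) \<and> L \<i> = p2 x" by (rule exI, rule conjI, rule V) simp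
    show "\<exists>L. (p2 has_derivative L) (at x) \<and> L \<i> = q22 x" by (rule exI, rule conjI, rule p) simp
  qed (use k in auto)
  have R1: "?R p1 \<le> 2 * (?N p1 + ennreal (2 * 4 powr k) * ?S (\<lambda>x. (q11 x)\<^sup>2 + (q12 x)\<^sup>2))"
    by (rule hardy_dilation[OF ab(1,2) AB \<gamma> k p1 c(1,2)]) auto
  have R2: "?R p2 \<le> 2 * (?N p2 + ennreal (2 * 4 powr k) * ?S (\<lambda>x. (q12 x)\<^sup>2 + (q22 x)\<^sup>2))"
    by (rule hardy_dilation[OF ab(1,2) AB \<gamma> k p2 c(2,3)]) auto
  have S1: "?S (\<lambda>x. (q11 x)\<^sup>2) \<le> ?Y" "?S (\<lambda>x. (q22 x)\<^sup>2) \<le> ?Y"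
    by (rule mono, simp)+
  \<comment> \<open>The squared gradients of the two components add up to the squared Hessian norm,
    with the mixed term counted twice.\<close>
  have S2: "?S (\<lambda>x. (q11 x)\<^sup>2 + (q12 x)\<^sup>2) + ?S (\<lambda>x. (q12 x)\<^sup>2 + (q22 x)\<^sup>2) = ?Y"
    using radial_weight_nonneg
    by (subst nn_integral_add[symmetric])
       (auto intro!: nn_integral_cong simp: indicator_def algebra_simps simp flip: ennreal_plus)
  have "?L = ?R p1 + ?R p2"
    using radial_weight_nonneg
    by (subst nn_integral_add[symmetric])
       (auto intro!: nn_integral_cong simp: indicator_def algebra_simps simp flip: ennreal_plus)
  also have "\<dots> \<le> 2 * ((ennreal ?K1 * ?X + ennreal ?K2 * ?Y) + ennreal (2 * 4 powr k) * ?S (\<lambda>x. (q11 x)\<^sup>2 + (q12 x)\<^sup>2))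
      + 2 * ((ennreal ?K1 * ?X + ennreal ?K2 * ?Y) + ennreal (2 * 4 powr k) * ?S (\<lambda>x. (q12 x)\<^sup>2 + (q22 x)\<^sup>2))"
    by (intro add_mono order_trans[OF R1] order_trans[OF R2] mult_left_mono order_trans[OF N1] order_trans[OF N2] S1 order_refl) auto
  also have "\<dots> = 2 * (2 * (ennreal ?K1 * ?X + ennreal ?K2 * ?Y) + ennreal (2 * 4 powr k) * ?Y)"
  proof -
    have *: "2 * (x + c * s) + 2 * (x + c * t) = 2 * (2 * x + c * (s + t))" for x c s t :: ennreal
    proof -
      have "2 * (2 * x + c * (s + t)) = 2 * ((x + x) + (c * s + c * t))"
        by (simp only: distrib_left[of c] mult_2[of x])
      also have "\<dots> = 2 * ((x + c * s) + (x + c * t))" by (simp only: ac_simps)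
      finally show ?thesis by (simp only: distrib_left)
    qed
    show ?thesis unfolding S2[symmetric] by (rule *)
  qed
  also have "\<dots> = ennreal (4 * ?K1) * ?X + ennreal (4 * ?K2 + 4 * 4 powr k) * ?Y"
  proof -
    have *: "2 * (2 * (u * x + v * y) + w * y) = (4 * u) * x + (4 * v + 2 * w) * y" for u v w x y :: ennreal
      by (simp add: distrib_left distrib_right mult.assoc[symmetric] add.assoc)
    have u: "ennreal (4 * ?K1) = 4 * ennreal ?K1" by (subst ennreal_mult') auto
    have v: "ennreal (4 * ?K2 + 4 * 4 powr k) = 4 * ennreal ?K2 + 2 * ennreal (2 * 4 powr k)"
    proof -
      have "ennreal (4 * ?K2 + 2 * (2 * 4 powr k)) = ennreal (4 * ?K2) + ennreal (2 * (2 * 4 powr k))"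
        by (rule ennreal_plus) auto
      also have "ennreal (4 * ?K2) = 4 * ennreal ?K2" by (subst ennreal_mult') auto
      also have "ennreal (2 * (2 * 4 powr k)) = 2 * ennreal (2 * 4 powr k)"
        using ennreal_mult'[of 2 "2 * 4 powr k"] by (simp only: ennreal_numeral)
      finally show ?thesis by simp
    qed
    show ?thesis unfolding u v by (rule *)
  qed
  also have "\<dots> \<le> ennreal (neck_const k \<beta> \<gamma>) * ?X + ennreal (neck_const k \<beta> \<gamma>) * ?Y"
    unfolding neck_const_def by (intro add_mono mult_right_mono ennreal_leI) auto
  finally show ?thesis by (simp add: distrib_left)
qed

section \<open>Weak derivatives\<close>

lemma iterated_partial_append:
  "iterated_partial (es @ fs) \<phi> = iterated_partial es (iterated_partial fs \<phi>)"
  by (induction es) auto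

lemma iterated_partial_eq_0:
  assumes "x \<notin> closure {x. \<phi> x \<noteq> 0}"
  shows "iterated_partial es \<phi> x = 0"
  using assms
proof (induction es arbitrary: x)
  case Nil
  then show ?case using closure_subset[of "{x. \<phi> x \<noteq> 0}"] by auto
next
  case (Cons e es)
  have "((\<lambda>x. 0) has_derivative (\<lambda>h. 0)) (at x)" by simp
  then have "(iterated_partial es \<phi> has_derivative (\<lambda>h. 0)) (at x)"
    by (rule has_derivative_transform_within_open[where s = "- closure {x. \<phi> x \<noteq> 0}"])
       (use Cons in auto)
  from frechet_derivative_at[OF this] show ?case by (metis iterated_partial.simps(2))
qed

lemma iterated_partial_continuous:
  assumes "\<phi> \<in> test_functions \<Omega>" "set es \<subseteq> Basis"
  shows "continuous_on UNIV (iterated_partial es \<phi>)"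
  using assms unfolding test_functions_def smooth_def
  by (auto intro!: continuous_at_imp_continuous_on differentiable_imp_continuous_within)

text \<open>Derivatives of test functions can be used as test functions themselves; iterating weak
  derivatives rests on this.\<close>

lemma iterated_partial_test_function:
  assumes \<phi>: "\<phi> \<in> test_functions \<Omega>" and es: "set es \<subseteq> Basis"
  shows "iterated_partial es \<phi> \<in> test_functions \<Omega>"
proof -
  have sub: "closure {x. iterated_partial es \<phi> x \<noteq> 0} \<subseteq> closure {x. \<phi> x \<noteq> 0}"
    by (rule closure_minimal) (use iterated_partial_eq_0 in auto)
  have "smooth (iterated_partial es \<phi>)"
    using \<phi> es unfolding test_functions_def smooth_def
    by (auto simp flip: iterated_partial_append)
  moreover have "compact (closure {x. iterated_partial es \<phi> x \<noteq> 0})"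
  proof -
    have "compact (closure {x. \<phi> x \<noteq> 0})" using \<phi> unfolding test_functions_def by blast
    then have "compact (closure {x. \<phi> x \<noteq> 0} \<inter> closure {x. iterated_partial es \<phi> x \<noteq> 0})"
      by (rule compact_Int_closed[OF _ closed_closure])
    then show ?thesis using sub by (simp only: Int_absorb1)
  qed
  moreover have "closure {x. iterated_partial es \<phi> x \<noteq> 0} \<subseteq> \<Omega>"
    using \<phi> sub unfolding test_functions_def by blast
  ultimately show ?thesis unfolding test_functions_def mem_Collect_eq by (intro conjI)
qed

lemma lebesgue_measurable_continuous:
  fixes \<psi> :: "'a::euclidean_space \<Rightarrow> real"
  assumes "continuous_on UNIV \<psi>"
  shows "\<psi> \<in> borel_measurable lebesgue"
  using borel_measurable_continuous_onI[OF assms] by (intro measurable_completion) simp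

lemma integrable_compactly_supported_mult:
  fixes v :: "'a::euclidean_space \<Rightarrow> 'b::euclidean_space"
  assumes v: "v locally_integrable_on \<Omega>" and c: "continuous_on UNIV \<psi>"
    and K: "compact K" "K \<subseteq> \<Omega>" and z: "\<And>x. x \<notin> K \<Longrightarrow> \<psi> x = 0"
  shows "set_integrable lebesgue \<Omega> (\<lambda>x. \<psi> x *\<^sub>R v x)"
proof -
  have vK: "integrable lebesgue (\<lambda>x. indicator K x *\<^sub>R v x)"
    using v K by (simp add: locally_integrable_on_def set_integrable_def)
  have "compact (\<psi> ` K)" by (rule compact_continuous_image[OF continuous_on_subset[OF c] K(1)]) simp
  then obtain M where M: "\<forall>y \<in> \<psi> ` K. norm y \<le> M" using compact_imp_bounded bounded_iff by metis
  have eq: "(\<lambda>x. indicator \<Omega> x *\<^sub>R (\<psi> x *\<^sub>R v x)) = (\<lambda>x. \<psi> x *\<^sub>R (indicator K x *\<^sub>R v x))"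
  proof
    fix x
    show "indicator \<Omega> x *\<^sub>R (\<psi> x *\<^sub>R v x) = \<psi> x *\<^sub>R (indicator K x *\<^sub>R v x)"
      using z[of x] K(2) by (cases "x \<in> K") auto
  qed
  have "integrable lebesgue (\<lambda>x. \<psi> x *\<^sub>R (indicator K x *\<^sub>R v x))"
  proof (rule Bochner_Integration.integrable_bound[where f = "\<lambda>x. M *\<^sub>R (indicator K x *\<^sub>R v x)"])
    show "integrable lebesgue (\<lambda>x. M *\<^sub>R (indicator K x *\<^sub>R v x))"
      by (intro integrable_scaleR_right vK)
    show "(\<lambda>x. \<psi> x *\<^sub>R (indicator K x *\<^sub>R v x)) \<in> borel_measurable lebesgue"
      by (rule borel_measurable_scaleR[OF lebesgue_measurable_continuous[OF c] borel_measurable_integrable[OF vK]])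
    show "AE x in lebesgue. norm (\<psi> x *\<^sub>R (indicator K x *\<^sub>R v x)) \<le> norm (M *\<^sub>R (indicator K x *\<^sub>R v x))"
    proof (rule AE_I2)
      fix x
      show "norm (\<psi> x *\<^sub>R (indicator K x *\<^sub>R v x)) \<le> norm (M *\<^sub>R (indicator K x *\<^sub>R v x))"
      proof (cases "x \<in> K")
        case True
        then have "norm (\<psi> x) \<le> M" using M by blast
        then have "\<bar>\<psi> x\<bar> \<le> \<bar>M\<bar>" by simp
        then show ?thesis using True by (simp add: mult_right_mono)
      qed simp
    qed
  qed
  then show ?thesis unfolding set_integrable_def eq .
qed

lemma test_function_integrable:
  fixes v :: "'a::euclidean_space \<Rightarrow> 'b::euclidean_space"
  assumes v: "v locally_integrable_on \<Omega>" and \<phi>: "\<phi> \<in> test_functions \<Omega>" and es: "set es \<subseteq> Basis"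
  shows "set_integrable lebesgue \<Omega> (\<lambda>x. iterated_partial es \<phi> x *\<^sub>R v x)"
  by (rule integrable_compactly_supported_mult[OF v iterated_partial_continuous[OF \<phi> es], where K = "closure {x. \<phi> x \<noteq> 0}"])
     (use \<phi> iterated_partial_eq_0 in \<open>auto simp: test_functions_def\<close>)

section \<open>Linear operations on weak derivatives\<close>

lemma locally_integrable_bounded_linear:
  fixes T :: "'b::euclidean_space \<Rightarrow> 'c::euclidean_space"
  assumes T: "bounded_linear T" and v: "v locally_integrable_on \<Omega>"
  shows "(\<lambda>x. T (v x)) locally_integrable_on \<Omega>"
  using v integrable_bounded_linear[OF T]
  unfolding locally_integrable_on_def set_integrable_def
  by (fastforce simp: linear_simps(5)[OF T])

lemma locally_integrable_add:
  assumes "u locally_integrable_on \<Omega>" "v locally_integrable_on \<Omega>"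
  shows "(\<lambda>x. u x + v x) locally_integrable_on \<Omega>"
  using assms unfolding locally_integrable_on_def by (auto intro: set_integral_add)

lemma set_lebesgue_integral_bounded_linear:
  fixes T :: "'b::euclidean_space \<Rightarrow> 'c::euclidean_space"
  assumes T: "bounded_linear T" and v: "set_integrable M A v"
  shows "(LINT x:A|M. T (v x)) = T (LINT x:A|M. v x)"
  using integral_bounded_linear[OF T v[unfolded set_integrable_def]]
  unfolding set_lebesgue_integral_def by (simp add: linear_simps(5)[OF T])

text \<open>Applied with T a coordinate functional, the embedding of the reals into the complex
  numbers, and multiplication by a complex constant.\<close>

lemma has_weak_partial_bounded_linear:
  fixes T :: "'b::euclidean_space \<Rightarrow> 'c::euclidean_space"
  assumes T: "bounded_linear T" and w: "has_weak_partial \<Omega> es u v" and es: "set es \<subseteq> Basis"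
  shows "has_weak_partial \<Omega> es (\<lambda>x. T (u x)) (\<lambda>x. T (v x))"
  unfolding has_weak_partial_def
proof (intro conjI ballI)
  have l: "u locally_integrable_on \<Omega>" "v locally_integrable_on \<Omega>" using w by (auto simp: has_weak_partial_def)
  then show "(\<lambda>x. T (u x)) locally_integrable_on \<Omega>" "(\<lambda>x. T (v x)) locally_integrable_on \<Omega>"
    using locally_integrable_bounded_linear[OF T] by auto
  fix \<phi> assume \<phi>: "\<phi> \<in> test_functions \<Omega>"
  have "(LINT x:\<Omega>|lebesgue. iterated_partial es \<phi> x *\<^sub>R T (u x)) = T (LINT x:\<Omega>|lebesgue. iterated_partial es \<phi> x *\<^sub>R u x)"
    using set_lebesgue_integral_bounded_linear[OF T test_function_integrable[OF l(1) \<phi> es]]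
    by (simp add: linear_simps(5)[OF T])
  also have "(LINT x:\<Omega>|lebesgue. iterated_partial es \<phi> x *\<^sub>R u x) = (-1) ^ length es *\<^sub>R (LINT x:\<Omega>|lebesgue. \<phi> x *\<^sub>R v x)"
    using w \<phi> by (simp add: has_weak_partial_def)
  also have "T \<dots> = (-1) ^ length es *\<^sub>R (LINT x:\<Omega>|lebesgue. \<phi> x *\<^sub>R T (v x))"
    using set_lebesgue_integral_bounded_linear[OF T test_function_integrable[OF l(2) \<phi>, of "[]"]]
    by (simp add: linear_simps(5)[OF T])
  finally show "(LINT x:\<Omega>|lebesgue. iterated_partial es \<phi> x *\<^sub>R T (u x)) = (-1) ^ length es *\<^sub>R (LINT x:\<Omega>|lebesgue. \<phi> x *\<^sub>R T (v x))" .
qed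

lemma has_weak_partial_add:
  fixes u v :: "'a::euclidean_space \<Rightarrow> 'b::euclidean_space"
  assumes w: "has_weak_partial \<Omega> es u v" "has_weak_partial \<Omega> es u' v'" and es: "set es \<subseteq> Basis"
  shows "has_weak_partial \<Omega> es (\<lambda>x. u x + u' x) (\<lambda>x. v x + v' x)"
  unfolding has_weak_partial_def
proof (intro conjI ballI)
  have l: "u locally_integrable_on \<Omega>" "v locally_integrable_on \<Omega>" "u' locally_integrable_on \<Omega>" "v' locally_integrable_on \<Omega>"
    using w by (auto simp: has_weak_partial_def)
  then show "(\<lambda>x. u x + u' x) locally_integrable_on \<Omega>" "(\<lambda>x. v x + v' x) locally_integrable_on \<Omega>"
    using locally_integrable_add by auto
  fix \<phi> assume \<phi>: "\<phi> \<in> test_functions \<Omega>"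
  show "(LINT x:\<Omega>|lebesgue. iterated_partial es \<phi> x *\<^sub>R (u x + u' x)) = (-1) ^ length es *\<^sub>R (LINT x:\<Omega>|lebesgue. \<phi> x *\<^sub>R (v x + v' x))"
    using w \<phi> set_integral_add(2)[OF test_function_integrable[OF l(1) \<phi> es] test_function_integrable[OF l(3) \<phi> es]]
      set_integral_add(2)[OF test_function_integrable[OF l(2) \<phi>, of "[]"] test_function_integrable[OF l(4) \<phi>, of "[]"]]
    by (simp add: has_weak_partial_def scaleR_add_right)
qed

text \<open>Testing D, the b-derivative of u, with the a-derivative of \<phi> moves both derivatives
  onto u. Thus a second-order weak derivative of u is a first-order one of any representative of its
  first-order derivative.\<close>

lemma has_weak_partial_iterate:
  assumes D: "has_weak_partial \<Omega> [b] u D" and W: "has_weak_partial \<Omega> [b, a] u W"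
    and ab: "a \<in> Basis" "b \<in> Basis"
  shows "has_weak_partial \<Omega> [a] D W"
  unfolding has_weak_partial_def
proof (intro conjI ballI)
  show "D locally_integrable_on \<Omega>" "W locally_integrable_on \<Omega>"
    using D W by (auto simp: has_weak_partial_def)
  fix \<phi> assume \<phi>: "\<phi> \<in> test_functions \<Omega>"
  have "iterated_partial [a] \<phi> \<in> test_functions \<Omega>"
    by (rule iterated_partial_test_function[OF \<phi>]) (use ab in simp)
  then have "(LINT x:\<Omega>|lebesgue. iterated_partial [b] (iterated_partial [a] \<phi>) x *\<^sub>R u x) =
      - (LINT x:\<Omega>|lebesgue. iterated_partial [a] \<phi> x *\<^sub>R D x)"
    using D unfolding has_weak_partial_def by fastforce
  moreover have "(LINT x:\<Omega>|lebesgue. iterated_partial [b, a] \<phi> x *\<^sub>R u x) = (LINT x:\<Omega>|lebesgue. \<phi> x *\<^sub>R W x)"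
    using W \<phi> unfolding has_weak_partial_def by fastforce
  moreover have "iterated_partial [b] (iterated_partial [a] \<phi>) = iterated_partial [b, a] \<phi>" by simp
  ultimately have "- (LINT x:\<Omega>|lebesgue. iterated_partial [a] \<phi> x *\<^sub>R D x) = (LINT x:\<Omega>|lebesgue. \<phi> x *\<^sub>R W x)"
    by (simp only:)
  then show "(LINT x:\<Omega>|lebesgue. iterated_partial [a] \<phi> x *\<^sub>R D x) = (-1) ^ length [a] *\<^sub>R (LINT x:\<Omega>|lebesgue. \<phi> x *\<^sub>R W x)"
    by (metis add.inverse_inverse length_Cons list.size(3) power_one_right One_nat_def scaleR_minus1_left)
qed

section \<open>Weak derivatives tested on translated bumps\<close>

lemma prod_bump_reflect: "prod_bump s 0 i j (x - y) = prod_bump (- s) (s *\<^sub>R x) i j y"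
  by (simp add: prod_bump_def algebra_simps)

lemma bump_test_function:
  assumes e: "e > 0" and sub: "cball x (2 * e) \<subseteq> \<Omega>"
  shows "(\<lambda>y. bump e 0 0 (x - y)) \<in> test_functions \<Omega>"
proof -
  have "prod_bump (- (1 / e)) ((1 / e) *\<^sub>R x) 0 0 \<in> test_functions \<Omega>"
  proof (rule prod_bump_test_function)
    show "{y. \<bar>- (1 / e) * Re y + Re ((1 / e) *\<^sub>R x)\<bar> \<le> 1 \<and> \<bar>- (1 / e) * Im y + Im ((1 / e) *\<^sub>R x)\<bar> \<le> 1} \<subseteq> \<Omega>"
    proof
      fix y assume "y \<in> {y. \<bar>- (1 / e) * Re y + Re ((1 / e) *\<^sub>R x)\<bar> \<le> 1 \<and> \<bar>- (1 / e) * Im y + Im ((1 / e) *\<^sub>R x)\<bar> \<le> 1}"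
      then have "\<bar>(Re x - Re y) / e\<bar> \<le> 1" "\<bar>(Im x - Im y) / e\<bar> \<le> 1" by (auto simp: diff_divide_distrib)
      then have "\<bar>Re (x - y)\<bar> \<le> e" "\<bar>Im (x - y)\<bar> \<le> e" using e by auto
      then have "dist x y \<le> 2 * e" using cmod_le[of "x - y"] by (simp add: dist_norm)
      then show "y \<in> \<Omega>" using sub by auto
    qed
  qed (use e in simp)
  then show ?thesis by (simp only: prod_bump_reflect)
qed

text \<open>Differentiating y -> B(x - y) produces one sign per derivative, which cancels the sign
  in the definition of a weak derivative. In other words, differentiating a mollified u agrees with
  mollifying its weak derivative.\<close>

lemma weak_partial_bump:
  fixes u v :: "complex \<Rightarrow> real"
  assumes w: "has_weak_partial \<Omega> es u v" and es: "set es \<subseteq> Basis"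
    and e: "e > 0" and sub: "cball x (2 * e) \<subseteq> \<Omega>"
  shows "(1 / e) ^ length es * (LINT y:\<Omega>|lebesgue. bump e (count_list es 1) (count_list es \<i>) (x - y) * u y)
    = (LINT y:\<Omega>|lebesgue. bump e 0 0 (x - y) * v y)"
proof -
  have t: "(\<lambda>y. bump e 0 0 (x - y)) \<in> test_functions \<Omega>"
    by (rule bump_test_function[OF e sub])
  have "iterated_partial es (\<lambda>y. bump e 0 0 (x - y)) =
      (\<lambda>y. (- (1 / e)) ^ length es * bump e (count_list es 1) (count_list es \<i>) (x - y))"
    unfolding prod_bump_reflect by (subst iterated_partial_prod_bump[OF es]) simp
  also have "\<dots> = (\<lambda>y. (-1) ^ length es * ((1 / e) ^ length es * bump e (count_list es 1) (count_list es \<i>) (x - y)))"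
    by (subst power_minus) (simp only: mult.assoc)
  finally have it: "iterated_partial es (\<lambda>y. bump e 0 0 (x - y)) = \<dots>" .
  have "(LINT y:\<Omega>|lebesgue. (-1) ^ length es * ((1 / e) ^ length es * bump e (count_list es 1) (count_list es \<i>) (x - y)) * u y)
      = (-1) ^ length es * (LINT y:\<Omega>|lebesgue. bump e 0 0 (x - y) * v y)"
  proof -
    have "\<forall>\<phi>\<in>test_functions \<Omega>. (LINT x:\<Omega>|lebesgue. iterated_partial es \<phi> x *\<^sub>R u x) =
        (-1) ^ length es *\<^sub>R (LINT x:\<Omega>|lebesgue. \<phi> x *\<^sub>R v x)"
      using w unfolding has_weak_partial_def by simp
    from bspec[OF this t] show ?thesis unfolding it real_scaleR_def .
  qed
  moreover have "(LINT y:\<Omega>|lebesgue. (-1) ^ length es * ((1 / e) ^ length es * bump e (count_list es 1) (count_list es \<i>) (x - y)) * u y)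
     = (-1) ^ length es * ((1 / e) ^ length es * (LINT y:\<Omega>|lebesgue. bump e (count_list es 1) (count_list es \<i>) (x - y) * u y))"
    by (simp only: mult.assoc set_integral_mult_right)
  ultimately have "(-1::real) ^ length es * ((1 / e) ^ length es * (LINT y:\<Omega>|lebesgue. bump e (count_list es 1) (count_list es \<i>) (x - y) * u y))
     = (-1) ^ length es * (LINT y:\<Omega>|lebesgue. bump e 0 0 (x - y) * v y)" by (simp only:)
  moreover have "(-1::real) ^ length es \<noteq> 0" by simp
  ultimately show ?thesis by (rule mult_left_cancel[THEN iffD1, rotated])
qed

text \<open>Weak derivatives are only Lebesgue measurable, whereas the convolution results are
  stated for functions integrable with respect to \<open>lborel\<close>; this passes to a Borel
  representative of the function extended by zero.\<close>

lemma borel_rep: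
  fixes u :: "'a::euclidean_space \<Rightarrow> real"
  assumes "set_integrable lebesgue A u"
  obtains f where "integrable lborel f" "AE x in lborel. indicator A x * u x = f x"
    "AE x in lebesgue. indicator A x * u x = f x"
proof -
  have i: "integrable lebesgue (\<lambda>x. indicator A x * u x)"
    using assms by (simp add: set_integrable_def)
  obtain f where f: "f \<in> borel_measurable lborel" "AE x in lborel. indicator A x * u x = f x"
    using completion_ex_borel_measurable_real[OF borel_measurable_integrable[OF i]] by blast
  have ae: "AE x in lebesgue. indicator A x * u x = f x" using AE_completion[OF f(2)] .
  have "integrable lebesgue f"
    by (rule integrable_cong_AE_imp[OF i measurable_completion[OF f(1)] ae])
  then have "integrable lborel f" using integrable_completion[OF f(1)] by simp
  with f ae that show ?thesis by blast
qed

lemma set_integral_borel_rep: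
  fixes u g :: "'a::euclidean_space \<Rightarrow> real"
  assumes u: "set_integrable lebesgue A u" and f: "integrable lborel f"
    and ae: "AE x in lebesgue. indicator A x * u x = f x" and g: "continuous_on UNIV g"
  shows "(LINT y:A|lebesgue. g y * u y) = (\<integral>y. g y * f y \<partial>lborel)"
proof -
  have "(LINT y:A|lebesgue. g y * u y) = (\<integral>y. g y * (indicator A y * u y) \<partial>lebesgue)"
    unfolding set_lebesgue_integral_def by (simp add: mult_ac)
  also have "\<dots> = (\<integral>y. g y * f y \<partial>lebesgue)"
  proof (rule integral_cong_AE)
    have m: "(\<lambda>x. indicator A x * u x) \<in> borel_measurable lebesgue"
      using u borel_measurable_integrable by (fastforce simp: set_integrable_def)
    show "(\<lambda>y. g y * (indicator A y * u y)) \<in> borel_measurable lebesgue"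
      by (rule borel_measurable_times[OF lebesgue_measurable_continuous[OF g] m])
    have "f \<in> borel_measurable lebesgue" by (intro measurable_completion borel_measurable_integrable f)
    then show "(\<lambda>y. g y * f y) \<in> borel_measurable lebesgue"
      by (rule borel_measurable_times[OF lebesgue_measurable_continuous[OF g]])
    show "AE y in lebesgue. g y * (indicator A y * u y) = g y * f y"
      using ae by eventually_elim simp
  qed
  also have "\<dots> = (\<integral>y. g y * f y \<partial>lborel)"
    using borel_measurable_continuous_onI[OF g] borel_measurable_integrable[OF f]
    by (intro integral_completion borel_measurable_times) simp_all
  finally show ?thesis .
qed

lemma bump_continuous: "continuous_on UNIV (\<lambda>y. prod_bump s 0 i j (x - y))"
  unfolding prod_bump_reflect by (rule prod_bump_continuous)

text \<open>Near each point the hypothesis says that mollifications of v at small scales vanish, and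
  they converge to v in L^1. Negligibility is a local property, so it suffices to treat small
  discs.\<close>

lemma fundamental_lemma:
  fixes v :: "complex \<Rightarrow> real"
  assumes \<Omega>: "open \<Omega>" and v: "v locally_integrable_on \<Omega>"
    and z: "\<And>x e. e > 0 \<Longrightarrow> cball x (2 * e) \<subseteq> \<Omega> \<Longrightarrow> (LINT y:\<Omega>|lebesgue. bump e 0 0 (x - y) * v y) = 0"
  shows "AE x in lebesgue. x \<in> \<Omega> \<longrightarrow> v x = 0"
proof -
  let ?S = "{x \<in> \<Omega>. v x \<noteq> 0}"
  have "negligible ?S"
  proof (rule iffD2[OF locally_negligible_alt], rule ballI)
    fix x0 assume x0: "x0 \<in> ?S"
    \<comment> \<open>Two radii: for x within r of x0 and 2e <= r the support of the bump at x stays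
      inside radius 2r, where v is integrable.\<close>
    obtain r where r: "r > 0" "cball x0 (2 * r) \<subseteq> \<Omega>"
    proof -
      obtain e where "e > 0" "cball x0 e \<subseteq> \<Omega>" using \<Omega> x0 open_contains_cball by blast
      then show ?thesis using that[of "e / 2"] by auto
    qed
    let ?K = "cball x0 (2 * r)"
    have vK: "set_integrable lebesgue ?K v" using v r(2) by (auto simp: locally_integrable_on_def)
    obtain f where f: "integrable lborel f" and ae: "AE x in lborel. indicator ?K x * v x = f x"
      "AE x in lebesgue. indicator ?K x * v x = f x" by (rule borel_rep[OF vK])
    have [measurable]: "f \<in> borel_measurable borel" using f by auto
    have [measurable]: "ball x0 r \<in> sets borel" by (intro borel_open) auto
    have conv0: "convol (bump_kernel e) f x = 0" if e: "e > 0" "2 * e \<le> r" and x: "x \<in> ball x0 r" for e x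
    proof -
      have sub: "cball x (2 * e) \<subseteq> ?K"
      proof
        fix y assume "y \<in> cball x (2 * e)"
        then show "y \<in> ?K" using x e dist_triangle[of x0 y x] by auto
      qed
      \<comment> \<open>The bump vanishes off the disc of radius 2e about x, which lies in both
        sets, so the domain of integration can be exchanged.\<close>
      have "(LINT y:\<Omega>|lebesgue. bump e 0 0 (x - y) * v y) = (LINT y:?K|lebesgue. bump e 0 0 (x - y) * v y)"
        unfolding set_lebesgue_integral_def
      proof (rule Bochner_Integration.integral_cong[OF refl])
        fix y
        show "indicat_real \<Omega> y *\<^sub>R (bump e 0 0 (x - y) * v y) = indicat_real ?K y *\<^sub>R (bump e 0 0 (x - y) * v y)"
        proof (cases "y \<in> cball x (2 * e)")
          case True
          then have "y \<in> ?K" "y \<in> \<Omega>" using sub r(2) by auto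
          then show ?thesis by simp
        next
          case False
          then have "bump e 0 0 (x - y) = 0"
            using prod_bump_support[OF e(1)] by (simp add: dist_norm)
          then show ?thesis by simp
        qed
      qed
      then have "(\<integral>y. bump e 0 0 (x - y) * f y \<partial>lborel) = 0"
        using z[OF e(1), of x] sub r(2) set_integral_borel_rep[OF vK f ae(2) bump_continuous, of "1/e" 0 0 x]
        by (metis dual_order.trans)
      then show ?thesis by (simp add: convol_bump_kernel convol_def[of "prod_bump _ _ _ _"])
    qed
    have le: "(set_int (ball x0 r) (\<lambda>x. \<bar>f x\<bar>)) \<le> ennreal \<eta>" if \<eta>: "\<eta> > 0" for \<eta> :: real
    proof -
      have "Lp_int 1 f < \<infinity>" using f by (simp add: Lp_int_def integrable_iff_bounded)
      from mollifier_convergence[OF _ f this \<eta>] obtain d where d: "d > 0"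
        "\<And>\<kappa>. mollifier d \<kappa> \<Longrightarrow> Lp_int 1 (\<lambda>x. convol \<kappa> f x - f x) \<le> ennreal \<eta>" by auto
      define e where "e = min (d / 2) (r / 2)"
      have e: "e > 0" "2 * e \<le> d" "2 * e \<le> r" using d(1) r(1) by (auto simp: e_def min_def)
      have "mollifier d (bump_kernel e)"
        using mollifier_bump_kernel[OF e(1)] e(2) by (auto simp: mollifier_def)
      from d(2)[OF this] have "Lp_int 1 (\<lambda>x. convol (bump_kernel e) f x - f x) \<le> ennreal \<eta>" .
      \<comment> \<open>On the smaller disc the convolution is 0, so the approximation error there
        is |f| itself.\<close>
      moreover have "(set_int (ball x0 r) (\<lambda>x. \<bar>f x\<bar>)) \<le> Lp_int 1 (\<lambda>x. convol (bump_kernel e) f x - f x)"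
        unfolding Lp_int_def using conv0[OF e(1,3)] by (intro nn_integral_mono) (auto simp: indicator_def)
      ultimately show ?thesis by (rule order_trans[rotated])
    qed
    have "(set_int (ball x0 r) (\<lambda>x. \<bar>f x\<bar>)) = 0"
    proof (rule ccontr)
      assume n: "(set_int (ball x0 r) (\<lambda>x. \<bar>f x\<bar>)) \<noteq> 0" (is "?J \<noteq> 0")
      have "?J \<le> ennreal 1" by (rule le) simp
      then obtain j where j: "?J = ennreal j" "j \<ge> 0" by (cases ?J) (auto simp: top_unique)
      then have "j > 0" using n by auto
      then show False using le[of "j / 2"] j by auto
    qed
    then have "AE x in lborel. ennreal \<bar>f x\<bar> * indicator (ball x0 r) x = 0"
      by (subst (asm) nn_integral_0_iff_AE) auto
    then have "AE x in lborel. x \<in> ball x0 r \<longrightarrow> v x = 0"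
      using ae(1)
    proof eventually_elim
      case (elim x)
      show ?case
      proof
        assume x: "x \<in> ball x0 r"
        then have "x \<in> ?K" using r(1) by auto
        then show "v x = 0" using elim x by simp
      qed
    qed
    then have "AE x in lebesgue. x \<in> ball x0 r \<longrightarrow> v x = 0" by (rule AE_completion)
    then obtain N where N: "{x \<in> space lebesgue. \<not> (x \<in> ball x0 r \<longrightarrow> v x = 0)} \<subseteq> N" "N \<in> null_sets lebesgue"
      by (auto elim!: AE_E simp: null_sets_def)
    have "?S \<inter> ball x0 r \<subseteq> N" using N(1) by auto
    then have "negligible (?S \<inter> ball x0 r)"
      using N(2) negligible_subset unfolding negligible_iff_null_sets[symmetric] by blast
    moreover have "openin (top_of_set ?S) (?S \<inter> ball x0 r)" by (simp add: openin_open_Int)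
    moreover have "x0 \<in> ?S \<inter> ball x0 r" using x0 r(1) by auto
    ultimately show "\<exists>U. openin (top_of_set ?S) U \<and> x0 \<in> U \<and> negligible U" by blast
  qed
  then have "AE x in lebesgue. x \<notin> ?S" unfolding negligible_iff_null_sets by (rule AE_not_in)
  then show ?thesis by eventually_elim auto
qed

lemma AE_eq_if_bump_integrals_eq:
  fixes v w :: "complex \<Rightarrow> real"
  assumes \<Omega>: "open \<Omega>" and v: "v locally_integrable_on \<Omega>" "w locally_integrable_on \<Omega>"
    and eq: "\<And>x e. e > 0 \<Longrightarrow> cball x (2 * e) \<subseteq> \<Omega> \<Longrightarrow>
      (LINT y:\<Omega>|lebesgue. bump e 0 0 (x - y) * v y) = (LINT y:\<Omega>|lebesgue. bump e 0 0 (x - y) * w y)"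
  shows "AE x in lebesgue. x \<in> \<Omega> \<longrightarrow> v x = w x"
proof -
  have "(\<lambda>x. - w x) locally_integrable_on \<Omega>"
    using locally_integrable_bounded_linear[OF bounded_linear_minus[OF bounded_linear_ident] v(2)] .
  then have l: "(\<lambda>x. v x + - w x) locally_integrable_on \<Omega>" by (rule locally_integrable_add[OF v(1)])
  have "AE x in lebesgue. x \<in> \<Omega> \<longrightarrow> v x + - w x = 0"
  proof (rule fundamental_lemma[OF \<Omega> l])
    fix x and e :: real assume e: "e > 0" "cball x (2 * e) \<subseteq> \<Omega>"
    note t = bump_test_function[OF e]
    have i: "set_integrable lebesgue \<Omega> (\<lambda>y. bump e 0 0 (x - y) * v y)"
      "set_integrable lebesgue \<Omega> (\<lambda>y. bump e 0 0 (x - y) * w y)"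
      using test_function_integrable[OF v(1) t, of "[]"] test_function_integrable[OF v(2) t, of "[]"] by simp_all
    show "(LINT y:\<Omega>|lebesgue. bump e 0 0 (x - y) * (v y + - w y)) = 0"
      using set_integral_diff(2)[OF i] eq[OF e] by (simp add: right_diff_distrib)
  qed
  then show ?thesis by eventually_elim auto
qed

lemma has_weak_partial_unique_real:
  fixes u v w :: "complex \<Rightarrow> real"
  assumes \<Omega>: "open \<Omega>" and es: "set es \<subseteq> Basis"
    and vw: "has_weak_partial \<Omega> es u v" "has_weak_partial \<Omega> es u w"
  shows "AE x in lebesgue. x \<in> \<Omega> \<longrightarrow> v x = w x"
proof (rule AE_eq_if_bump_integrals_eq[OF \<Omega>])
  show "v locally_integrable_on \<Omega>" "w locally_integrable_on \<Omega>" using vw by (auto simp: has_weak_partial_def)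
  show "(LINT y:\<Omega>|lebesgue. bump e 0 0 (x - y) * v y) = (LINT y:\<Omega>|lebesgue. bump e 0 0 (x - y) * w y)"
    if "e > 0" "cball x (2 * e) \<subseteq> \<Omega>" for x e
    using weak_partial_bump[OF vw(1) es that] weak_partial_bump[OF vw(2) es that] by simp
qed

text \<open>The representative selected by \<open>weak_partial\<close> is arbitrary, but once some
  weak derivative exists uniqueness ties it to every other one. Vector values are handled coordinate
  by coordinate.\<close>

lemma weak_partial_AE_eq:
  fixes u v :: "complex \<Rightarrow> 'b::euclidean_space"
  assumes \<Omega>: "open \<Omega>" and es: "set es \<subseteq> Basis" and v: "has_weak_partial \<Omega> es u v"
  shows "AE x in lebesgue. x \<in> \<Omega> \<longrightarrow> weak_partial \<Omega> es u x = v x"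
proof -
  have w: "has_weak_partial \<Omega> es u (weak_partial \<Omega> es u)"
    unfolding weak_partial_def by (rule someI[where P = "has_weak_partial \<Omega> es u", OF v])
  have "AE x in lebesgue. \<forall>b\<in>Basis. x \<in> \<Omega> \<longrightarrow> weak_partial \<Omega> es u x \<bullet> b = v x \<bullet> b"
  proof (intro AE_finite_allI finite_Basis)
    fix b :: 'b assume "b \<in> Basis"
    have T: "bounded_linear (\<lambda>x. x \<bullet> b)" by (rule bounded_linear_inner_left)
    show "AE x in lebesgue. x \<in> \<Omega> \<longrightarrow> weak_partial \<Omega> es u x \<bullet> b = v x \<bullet> b"
      by (rule has_weak_partial_unique_real[OF \<Omega> es has_weak_partial_bounded_linear[OF T w es] has_weak_partial_bounded_linear[OF T v es]])
  qed
  then show ?thesis by eventually_elim (auto intro: euclidean_eqI)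
qed

text \<open>Both orders of differentiation turn a bump into the same function, so the two weak
  derivatives have equal bump integrals.\<close>

lemma mixed_weak_partials_AE_eq:
  fixes u v w :: "complex \<Rightarrow> real"
  assumes \<Omega>: "open \<Omega>" and vw: "has_weak_partial \<Omega> [1, \<i>] u v" "has_weak_partial \<Omega> [\<i>, 1] u w"
  shows "AE x in lebesgue. x \<in> \<Omega> \<longrightarrow> v x = w x"
proof (rule AE_eq_if_bump_integrals_eq[OF \<Omega>])
  show "v locally_integrable_on \<Omega>" "w locally_integrable_on \<Omega>" using vw by (auto simp: has_weak_partial_def)
  show "(LINT y:\<Omega>|lebesgue. bump e 0 0 (x - y) * v y) = (LINT y:\<Omega>|lebesgue. bump e 0 0 (x - y) * w y)"
    if "e > 0" "cball x (2 * e) \<subseteq> \<Omega>" for x e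
    using weak_partial_bump[OF vw(1) _ that] weak_partial_bump[OF vw(2) _ that]
    by (simp add: Basis_complex_def)
qed

section \<open>Conjugation with a power of the radius\<close>

lemma mollifier_mono: "mollifier d \<kappa> \<Longrightarrow> d \<le> d' \<Longrightarrow> mollifier d' \<kappa>"
  by (auto simp: mollifier_def)

text \<open>The array g consists of the derivatives of one mollification of \<open>V 0 0\<close>,
  hence its derivative relations hold on the whole plane. On S, at distance \<delta> from the
  complement of \<Omega>, \<open>link\<close> identifies \<open>g i j\<close> with the mollification
  of \<open>V i j\<close>, which is close in L^2.\<close>

lemma smooth_approximation:
  fixes V :: "nat \<Rightarrow> nat \<Rightarrow> complex \<Rightarrow> real"
  assumes int: "\<And>i j. i + j \<le> 2 \<Longrightarrow> integrable lborel (V i j)"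
    and L2: "\<And>i j. i + j \<le> 2 \<Longrightarrow> Lp_int 2 (V i j) < \<infinity>"
    and link: "\<And>i j x e. i + j \<le> 2 \<Longrightarrow> e > 0 \<Longrightarrow> cball x (2 * e) \<subseteq> \<Omega> \<Longrightarrow>
      (1 / e) ^ (i + j) * convol (bump e i j) (V 0 0) x = convol (bump e 0 0) (V i j) x"
    and \<delta>: "\<delta> > 0" "\<And>x. x \<in> S \<Longrightarrow> cball x \<delta> \<subseteq> \<Omega>" and \<eta>: "\<eta> > 0"
  shows "\<exists>g. (\<forall>i j x. (g i j has_derivative (dxy (g (Suc i) j x) (g i (Suc j) x))) (at x)) \<and>
    (\<forall>i j. i + j \<le> 2 \<longrightarrow> (set_int S (\<lambda>x. (g i j x - V i j x)\<^sup>2)) \<le> ennreal \<eta>)"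
proof -
  have "\<exists>d>0. \<forall>\<kappa>. mollifier d \<kappa> \<longrightarrow> Lp_int 2 (\<lambda>x. convol \<kappa> (V i j) x - V i j x) \<le> ennreal \<eta>" if "i + j \<le> 2" for i j
    by (rule mollifier_convergence[OF _ int[OF that] L2[OF that] \<eta>]) simp
  then obtain D where D: "\<And>i j. i + j \<le> 2 \<Longrightarrow> D i j > 0"
    "\<And>i j \<kappa>. i + j \<le> 2 \<Longrightarrow> mollifier (D i j) \<kappa> \<Longrightarrow> Lp_int 2 (\<lambda>x. convol \<kappa> (V i j) x - V i j x) \<le> ennreal \<eta>"
    by metis
  let ?I = "{p::nat \<times> nat. fst p + snd p \<le> 2}"
  have fin: "finite ?I"
    by (rule finite_subset[of _ "{..2} \<times> {..2}"]) auto
  \<comment> \<open>One scale for all six derivatives of order at most 2, capped by \<delta> so that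
    supports stay in \<Omega>.\<close>
  define d where "d = Min (insert \<delta> ((\<lambda>p. D (fst p) (snd p)) ` ?I))"
  have dD: "d \<le> D i j" if "i + j \<le> 2" for i j
    unfolding d_def using fin that by (intro Min_le) (auto intro!: image_eqI[of _ _ "(i, j)"])
  have d\<delta>: "d \<le> \<delta>" unfolding d_def using fin by (intro Min_le) auto
  have d0: "d > 0" unfolding d_def using fin D(1) \<delta>(1) by (subst Min_gr_iff) auto
  define e where "e = d / 2"
  have e: "e > 0" "2 * e = d" using d0 by (auto simp: e_def)
  \<comment> \<open>The power of 1/e is the chain-rule factor; with it, the derivatives of
    \<open>g i j\<close> are exactly the neighbouring entries of the array.\<close>
  define g where "g = (\<lambda>i j x. (1 / e) ^ (i + j) * convol (bump e i j) (V 0 0) x / bump_mass e)"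
  have i0: "integrable lborel (V 0 0)" by (rule int) simp
  have "(g i j has_derivative (dxy (g (Suc i) j x) (g i (Suc j) x))) (at x)" for i j x
  proof -
    have "((\<lambda>x. (1 / e) ^ (i + j) / bump_mass e * convol (bump e i j) (V 0 0) x) has_derivative
      (\<lambda>h. (1 / e) ^ (i + j) / bump_mass e * ((1 / e) * convol (bump e (Suc i) j) (V 0 0) x * Re h
         + (1 / e) * convol (bump e i (Suc j)) (V 0 0) x * Im h))) (at x)"
      by (intro has_derivative_mult_right convol_prod_bump_has_derivative i0)
    moreover have "(\<lambda>x. (1 / e) ^ (i + j) / bump_mass e * convol (bump e i j) (V 0 0) x) = g i j"
      by (simp add: g_def fun_eq_iff)
    moreover have "(\<lambda>h. (1 / e) ^ (i + j) / bump_mass e * ((1 / e) * convol (bump e (Suc i) j) (V 0 0) x * Re h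
         + (1 / e) * convol (bump e i (Suc j)) (V 0 0) x * Im h)) = (dxy (g (Suc i) j x) (g i (Suc j) x))"
      by (rule ext) (simp add: g_def distrib_left mult_ac)
    ultimately show ?thesis by simp
  qed
  moreover have "(set_int S (\<lambda>x. (g i j x - V i j x)\<^sup>2)) \<le> ennreal \<eta>" if ij: "i + j \<le> 2" for i j
  proof -
    have m: "mollifier (D i j) (bump_kernel e)"
      using mollifier_mono[OF mollifier_bump_kernel[OF e(1)]] dD[OF ij] e(2) by simp
    have "(set_int S (\<lambda>x. (g i j x - V i j x)\<^sup>2)) \<le> Lp_int 2 (\<lambda>x. convol (bump_kernel e) (V i j) x - V i j x)"
      unfolding Lp_int_def
    proof (rule nn_integral_mono)
      fix x
      show "ennreal ((g i j x - V i j x)\<^sup>2) * indicator S x \<le> ennreal (\<bar>convol (bump_kernel e) (V i j) x - V i j x\<bar> ^ 2)"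
      proof (cases "x \<in> S")
        case True
        have "cball x (2 * e) \<subseteq> \<Omega>" using \<delta>(2)[OF True] d\<delta> e(2) by auto
        then have "g i j x = convol (bump_kernel e) (V i j) x"
          unfolding g_def convol_bump_kernel using link[OF ij e(1)] by simp
        then show ?thesis using True by simp
      qed simp
    qed
    also have "\<dots> \<le> ennreal \<eta>" by (rule D(2)[OF ij m])
    finally show ?thesis .
  qed
  ultimately show ?thesis by blast
qed

text \<open>\<open>rinv\<close> and \<open>iinv\<close> are the components of x/|x|^2; for x nonzero
  1/x = \<open>rinv x\<close> - \<i> \<open>iinv x\<close>, which links them to the complex
  operator.\<close>

definition rinv :: "complex \<Rightarrow> real" where "rinv x = Re x / (cmod x)\<^sup>2"
definition iinv :: "complex \<Rightarrow> real" where "iinv x = Im x / (cmod x)\<^sup>2"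

text \<open>The components of \<open>r\<^sup>-\<^sup>k \<nabla>(r\<^sup>k u)\<close> and of the Hessian \<open>r\<^sup>-\<^sup>k \<nabla>\<^sup>2(r\<^sup>k u)\<close>, with \<open>r = |x|\<close>,
  in terms of the array \<open>v i j = \<partial>\<^sub>1\<^sup>i \<partial>\<^sub>2\<^sup>j u\<close>.\<close>

definition conj_grad1 :: "real \<Rightarrow> (nat \<Rightarrow> nat \<Rightarrow> complex \<Rightarrow> real) \<Rightarrow> complex \<Rightarrow> real" where
  "conj_grad1 k v x = v 1 0 x + k * rinv x * v 0 0 x"
definition conj_grad2 :: "real \<Rightarrow> (nat \<Rightarrow> nat \<Rightarrow> complex \<Rightarrow> real) \<Rightarrow> complex \<Rightarrow> real" where
  "conj_grad2 k v x = v 0 1 x + k * iinv x * v 0 0 x"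
definition conj_hess11 :: "real \<Rightarrow> (nat \<Rightarrow> nat \<Rightarrow> complex \<Rightarrow> real) \<Rightarrow> complex \<Rightarrow> real" where
  "conj_hess11 k v x = v 2 0 x + 2 * k * rinv x * v 1 0 x +
     (k * ((rinv x)\<^sup>2 + (iinv x)\<^sup>2) + (k\<^sup>2 - 2 * k) * (rinv x)\<^sup>2) * v 0 0 x"
definition conj_hess12 :: "real \<Rightarrow> (nat \<Rightarrow> nat \<Rightarrow> complex \<Rightarrow> real) \<Rightarrow> complex \<Rightarrow> real" where
  "conj_hess12 k v x = v 1 1 x + k * iinv x * v 1 0 x + k * rinv x * v 0 1 x +
     (k\<^sup>2 - 2 * k) * (rinv x * iinv x) * v 0 0 x"
definition conj_hess22 :: "real \<Rightarrow> (nat \<Rightarrow> nat \<Rightarrow> complex \<Rightarrow> real) \<Rightarrow> complex \<Rightarrow> real" where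
  "conj_hess22 k v x = v 0 2 x + 2 * k * iinv x * v 0 1 x +
     (k * ((rinv x)\<^sup>2 + (iinv x)\<^sup>2) + (k\<^sup>2 - 2 * k) * (iinv x)\<^sup>2) * v 0 0 x"

abbreviation conj_grad_sq :: "real \<Rightarrow> (nat \<Rightarrow> nat \<Rightarrow> complex \<Rightarrow> real) \<Rightarrow> complex \<Rightarrow> real" where
  "conj_grad_sq k v x \<equiv> (conj_grad1 k v x)\<^sup>2 + (conj_grad2 k v x)\<^sup>2"
abbreviation conj_hess_sq :: "real \<Rightarrow> (nat \<Rightarrow> nat \<Rightarrow> complex \<Rightarrow> real) \<Rightarrow> complex \<Rightarrow> real" where
  "conj_hess_sq k v x \<equiv> (conj_hess11 k v x)\<^sup>2 + 2 * (conj_hess12 k v x)\<^sup>2 + (conj_hess22 k v x)\<^sup>2"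

lemma rinv_iinv_measurable [measurable]:
  "rinv \<in> borel_measurable borel" "iinv \<in> borel_measurable borel"
  unfolding rinv_def iinv_def by measurable

lemma rinv_iinv_power2: "(rinv x)\<^sup>2 + (iinv x)\<^sup>2 = 1 / (cmod x)\<^sup>2"
proof (cases "x = 0")
  case False
  have "(rinv x)\<^sup>2 + (iinv x)\<^sup>2 = ((Re x)\<^sup>2 + (Im x)\<^sup>2) / ((cmod x)\<^sup>2)\<^sup>2"
    by (simp add: rinv_def iinv_def power_divide add_divide_distrib)
  also have "\<dots> = (cmod x)\<^sup>2 / ((cmod x)\<^sup>2)\<^sup>2" by (simp only: cmod_power2)
  also have "\<dots> = 1 / (cmod x)\<^sup>2" using False by (simp add: power2_eq_square)
  finally show ?thesis .
qed (simp add: rinv_def iinv_def)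

text \<open>The derivatives are polynomials in \<open>rinv\<close> and \<open>iinv\<close> again, so
  every later conjugation identity becomes polynomial algebra.\<close>

lemma rinv_has_derivative:
  assumes x: "x \<noteq> 0"
  shows "(rinv has_derivative (dxy ((iinv x)\<^sup>2 - (rinv x)\<^sup>2) (- 2 * rinv x * iinv x))) (at x)"
    and "(iinv has_derivative (dxy (- 2 * rinv x * iinv x) ((rinv x)\<^sup>2 - (iinv x)\<^sup>2))) (at x)"
proof -
  let ?n = "\<lambda>x::complex. (Re x)\<^sup>2 + (Im x)\<^sup>2"
  have n: "?n x \<noteq> 0" using x by (simp add: complex_neq_0 sum_power2_eq_zero_iff complex_eq_iff)
  have r: "rinv = (\<lambda>x. Re x / ?n x)" "iinv = (\<lambda>x. Im x / ?n x)"
    by (simp_all add: fun_eq_iff rinv_def iinv_def cmod_power2)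
  have dn: "(?n has_derivative (dxy (2 * Re x) (2 * Im x))) (at x)"
    by (auto intro!: derivative_eq_intros)
  have 1: "((\<lambda>x. Re x / ?n x) has_derivative (\<lambda>h. (Re h * ?n x - Re x * (2 * Re x * Re h + 2 * Im x * Im h)) / (?n x * ?n x))) (at x)"
    by (rule has_derivative_divide'[OF _ dn n]) (auto intro!: derivative_eq_intros)
  have 2: "((\<lambda>x. Im x / ?n x) has_derivative (\<lambda>h. (Im h * ?n x - Im x * (2 * Re x * Re h + 2 * Im x * Im h)) / (?n x * ?n x))) (at x)"
    by (rule has_derivative_divide'[OF _ dn n]) (auto intro!: derivative_eq_intros)
  have a: "(iinv x)\<^sup>2 - (rinv x)\<^sup>2 = ((Im x)\<^sup>2 - (Re x)\<^sup>2) / (?n x * ?n x)"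
    "rinv x * iinv x = Re x * Im x / (?n x * ?n x)"
    unfolding r by (simp_all add: power2_eq_square diff_divide_distrib)
  have l1: "u / n * p - 2 * (w / n) * q = (u * p - 2 * w * q) / n"
    and l2: "- (u / n) * p - 2 * (w / n) * q = (- u * p - 2 * w * q) / n" for u w p q n :: real
    by (simp_all add: diff_divide_distrib)
  have e1: "(Re h * ?n x - Re x * (2 * Re x * Re h + 2 * Im x * Im h)) / (?n x * ?n x) =
     ((iinv x)\<^sup>2 - (rinv x)\<^sup>2) * Re h + (- 2 * rinv x * iinv x) * Im h" for h
  proof -
    have "((iinv x)\<^sup>2 - (rinv x)\<^sup>2) * Re h + (- 2 * rinv x * iinv x) * Im h =
        ((iinv x)\<^sup>2 - (rinv x)\<^sup>2) * Re h - 2 * (rinv x * iinv x) * Im h" by simp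
    also have "\<dots> = (((Im x)\<^sup>2 - (Re x)\<^sup>2) * Re h - 2 * (Re x * Im x) * Im h) / (?n x * ?n x)"
      unfolding a by (rule l1)
    also have "((Im x)\<^sup>2 - (Re x)\<^sup>2) * Re h - 2 * (Re x * Im x) * Im h = Re h * ?n x - Re x * (2 * Re x * Re h + 2 * Im x * Im h)"
      by (simp add: power2_eq_square algebra_simps)
    finally show ?thesis by simp
  qed
  have e2: "(Im h * ?n x - Im x * (2 * Re x * Re h + 2 * Im x * Im h)) / (?n x * ?n x) =
     (- 2 * rinv x * iinv x) * Re h + ((rinv x)\<^sup>2 - (iinv x)\<^sup>2) * Im h" for h
  proof -
    have "(- 2 * rinv x * iinv x) * Re h + ((rinv x)\<^sup>2 - (iinv x)\<^sup>2) * Im h =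
        - ((iinv x)\<^sup>2 - (rinv x)\<^sup>2) * Im h - 2 * (rinv x * iinv x) * Re h" by (simp add: algebra_simps)
    also have "\<dots> = (- ((Im x)\<^sup>2 - (Re x)\<^sup>2) * Im h - 2 * (Re x * Im x) * Re h) / (?n x * ?n x)"
      unfolding a by (rule l2)
    also have "- ((Im x)\<^sup>2 - (Re x)\<^sup>2) * Im h - 2 * (Re x * Im x) * Re h = Im h * ?n x - Im x * (2 * Re x * Re h + 2 * Im x * Im h)"
      by (simp add: power2_eq_square algebra_simps)
    finally show ?thesis by simp
  qed
  show "(rinv has_derivative (dxy ((iinv x)\<^sup>2 - (rinv x)\<^sup>2) (- 2 * rinv x * iinv x))) (at x)"
    using 1 unfolding e1 r(1)[symmetric] .
  show "(iinv has_derivative (dxy (- 2 * rinv x * iinv x) ((rinv x)\<^sup>2 - (iinv x)\<^sup>2))) (at x)"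
    using 2 unfolding e2 r(2)[symmetric] .
qed

text \<open>The logarithmic gradient of r^k is k x/|x|^2; all first-order terms created by the
  conjugation come from it.\<close>

lemma norm_powr_has_derivative:
  assumes x: "x \<noteq> 0"
  shows "((\<lambda>x::complex. norm x powr k) has_derivative (\<lambda>h. norm x powr k * k * (rinv x * Re h + iinv x * Im h))) (at x)"
proof -
  have n: "(norm has_derivative (\<lambda>h. (Re x * Re h + Im x * Im h) / norm x)) (at x)"
    using has_derivative_norm[OF x] by (simp add: sgn_div_norm inner_complex_def field_simps add_divide_distrib)
  have p: "((\<lambda>t. t powr k) has_real_derivative (k * norm x powr (k - 1))) (at (norm x))"
    using x by (intro has_real_derivative_powr) auto
  have "((\<lambda>x::complex. norm x powr k) has_derivative (\<lambda>h. ((Re x * Re h + Im x * Im h) / norm x) * (k * norm x powr (k - 1)))) (at x)"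
    by (rule DERIV_compose_FDERIV[OF p n])
  moreover have "((Re x * Re h + Im x * Im h) / norm x) * (k * norm x powr (k - 1)) = norm x powr k * k * (rinv x * Re h + iinv x * Im h)" for h
    using x by (simp add: powr_diff rinv_def iinv_def power2_eq_square field_simps)
  ultimately show ?thesis by simp
qed

lemma conj_derivatives:
  fixes g :: "nat \<Rightarrow> nat \<Rightarrow> complex \<Rightarrow> real"
    and k :: real
  assumes g: "\<And>i j x. (g i j has_derivative (dxy (g (Suc i) j x) (g i (Suc j) x))) (at x)"
    and x: "x \<noteq> 0"
  defines "N \<equiv> \<lambda>x::complex. norm x powr k"
  shows "((\<lambda>x. N x * g 0 0 x) has_derivative (dxy (N x * conj_grad1 k g x) (N x * conj_grad2 k g x))) (at x)"
    and "((\<lambda>x. N x * conj_grad1 k g x) has_derivative (dxy (N x * conj_hess11 k g x) (N x * conj_hess12 k g x))) (at x)"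
    and "((\<lambda>x. N x * conj_grad2 k g x) has_derivative (dxy (N x * conj_hess12 k g x) (N x * conj_hess22 k g x))) (at x)"
proof -
  have N: "(N has_derivative (\<lambda>h. N x * k * (rinv x * Re h + iinv x * Im h))) (at x)"
    unfolding N_def by (rule norm_powr_has_derivative[OF x])
  note R = rinv_has_derivative(1)[OF x] and I = rinv_has_derivative(2)[OF x]
  have num: "Suc (Suc 0) = 2" "Suc 0 = 1" by simp_all
  note g00 = g[of 0 0 x, unfolded num] and g10 = g[of 1 0 x, unfolded num] and g01 = g[of 0 1 x, unfolded num]
  show "((\<lambda>x. N x * g 0 0 x) has_derivative (dxy (N x * conj_grad1 k g x) (N x * conj_grad2 k g x))) (at x)"
    by (rule has_derivative_eq_rhs[OF has_derivative_mult[OF N g00]])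
       (simp add: conj_grad1_def conj_grad2_def fun_eq_iff algebra_simps)
  have s: "Suc 1 = 2" by simp
  have G1: "(conj_grad1 k g has_derivative (\<lambda>h. (g 2 0 x * Re h + g 1 1 x * Im h) +
      (k * rinv x * (g 1 0 x * Re h + g 0 1 x * Im h) + k * (((iinv x)\<^sup>2 - (rinv x)\<^sup>2) * Re h + (- 2 * rinv x * iinv x) * Im h) * g 0 0 x))) (at x)"
    unfolding conj_grad1_def using g10 unfolding s
    by (intro has_derivative_add has_derivative_mult has_derivative_mult_right R g00)
  show "((\<lambda>x. N x * conj_grad1 k g x) has_derivative (dxy (N x * conj_hess11 k g x) (N x * conj_hess12 k g x))) (at x)"
    by (rule has_derivative_eq_rhs[OF has_derivative_mult[OF N G1]])
       (simp add: conj_grad1_def conj_hess11_def conj_hess12_def fun_eq_iff power2_eq_square algebra_simps)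
  have G2: "(conj_grad2 k g has_derivative (\<lambda>h. (g 1 1 x * Re h + g 0 2 x * Im h) +
      (k * iinv x * (g 1 0 x * Re h + g 0 1 x * Im h) + k * ((- 2 * rinv x * iinv x) * Re h + ((rinv x)\<^sup>2 - (iinv x)\<^sup>2) * Im h) * g 0 0 x))) (at x)"
    unfolding conj_grad2_def using g01 unfolding s
    by (intro has_derivative_add has_derivative_mult has_derivative_mult_right I g00)
  show "((\<lambda>x. N x * conj_grad2 k g x) has_derivative (dxy (N x * conj_hess12 k g x) (N x * conj_hess22 k g x))) (at x)"
    by (rule has_derivative_eq_rhs[OF has_derivative_mult[OF N G2]])
       (simp add: conj_grad2_def conj_hess12_def conj_hess22_def fun_eq_iff power2_eq_square algebra_simps)
qed

lemma conj_measurable [measurable]: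
  assumes "\<And>i j. i + j \<le> 2 \<Longrightarrow> v i j \<in> borel_measurable borel"
  shows "conj_grad1 k v \<in> borel_measurable borel" "conj_grad2 k v \<in> borel_measurable borel"
    "conj_hess11 k v \<in> borel_measurable borel" "conj_hess12 k v \<in> borel_measurable borel"
    "conj_hess22 k v \<in> borel_measurable borel"
proof -
  have [measurable]: "v 0 0 \<in> borel_measurable borel" "v 1 0 \<in> borel_measurable borel" "v 0 1 \<in> borel_measurable borel"
    "v 2 0 \<in> borel_measurable borel" "v 1 1 \<in> borel_measurable borel" "v 0 2 \<in> borel_measurable borel"
    by (rule assms, simp)+
  show "conj_grad1 k v \<in> borel_measurable borel" "conj_grad2 k v \<in> borel_measurable borel"
    "conj_hess11 k v \<in> borel_measurable borel" "conj_hess12 k v \<in> borel_measurable borel"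
    "conj_hess22 k v \<in> borel_measurable borel"
    unfolding conj_grad1_def conj_grad2_def conj_hess11_def conj_hess12_def conj_hess22_def
    by measurable
qed

lemma smooth_conj_estimate:
  fixes g :: "nat \<Rightarrow> nat \<Rightarrow> complex \<Rightarrow> real"
  assumes ab: "0 < a" "0 < b" "a \<le> A" "A \<le> 2 * a" "3 * A < B" "B \<le> b"
    and \<gamma>: "0 \<le> \<gamma>" "\<gamma> \<le> 1" and \<beta>: "0 \<le> \<beta>" and k: "2 \<le> k"
    and g: "\<And>i j x. (g i j has_derivative (dxy (g (Suc i) j x) (g i (Suc j) x))) (at x)"
  shows "(set_int (annulus A B) (\<lambda>x. conj_grad_sq k g x * radial_weight (- 2) (2 * \<gamma>) a b x)) \<le>
      ennreal (neck_const k \<beta> \<gamma>) *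
      ((set_int (annulus A B) (\<lambda>x. (g 0 0 x)\<^sup>2 * radial_weight (- 4) (4 * \<beta>) a b x))
      + (set_int (annulus A B) (\<lambda>x. conj_hess_sq k g x * radial_weight 0 (2 * \<gamma>) a b x)))"
proof -
  let ?N = "\<lambda>x::complex. norm x powr k"
  have gc: "continuous_on S (g i j)" for S i j
    by (intro continuous_at_imp_continuous_on ballI has_derivative_continuous[OF g])
  have gm: "g i j \<in> borel_measurable borel" for i j
    by (rule borel_measurable_continuous_onI[OF gc])
  note [measurable] = gm conj_measurable[of g, OF gm]
  have Nc: "continuous_on (- {0}) ?N" by (intro continuous_intros) auto
  have Rc: "continuous_on (- {0}) rinv" "continuous_on (- {0}) iinv"
    unfolding rinv_def iinv_def by (intro continuous_intros; simp)+
  have hc: "continuous_on (- {0}) (\<lambda>x. ?N x * conj_hess11 k g x)" "continuous_on (- {0}) (\<lambda>x. ?N x * conj_hess12 k g x)"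
    "continuous_on (- {0}) (\<lambda>x. ?N x * conj_hess22 k g x)"
    unfolding conj_hess11_def conj_hess12_def conj_hess22_def
    by (intro continuous_on_mult continuous_on_add continuous_on_power continuous_on_const Nc Rc gc)+
  have nz: "x \<in> annulus A B \<Longrightarrow> x \<noteq> 0" for x using ab by (auto simp: mem_annulus)
  \<comment> \<open>The factor r^(2k) from squaring the conjugated quantities cancels the shift -2k
    in the radial exponent.\<close>
  have w: "(?N x * c)\<^sup>2 * radial_weight (e - 2 * k) s a b x = c\<^sup>2 * radial_weight e s a b x" if "x \<noteq> 0" for x e s c
  proof -
    have "(?N x)\<^sup>2 * norm x powr (e - 2 * k) = norm x powr (k + k + (e - 2 * k))"
      by (simp only: powr_add power2_eq_square)
    then have "(?N x)\<^sup>2 * norm x powr (e - 2 * k) = norm x powr e" by simp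
    then show ?thesis
      unfolding radial_weight_def power_mult_distrib by (metis mult.assoc mult.commute)
  qed
  have "(set_int (annulus A B) (\<lambda>x. ((?N x * conj_grad1 k g x)\<^sup>2 + (?N x * conj_grad2 k g x)\<^sup>2) * radial_weight (- 2 - 2 * k) (2 * \<gamma>) a b x)) \<le>
      ennreal (neck_const k \<beta> \<gamma>) *
      ((set_int (annulus A B) (\<lambda>x. (?N x * g 0 0 x)\<^sup>2 * radial_weight (- 4 - 2 * k) (4 * \<beta>) a b x))
      + (set_int (annulus A B) (\<lambda>x. ((?N x * conj_hess11 k g x)\<^sup>2 + 2 * (?N x * conj_hess12 k g x)\<^sup>2 + (?N x * conj_hess22 k g x)\<^sup>2) * radial_weight (- 2 * k) (2 * \<gamma>) a b x)))"
    by (rule smooth_neck_estimate[OF ab \<gamma> \<beta> k conj_derivatives[where g = g and k = k, OF g] hc]) measurable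
  also have "(set_int (annulus A B) (\<lambda>x. ((?N x * conj_grad1 k g x)\<^sup>2 + (?N x * conj_grad2 k g x)\<^sup>2) * radial_weight (- 2 - 2 * k) (2 * \<gamma>) a b x))
     = (set_int (annulus A B) (\<lambda>x. conj_grad_sq k g x * radial_weight (- 2) (2 * \<gamma>) a b x))"
    by (intro nn_integral_cong) (use nz w in \<open>auto simp: indicator_def distrib_right\<close>)
  also have "(set_int (annulus A B) (\<lambda>x. (?N x * g 0 0 x)\<^sup>2 * radial_weight (- 4 - 2 * k) (4 * \<beta>) a b x))
    = (set_int (annulus A B) (\<lambda>x. (g 0 0 x)\<^sup>2 * radial_weight (- 4) (4 * \<beta>) a b x))"
    by (intro nn_integral_cong) (use nz w in \<open>auto simp: indicator_def\<close>)
  also have "(set_int (annulus A B) (\<lambda>x. ((?N x * conj_hess11 k g x)\<^sup>2 + 2 * (?N x * conj_hess12 k g x)\<^sup>2 + (?N x * conj_hess22 k g x)\<^sup>2) * radial_weight (- 2 * k) (2 * \<gamma>) a b x))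
    = (set_int (annulus A B) (\<lambda>x. conj_hess_sq k g x * radial_weight 0 (2 * \<gamma>) a b x))"
  proof (intro nn_integral_cong)
    fix x
    have "((?N x * conj_hess11 k g x)\<^sup>2 + 2 * (?N x * conj_hess12 k g x)\<^sup>2 + (?N x * conj_hess22 k g x)\<^sup>2) * radial_weight (- 2 * k) (2 * \<gamma>) a b x
      = conj_hess_sq k g x * radial_weight 0 (2 * \<gamma>) a b x" if "x \<noteq> 0"
      using w[OF that, where e = 0 and s = "2 * \<gamma>"] by (simp add: distrib_right mult.assoc)
    then show "ennreal (((?N x * conj_hess11 k g x)\<^sup>2 + 2 * (?N x * conj_hess12 k g x)\<^sup>2 + (?N x * conj_hess22 k g x)\<^sup>2) * radial_weight (- 2 * k) (2 * \<gamma>) a b x) * indicator (annulus A B) x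
      = ennreal (conj_hess_sq k g x * radial_weight 0 (2 * \<gamma>) a b x) * indicator (annulus A B) x"
      using nz[of x] by (cases "x \<in> annulus A B") auto
  qed
  finally show ?thesis .
qed

section \<open>Passage to weakly differentiable functions\<close>

lemma square_sum4_bound:
  fixes C :: real
  assumes "\<bar>c1\<bar> \<le> C" "\<bar>c2\<bar> \<le> C" "\<bar>c3\<bar> \<le> C" "\<bar>c4\<bar> \<le> C"
  shows "(c1 * d1 + c2 * d2 + c3 * d3 + c4 * d4)\<^sup>2 \<le> 4 * C\<^sup>2 * (d1\<^sup>2 + d2\<^sup>2 + d3\<^sup>2 + d4\<^sup>2)"
proof -
  have *: "(p + q + r + s)\<^sup>2 \<le> 4 * (p\<^sup>2 + q\<^sup>2 + r\<^sup>2 + s\<^sup>2)" for p q r s :: real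
    using zero_le_power2[of "p - q"] zero_le_power2[of "p - r"] zero_le_power2[of "p - s"]
      zero_le_power2[of "q - r"] zero_le_power2[of "q - s"] zero_le_power2[of "r - s"]
    by (simp add: power2_eq_square algebra_simps)
  have b: "(c * d)\<^sup>2 \<le> C\<^sup>2 * d\<^sup>2" if "\<bar>c\<bar> \<le> C" for c d :: real
    unfolding power_mult_distrib using that power_mono[OF that abs_ge_zero, of 2] by (intro mult_right_mono) auto
  show ?thesis
    using *[of "c1 * d1" "c2 * d2" "c3 * d3" "c4 * d4"] b[OF assms(1), of d1] b[OF assms(2), of d2]
      b[OF assms(3), of d3] b[OF assms(4), of d4]
    by (simp add: algebra_simps)
qed

definition jet_square :: "(nat \<Rightarrow> nat \<Rightarrow> complex \<Rightarrow> real) \<Rightarrow> complex \<Rightarrow> real" where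
  "jet_square d x = (d 0 0 x)\<^sup>2 + (d 1 0 x)\<^sup>2 + (d 0 1 x)\<^sup>2 + (d 2 0 x)\<^sup>2 + (d 1 1 x)\<^sup>2 + (d 0 2 x)\<^sup>2"

text \<open>A common bound on norm x >= A for all coefficients of the conjugated gradient and
  Hessian, from |\<open>rinv x\<close>|, |\<open>iinv x\<close>| <= 1/A. It may depend on A because
  it multiplies only errors that tend to 0.\<close>

definition coeff_bound :: "real \<Rightarrow> real \<Rightarrow> real" where
  "coeff_bound k A = 1 + 2 * k * (1 / A) + (2 * k + \<bar>k\<^sup>2 - 2 * k\<bar>) * (1 / A)\<^sup>2"

lemma jet_square_nonneg: "jet_square d x \<ge> 0"
  by (simp add: jet_square_def)

lemma conj_bounds:
  assumes x: "A \<le> norm x" and A: "A > 0" and k: "k \<ge> 0"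
  shows "(conj_grad1 k d x)\<^sup>2 \<le> 4 * (coeff_bound k A)\<^sup>2 * jet_square d x"
    "(conj_grad2 k d x)\<^sup>2 \<le> 4 * (coeff_bound k A)\<^sup>2 * jet_square d x"
    "(conj_hess11 k d x)\<^sup>2 \<le> 4 * (coeff_bound k A)\<^sup>2 * jet_square d x"
    "(conj_hess12 k d x)\<^sup>2 \<le> 4 * (coeff_bound k A)\<^sup>2 * jet_square d x"
    "(conj_hess22 k d x)\<^sup>2 \<le> 4 * (coeff_bound k A)\<^sup>2 * jet_square d x"
proof -
  define c where "c = 1 / A"
  let ?C = "coeff_bound k A"
  have c0: "c \<ge> 0" using A by (simp add: c_def)
  have n: "1 / norm x \<le> c" using x A by (simp add: c_def frac_le)
  have nx: "norm x > 0" using x A by linarith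
  have b: "\<bar>rinv x\<bar> \<le> c" "\<bar>iinv x\<bar> \<le> c"
  proof -
    have *: "\<bar>t / (norm x)\<^sup>2\<bar> \<le> c" if "\<bar>t\<bar> \<le> norm x" for t
    proof -
      have "\<bar>t / (norm x)\<^sup>2\<bar> \<le> norm x / (norm x)\<^sup>2"
        using that by (simp add: divide_right_mono)
      also have "\<dots> = 1 / norm x" using nx by (simp add: power2_eq_square)
      finally show ?thesis using n by linarith
    qed
    show "\<bar>rinv x\<bar> \<le> c" "\<bar>iinv x\<bar> \<le> c"
      unfolding rinv_def iinv_def by (rule *, simp add: abs_Re_le_cmod abs_Im_le_cmod)+
  qed
  have b2: "\<bar>s * t\<bar> \<le> c\<^sup>2" if "\<bar>s\<bar> \<le> c" "\<bar>t\<bar> \<le> c" for s t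
    unfolding abs_mult power2_eq_square using that c0 by (intro mult_mono) auto
  define l where "l = \<bar>k\<^sup>2 - 2 * k\<bar>"
  have C: "?C = 1 + 2 * (k * c) + 2 * (k * c\<^sup>2) + l * c\<^sup>2"
    by (simp add: coeff_bound_def c_def l_def algebra_simps)
  have nn: "k * c \<ge> 0" "k * c\<^sup>2 \<ge> 0" "l * c\<^sup>2 \<ge> 0" using k c0 by (simp_all add: l_def)
  have one: "\<bar>1\<bar> \<le> ?C" "\<bar>0\<bar> \<le> ?C" unfolding C using nn by linarith+
  have lin: "\<bar>k * t\<bar> \<le> ?C" "\<bar>2 * k * t\<bar> \<le> ?C" if "\<bar>t\<bar> \<le> c" for t
  proof -
    have "\<bar>k * t\<bar> \<le> k * c" using that k by (simp add: abs_mult mult_left_mono)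
    then show "\<bar>k * t\<bar> \<le> ?C" "\<bar>2 * k * t\<bar> \<le> ?C" unfolding C using nn by linarith+
  qed
  have quad: "\<bar>(k\<^sup>2 - 2 * k) * (s * t)\<bar> \<le> l * c\<^sup>2" if "\<bar>s\<bar> \<le> c" "\<bar>t\<bar> \<le> c" for s t
    unfolding abs_mult[of "k\<^sup>2 - 2 * k"] l_def[symmetric] using b2[OF that] by (intro mult_left_mono) (auto simp: l_def)
  have sq: "\<bar>k * ((rinv x)\<^sup>2 + (iinv x)\<^sup>2) + (k\<^sup>2 - 2 * k) * t\<^sup>2\<bar> \<le> ?C" if "\<bar>t\<bar> \<le> c" for t
  proof -
    have "\<bar>k * ((rinv x)\<^sup>2 + (iinv x)\<^sup>2)\<bar> \<le> k * (c\<^sup>2 + c\<^sup>2)"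
      unfolding abs_mult using b2[OF b(1) b(1)] b2[OF b(2) b(2)] k
      by (intro mult_mono) (auto simp: power2_eq_square)
    then show ?thesis
      using quad[OF that that] unfolding C using nn by (simp add: power2_eq_square[of t] algebra_simps)
  qed
  have x12: "\<bar>(k\<^sup>2 - 2 * k) * (rinv x * iinv x)\<bar> \<le> ?C"
    using quad[OF b] unfolding C using nn by linarith
  have fin: "4 * ?C\<^sup>2 * S \<le> 4 * ?C\<^sup>2 * jet_square d x" if "S \<le> jet_square d x" for S
    using that by (intro mult_left_mono) auto
  note S = square_sum4_bound[of _ ?C]
  show "(conj_grad1 k d x)\<^sup>2 \<le> 4 * ?C\<^sup>2 * jet_square d x"
  proof -
    have "(conj_grad1 k d x)\<^sup>2 \<le> 4 * ?C\<^sup>2 * ((d 1 0 x)\<^sup>2 + (d 0 0 x)\<^sup>2 + 0 + 0)"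
      using S[OF one(1) lin(1)[OF b(1)] one(2) one(2), of "d 1 0 x" "d 0 0 x" 0 0] by (simp add: conj_grad1_def)
    also have "\<dots> \<le> 4 * ?C\<^sup>2 * jet_square d x" by (rule fin) (simp add: jet_square_def)
    finally show ?thesis .
  qed
  show "(conj_grad2 k d x)\<^sup>2 \<le> 4 * ?C\<^sup>2 * jet_square d x"
  proof -
    have "(conj_grad2 k d x)\<^sup>2 \<le> 4 * ?C\<^sup>2 * ((d 0 1 x)\<^sup>2 + (d 0 0 x)\<^sup>2 + 0 + 0)"
      using S[OF one(1) lin(1)[OF b(2)] one(2) one(2), of "d 0 1 x" "d 0 0 x" 0 0] by (simp add: conj_grad2_def)
    also have "\<dots> \<le> 4 * ?C\<^sup>2 * jet_square d x" by (rule fin) (simp add: jet_square_def)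
    finally show ?thesis .
  qed
  show "(conj_hess11 k d x)\<^sup>2 \<le> 4 * ?C\<^sup>2 * jet_square d x"
  proof -
    have "(conj_hess11 k d x)\<^sup>2 \<le> 4 * ?C\<^sup>2 * ((d 2 0 x)\<^sup>2 + (d 1 0 x)\<^sup>2 + (d 0 0 x)\<^sup>2 + 0)"
      using S[OF one(1) lin(2)[OF b(1)] sq[OF b(1)] one(2), of "d 2 0 x" "d 1 0 x" "d 0 0 x" 0] by (simp add: conj_hess11_def)
    also have "\<dots> \<le> 4 * ?C\<^sup>2 * jet_square d x" by (rule fin) (simp add: jet_square_def)
    finally show ?thesis .
  qed
  show "(conj_hess12 k d x)\<^sup>2 \<le> 4 * ?C\<^sup>2 * jet_square d x"
  proof -
    have "(conj_hess12 k d x)\<^sup>2 \<le> 4 * ?C\<^sup>2 * ((d 1 1 x)\<^sup>2 + (d 1 0 x)\<^sup>2 + (d 0 1 x)\<^sup>2 + (d 0 0 x)\<^sup>2)"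
      using S[OF one(1) lin(1)[OF b(2)] lin(1)[OF b(1)] x12, of "d 1 1 x" "d 1 0 x" "d 0 1 x" "d 0 0 x"] by (simp add: conj_hess12_def)
    also have "\<dots> \<le> 4 * ?C\<^sup>2 * jet_square d x" by (rule fin) (simp add: jet_square_def)
    finally show ?thesis .
  qed
  show "(conj_hess22 k d x)\<^sup>2 \<le> 4 * ?C\<^sup>2 * jet_square d x"
  proof -
    have "(conj_hess22 k d x)\<^sup>2 \<le> 4 * ?C\<^sup>2 * ((d 0 2 x)\<^sup>2 + (d 0 1 x)\<^sup>2 + (d 0 0 x)\<^sup>2 + 0)"
      using S[OF one(1) lin(2)[OF b(2)] sq[OF b(2)] one(2), of "d 0 2 x" "d 0 1 x" "d 0 0 x" 0] by (simp add: conj_hess22_def)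
    also have "\<dots> \<le> 4 * ?C\<^sup>2 * jet_square d x" by (rule fin) (simp add: jet_square_def)
    finally show ?thesis .
  qed
qed

lemma radial_weight_le:
  assumes "0 < a" "a \<le> A" "A \<le> norm x" "norm x \<le> b" "e \<le> 0" "0 \<le> s"
  shows "radial_weight e s a b x \<le> 2 * A powr e"
proof -
  have "norm x powr e \<le> A powr e" using assms by (intro powr_mono2') auto
  moreover have "neck_weight s a b x \<le> 2" using assms by (intro neck_weight_le_2) auto
  ultimately have "radial_weight e s a b x \<le> A powr e * 2" unfolding radial_weight_def by (intro mult_mono) auto
  then show ?thesis by simp
qed

lemma nn_integral_linear_bound:
  fixes F G E :: "complex \<Rightarrow> real"
  assumes le: "\<And>x. x \<in> S \<Longrightarrow> F x \<le> 2 * G x + M * E x"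
    and nn: "\<And>x. G x \<ge> 0" "\<And>x. E x \<ge> 0" "M \<ge> 0"
    and [measurable]: "G \<in> borel_measurable borel" "E \<in> borel_measurable borel" "S \<in> sets borel"
  shows "(set_int S F) \<le>
    2 * (set_int S G) + ennreal M * (set_int S E)"
proof -
  have "(set_int S F) \<le>
     (\<integral>\<^sup>+x. 2 * (ennreal (G x) * indicator S x) + ennreal M * (ennreal (E x) * indicator S x) \<partial>lborel)"
  proof (rule nn_integral_mono)
    fix x
    show "ennreal (F x) * indicator S x \<le> 2 * (ennreal (G x) * indicator S x) + ennreal M * (ennreal (E x) * indicator S x)"
    proof (cases "x \<in> S")
      case True
      have "ennreal (F x) \<le> ennreal (2 * G x + M * E x)" by (rule ennreal_leI[OF le[OF True]])
      also have "\<dots> = 2 * ennreal (G x) + ennreal M * ennreal (E x)"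
        using nn by (simp add: ennreal_mult)
      finally show ?thesis using True by simp
    qed simp
  qed
  also have "\<dots> = 2 * (set_int S G) + ennreal M * (set_int S E)"
    by (subst nn_integral_add) (auto simp: nn_integral_cmult)
  finally show ?thesis .
qed

lemma nn_integral_jet_square:
  assumes m: "\<And>i j. i + j \<le> 2 \<Longrightarrow> d i j \<in> borel_measurable borel" and S[measurable]: "S \<in> sets borel"
    and le: "\<And>i j. i + j \<le> 2 \<Longrightarrow> (set_int S (\<lambda>x. (d i j x)\<^sup>2)) \<le> c"
  shows "(set_int S (\<lambda>x. jet_square d x)) \<le> 6 * c"
proof -
  have [measurable]: "d 0 0 \<in> borel_measurable borel" "d 1 0 \<in> borel_measurable borel" "d 0 1 \<in> borel_measurable borel"
    "d 2 0 \<in> borel_measurable borel" "d 1 1 \<in> borel_measurable borel" "d 0 2 \<in> borel_measurable borel"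
    by (rule m, simp)+
  let ?t = "\<lambda>i j x. ennreal ((d i j x)\<^sup>2) * indicator S x"
  have "(set_int S (\<lambda>x. jet_square d x)) =
     (\<integral>\<^sup>+x. ?t 0 0 x + (?t 1 0 x + (?t 0 1 x + (?t 2 0 x + (?t 1 1 x + ?t 0 2 x)))) \<partial>lborel)"
    by (intro nn_integral_cong) (simp add: jet_square_def distrib_right add.assoc)
  also have "\<dots> = (\<integral>\<^sup>+x. ?t 0 0 x \<partial>lborel) + ((\<integral>\<^sup>+x. ?t 1 0 x \<partial>lborel) + ((\<integral>\<^sup>+x. ?t 0 1 x \<partial>lborel) +
      ((\<integral>\<^sup>+x. ?t 2 0 x \<partial>lborel) + ((\<integral>\<^sup>+x. ?t 1 1 x \<partial>lborel) + (\<integral>\<^sup>+x. ?t 0 2 x \<partial>lborel)))))"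
    by (simp add: nn_integral_add del: One_nat_def)
  also have "\<dots> \<le> c + (c + (c + (c + (c + c))))"
    by (intro add_mono le) auto
  also have "\<dots> = 6 * c"
    using distrib_right[of 1 5 c] distrib_right[of 1 4 c] distrib_right[of 1 3 c] distrib_right[of 1 2 c]
    by (simp add: mult_2)
  finally show ?thesis .
qed

lemma conj_diff:
  "conj_grad1 k v x = conj_grad1 k g x - conj_grad1 k (\<lambda>i j x. g i j x - v i j x) x"
  "conj_grad2 k v x = conj_grad2 k g x - conj_grad2 k (\<lambda>i j x. g i j x - v i j x) x"
  "conj_hess11 k g x = conj_hess11 k v x + conj_hess11 k (\<lambda>i j x. g i j x - v i j x) x"
  "conj_hess12 k g x = conj_hess12 k v x + conj_hess12 k (\<lambda>i j x. g i j x - v i j x) x"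
  "conj_hess22 k g x = conj_hess22 k v x + conj_hess22 k (\<lambda>i j x. g i j x - v i j x) x"
  unfolding conj_grad1_def conj_grad2_def conj_hess11_def conj_hess12_def conj_hess22_def
  by (simp_all add: algebra_simps)

lemma square_add_le: "((p::real) + q)\<^sup>2 \<le> 2 * p\<^sup>2 + 2 * q\<^sup>2" "(p - q)\<^sup>2 \<le> 2 * p\<^sup>2 + 2 * q\<^sup>2"
  using zero_le_power2[of "p - q"] zero_le_power2[of "p + q"] by (simp_all add: power2_eq_square algebra_simps)

lemma double_sum2_le:
  fixes p p1 p2 q q1 q2 :: real
  assumes "p \<le> 2 * p1 + 2 * p2" "q \<le> 2 * q1 + 2 * q2"
  shows "p + q \<le> 2 * (p1 + q1) + 2 * (p2 + q2)"
  using assms unfolding distrib_left by linarith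

lemma double_sum3_le:
  fixes p p1 p2 q q1 q2 r r1 r2 :: real
  assumes "p \<le> 2 * p1 + 2 * p2" "q \<le> 2 * q1 + 2 * q2" "r \<le> 2 * r1 + 2 * r2"
  shows "p + 2 * q + r \<le> 2 * (p1 + 2 * q1 + r1) + 2 * (p2 + 2 * q2 + r2)"
  using assms unfolding distrib_left by linarith

text \<open>The strict inequalities a < A and B < b leave room for mollification. Passing from V to
  g on the left and back on the right costs a factor 2 each time, hence the 4; everything else is an
  error made smaller than \<epsilon>.\<close>

lemma weak_conj_estimate:
  fixes V :: "nat \<Rightarrow> nat \<Rightarrow> complex \<Rightarrow> real"
  assumes ab: "0 < a" "a < A" "A \<le> 2 * a" "3 * A < B" "B < b"
    and \<gamma>: "0 \<le> \<gamma>" "\<gamma> \<le> 1" and \<beta>: "0 \<le> \<beta>" and k: "2 \<le> k"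
    and int: "\<And>i j. i + j \<le> 2 \<Longrightarrow> integrable lborel (V i j)"
    and L2: "\<And>i j. i + j \<le> 2 \<Longrightarrow> Lp_int 2 (V i j) < \<infinity>"
    and link: "\<And>i j x e. i + j \<le> 2 \<Longrightarrow> e > 0 \<Longrightarrow> cball x (2 * e) \<subseteq> annulus a b \<Longrightarrow>
      (1 / e) ^ (i + j) * convol (bump e i j) (V 0 0) x = convol (bump e 0 0) (V i j) x"
  shows "(set_int (annulus A B) (\<lambda>x. conj_grad_sq k V x * radial_weight (- 2) (2 * \<gamma>) a b x)) \<le>
      ennreal (4 * neck_const k \<beta> \<gamma>) *
      ((set_int (annulus A B) (\<lambda>x. (V 0 0 x)\<^sup>2 * radial_weight (- 4) (4 * \<beta>) a b x))
      + (set_int (annulus A B) (\<lambda>x. conj_hess_sq k V x * radial_weight 0 (2 * \<gamma>) a b x)))"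
    (is "?L V \<le> ennreal (4 * ?K) * (?X V + ?Y V)")
proof (rule ennreal_le_epsilon)
  fix \<epsilon> :: real assume \<epsilon>: "\<epsilon> > 0"
  let ?S = "annulus A B"
  have A: "A > 0" using ab by linarith
  have K: "?K \<ge> 0" by (simp add: neck_const_def)
  define C where "C = coeff_bound k A"
  \<comment> \<open>Dominates the three error coefficients: gradient 16 C^2 times weight 2 A^(-2),
    zeroth order 2 times 2 A^(-4), and Hessian 32 C^2 times 2.\<close>
  define M where "M = 64 * C\<^sup>2 * (1 + A powr (- 2)) + 4 * A powr (- 4)"
  have M0: "M \<ge> 0" by (simp add: M_def)
  have Mge: "32 * C\<^sup>2 * A powr (- 2) \<le> M" "4 * A powr (- 4) \<le> M" "64 * C\<^sup>2 \<le> M"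
  proof -
    have "C\<^sup>2 \<ge> 0" "C\<^sup>2 * A powr (- 2) \<ge> 0" "A powr (- 4) \<ge> 0" by simp_all
    then show "32 * C\<^sup>2 * A powr (- 2) \<le> M" "4 * A powr (- 4) \<le> M" "64 * C\<^sup>2 \<le> M"
      unfolding M_def distrib_left by (simp_all only: mult.assoc; linarith)+
  qed
  \<comment> \<open>Six derivatives with error \<eta> contribute 6 M \<eta>, once on the left and 4K
    times through the right, in total (24K + 6) M \<eta>. The added 1 keeps the denominator
    positive.\<close>
  define \<eta> where "\<eta> = \<epsilon> / ((24 * ?K + 6) * M + 1)"
  have den: "(24 * ?K + 6) * M + 1 > 0" using K M0 by (intro add_nonneg_pos) auto
  have \<eta>: "\<eta> > 0" using \<epsilon> den by (simp add: \<eta>_def)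
  have \<eta>le: "(24 * ?K + 6) * M * \<eta> \<le> \<epsilon>"
    using \<epsilon> den K M0 by (simp add: \<eta>_def divide_simps mult_left_mono)
  have sub: "cball x (min (A - a) (b - B)) \<subseteq> annulus a b" if "x \<in> ?S" for x
  proof
    fix y assume "y \<in> cball x (min (A - a) (b - B))"
    then have "norm (x - y) \<le> A - a" "norm (x - y) \<le> b - B" by (auto simp: dist_norm)
    moreover have "norm x - norm y \<le> norm (x - y)" "norm y - norm x \<le> norm (x - y)"
      using norm_triangle_ineq2[of x y] norm_triangle_ineq2[of y x] by (simp_all add: norm_minus_commute)
    ultimately show "y \<in> annulus a b" using that by (simp add: mem_annulus)
  qed
  obtain g where g: "\<And>i j x. (g i j has_derivative (dxy (g (Suc i) j x) (g i (Suc j) x))) (at x)"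
    and gV: "\<And>i j. i + j \<le> 2 \<Longrightarrow> (set_int ?S (\<lambda>x. (g i j x - V i j x)\<^sup>2)) \<le> ennreal \<eta>"
  proof -
    have "min (A - a) (b - B) > 0" using ab by simp
    from smooth_approximation[where S = ?S, OF int L2 link this sub \<eta>] that show ?thesis by blast
  qed
  define d where "d = (\<lambda>i j x. g i j x - V i j x)"
  have gm: "g i j \<in> borel_measurable borel" for i j
    by (rule borel_measurable_continuous_onI) (intro continuous_at_imp_continuous_on ballI has_derivative_continuous[OF g])
  have Vm: "V i j \<in> borel_measurable borel" if "i + j \<le> 2" for i j using int[OF that] by auto
  have dm: "d i j \<in> borel_measurable borel" if "i + j \<le> 2" for i j
    unfolding d_def using gm Vm[OF that] by measurable
  have [measurable]: "jet_square d \<in> borel_measurable borel"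
  proof -
    have [measurable]: "d 0 0 \<in> borel_measurable borel" "d 1 0 \<in> borel_measurable borel" "d 0 1 \<in> borel_measurable borel"
      "d 2 0 \<in> borel_measurable borel" "d 1 1 \<in> borel_measurable borel" "d 0 2 \<in> borel_measurable borel"
      by (rule dm, simp)+
    show ?thesis unfolding jet_square_def by measurable
  qed
  have V00[measurable]: "V 0 0 \<in> borel_measurable borel" by (rule Vm) simp
  note [measurable] = conj_measurable[of V, OF Vm] conj_measurable[of g, OF gm] gm
  let ?E = "set_int ?S (\<lambda>x. jet_square d x)"
  have E: "?E \<le> ennreal (6 * \<eta>)"
    using nn_integral_jet_square[where S = ?S and c = "ennreal \<eta>", OF dm] gV \<eta> by (simp add: d_def ennreal_mult)
  have cb: "(conj_grad1 k d x)\<^sup>2 \<le> 4 * C\<^sup>2 * jet_square d x" "(conj_grad2 k d x)\<^sup>2 \<le> 4 * C\<^sup>2 * jet_square d x"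
    "(conj_hess11 k d x)\<^sup>2 \<le> 4 * C\<^sup>2 * jet_square d x" "(conj_hess12 k d x)\<^sup>2 \<le> 4 * C\<^sup>2 * jet_square d x"
    "(conj_hess22 k d x)\<^sup>2 \<le> 4 * C\<^sup>2 * jet_square d x" if "x \<in> ?S" for x
    unfolding C_def using conj_bounds[of A x k d] that A k by (auto simp: mem_annulus)
  have w: "radial_weight e s a b x \<le> 2 * A powr e" if "x \<in> ?S" "e \<le> 0" "0 \<le> s" for x e s
    using that ab by (intro radial_weight_le) (auto simp: mem_annulus)
  have cd: "conj_grad1 k V x = conj_grad1 k g x - conj_grad1 k d x"
    "conj_grad2 k V x = conj_grad2 k g x - conj_grad2 k d x"
    "conj_hess11 k g x = conj_hess11 k V x + conj_hess11 k d x"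
    "conj_hess12 k g x = conj_hess12 k V x + conj_hess12 k d x"
    "conj_hess22 k g x = conj_hess22 k V x + conj_hess22 k d x" for x
    unfolding d_def by (rule conj_diff)+
  have L: "?L V \<le> 2 * ?L g + ennreal M * ?E"
  proof (rule nn_integral_linear_bound)
    fix x assume x: "x \<in> ?S"
    let ?w = "radial_weight (- 2) (2 * \<gamma>) a b x"
    have "conj_grad_sq k V x \<le>
        2 * conj_grad_sq k g x + 2 * conj_grad_sq k d x"
      unfolding cd(1,2)[of x] by (rule double_sum2_le[OF square_add_le(2) square_add_le(2)])
    also have "\<dots> \<le> 2 * conj_grad_sq k g x + 16 * C\<^sup>2 * jet_square d x"
      using cb(1,2)[OF x] unfolding distrib_left by linarith
    finally have "conj_grad_sq k V x * ?w \<le>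
        (2 * conj_grad_sq k g x + 16 * C\<^sup>2 * jet_square d x) * ?w"
      by (intro mult_right_mono radial_weight_nonneg)
    also have "\<dots> = 2 * (conj_grad_sq k g x * ?w) + 16 * C\<^sup>2 * jet_square d x * ?w"
      by (simp add: distrib_right)
    also have "16 * C\<^sup>2 * jet_square d x * ?w \<le> 16 * C\<^sup>2 * jet_square d x * (2 * A powr (- 2))"
      using w[OF x] \<gamma> jet_square_nonneg by (intro mult_left_mono) auto
    also have "\<dots> = 32 * C\<^sup>2 * A powr (- 2) * jet_square d x" by simp
    also have "\<dots> \<le> M * jet_square d x" by (intro mult_right_mono Mge jet_square_nonneg)
    finally show "conj_grad_sq k V x * ?w \<le>
      2 * (conj_grad_sq k g x * ?w) + M * jet_square d x" by simp
  qed (auto simp: radial_weight_nonneg jet_square_nonneg M0)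
  have X: "?X g \<le> 2 * ?X V + ennreal M * ?E"
  proof (rule nn_integral_linear_bound)
    fix x assume x: "x \<in> ?S"
    let ?w = "radial_weight (- 4) (4 * \<beta>) a b x"
    have "(g 0 0 x)\<^sup>2 \<le> 2 * (V 0 0 x)\<^sup>2 + 2 * (d 0 0 x)\<^sup>2"
      using square_add_le(1)[of "V 0 0 x" "d 0 0 x"] by (simp add: d_def)
    also have "\<dots> \<le> 2 * (V 0 0 x)\<^sup>2 + 2 * jet_square d x" by (simp add: jet_square_def)
    finally have "(g 0 0 x)\<^sup>2 * ?w \<le> (2 * (V 0 0 x)\<^sup>2 + 2 * jet_square d x) * ?w"
      by (intro mult_right_mono radial_weight_nonneg)
    also have "\<dots> = 2 * ((V 0 0 x)\<^sup>2 * ?w) + 2 * jet_square d x * ?w" by (simp add: distrib_right)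
    also have "2 * jet_square d x * ?w \<le> 2 * jet_square d x * (2 * A powr (- 4))"
      using w[OF x] \<beta> jet_square_nonneg by (intro mult_left_mono) auto
    also have "\<dots> = 4 * A powr (- 4) * jet_square d x" by simp
    also have "\<dots> \<le> M * jet_square d x" by (intro mult_right_mono Mge jet_square_nonneg)
    finally show "(g 0 0 x)\<^sup>2 * ?w \<le> 2 * ((V 0 0 x)\<^sup>2 * ?w) + M * jet_square d x" by simp
  qed (auto simp: radial_weight_nonneg jet_square_nonneg M0)
  have Y: "?Y g \<le> 2 * ?Y V + ennreal M * ?E"
  proof (rule nn_integral_linear_bound)
    fix x assume x: "x \<in> ?S"
    let ?w = "radial_weight 0 (2 * \<gamma>) a b x"
    let ?h = "\<lambda>v. conj_hess_sq k v x"
    have "?h g \<le> 2 * ?h V + 2 * ?h d"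
      unfolding cd(3-5)[of x] by (rule double_sum3_le[OF square_add_le(1) square_add_le(1) square_add_le(1)])
    also have "\<dots> \<le> 2 * ?h V + 32 * C\<^sup>2 * jet_square d x"
      using cb(3-5)[OF x] unfolding distrib_left by linarith
    finally have "?h g * ?w \<le> (2 * ?h V + 32 * C\<^sup>2 * jet_square d x) * ?w"
      by (intro mult_right_mono radial_weight_nonneg)
    also have "\<dots> = 2 * (?h V * ?w) + 32 * C\<^sup>2 * jet_square d x * ?w" by (simp only: distrib_right mult.assoc)
    also have "32 * C\<^sup>2 * jet_square d x * ?w \<le> 32 * C\<^sup>2 * jet_square d x * (2 * A powr 0)"
      using w[OF x, of 0 "2 * \<gamma>"] \<gamma> jet_square_nonneg by (intro mult_left_mono) auto
    also have "\<dots> = 64 * C\<^sup>2 * jet_square d x" using A by simp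
    also have "\<dots> \<le> M * jet_square d x" by (intro mult_right_mono Mge jet_square_nonneg)
    finally show "?h g * ?w \<le> 2 * (?h V * ?w) + M * jet_square d x" by simp
  qed (auto simp: radial_weight_nonneg jet_square_nonneg M0)
  have G: "?L g \<le> ennreal ?K * (?X g + ?Y g)"
    by (rule smooth_conj_estimate[where g = g, OF _ _ _ _ _ _ \<gamma> \<beta> k g]) (use ab in auto)
  let ?m = "ennreal (M * (6 * \<eta>))"
  have ME: "ennreal M * ?E \<le> ?m"
    using M0 \<eta> by (subst ennreal_mult) (auto intro!: mult_left_mono E)
  have "?L V \<le> 2 * ?L g + ?m" by (rule order_trans[OF L add_left_mono[OF ME]])
  also have "\<dots> \<le> 2 * (ennreal ?K * (?X g + ?Y g)) + ?m"
    by (intro add_right_mono mult_left_mono G) auto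
  also have "\<dots> \<le> 2 * (ennreal ?K * ((2 * ?X V + ?m) + (2 * ?Y V + ?m))) + ?m"
    by (intro add_right_mono mult_left_mono add_mono order_trans[OF X add_left_mono[OF ME]] order_trans[OF Y add_left_mono[OF ME]]) auto
  also have "\<dots> = ennreal (4 * ?K) * (?X V + ?Y V) + (ennreal (4 * ?K) * ?m + ?m)"
  proof -
    have *: "2 * (c * ((2 * x + m) + (2 * y + m))) + m = (4 * c) * (x + y) + ((4 * c) * m + m)" for c x y m :: ennreal
    proof -
      have "(2 * x + m) + (2 * y + m) = 2 * (x + y) + 2 * m"
        unfolding distrib_left mult_2[of m] by (simp only: ac_simps)
      also have "2 * (c * (2 * (x + y) + 2 * m)) = (4 * c) * (x + y) + (4 * c) * m"
        by (simp add: distrib_left mult_ac)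
      finally show ?thesis by (simp only: add.assoc)
    qed
    have "ennreal (4 * ?K) = 4 * ennreal ?K" by (subst ennreal_mult') auto
    then show ?thesis by (simp only: *)
  qed
  also have "ennreal (4 * ?K) * ?m + ?m = ennreal (4 * ?K * (M * (6 * \<eta>)) + M * (6 * \<eta>))"
  proof -
    have k4: "0 \<le> 4 * ?K" and m0: "0 \<le> M * (6 * \<eta>)" using K M0 \<eta> by auto
    show ?thesis
      by (simp only: ennreal_plus[OF mult_nonneg_nonneg[OF k4 m0] m0] ennreal_mult[OF k4 m0])
  qed
  also have "\<dots> \<le> ennreal \<epsilon>"
    using \<eta>le by (intro ennreal_leI) (simp add: algebra_simps)
  finally show "?L V \<le> ennreal (4 * ?K) * (?X V + ?Y V) + ennreal \<epsilon>" by (simp add: add_left_mono)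
qed

section \<open>Representatives and derivative arrays of Sobolev functions\<close>

lemma L2_set_integrable:
  fixes u :: "'a::euclidean_space \<Rightarrow> real"
  assumes u: "u \<in> L2_on \<Omega>" and \<Omega>: "bounded \<Omega>" "open \<Omega>"
  shows "set_integrable lebesgue \<Omega> u"
proof -
  have m: "(\<lambda>x. indicator \<Omega> x *\<^sub>R u x) \<in> borel_measurable lebesgue"
    and i: "integrable lebesgue (\<lambda>x. indicator \<Omega> x *\<^sub>R (norm (u x))\<^sup>2)"
    using u by (auto simp: L2_on_def set_borel_measurable_def set_integrable_def)
  have "integrable lebesgue (indicator \<Omega> :: 'a \<Rightarrow> real)"
    using lmeasurable_open[OF \<Omega>] by (simp add: lmeasurable_iff_integrable)
  then have i2: "integrable lebesgue (\<lambda>x. indicator \<Omega> x + indicator \<Omega> x *\<^sub>R (norm (u x))\<^sup>2)"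
    by (rule Bochner_Integration.integrable_add[OF _ i])
  show ?thesis unfolding set_integrable_def
  proof (rule Bochner_Integration.integrable_bound[OF i2 m], rule AE_I2)
    fix x
    \<comment> \<open>On a set of finite measure, square integrability implies integrability through
      this inequality.\<close>
    have "\<bar>u x\<bar> \<le> 1 + (u x)\<^sup>2"
    proof -
      have "0 \<le> (\<bar>u x\<bar> - 1)\<^sup>2" by simp
      then have "2 * \<bar>u x\<bar> \<le> 1 + (u x)\<^sup>2" by (simp add: power2_diff)
      then show ?thesis by linarith
    qed
    then show "norm (indicator \<Omega> x *\<^sub>R u x) \<le> norm (indicator \<Omega> x + indicator \<Omega> x *\<^sub>R (norm (u x))\<^sup>2)"
      by (simp add: indicator_def)
  qed
qed

lemma L2_borel_rep:
  fixes u :: "'a::euclidean_space \<Rightarrow> real"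
  assumes u: "u \<in> L2_on \<Omega>" and \<Omega>: "bounded \<Omega>" "open \<Omega>"
  shows "\<exists>f. integrable lborel f \<and> Lp_int 2 f < \<infinity> \<and> (AE x in lebesgue. indicator \<Omega> x * u x = f x)"
proof -
  obtain f where f: "integrable lborel f" and ae: "AE x in lborel. indicator \<Omega> x * u x = f x"
    "AE x in lebesgue. indicator \<Omega> x * u x = f x" by (rule borel_rep[OF L2_set_integrable[OF u \<Omega>]])
  have "Lp_int 2 f = (\<integral>\<^sup>+x. ennreal (norm (indicator \<Omega> x *\<^sub>R (norm (u x))\<^sup>2)) \<partial>lborel)"
    unfolding Lp_int_def
  proof (rule nn_integral_cong_AE)
    show "AE x in lborel. ennreal (\<bar>f x\<bar>\<^sup>2) = ennreal (norm (indicator \<Omega> x *\<^sub>R (norm (u x))\<^sup>2))"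
      using ae(1) by eventually_elim (auto simp: indicator_def)
  qed
  also have "\<dots> = (\<integral>\<^sup>+x. ennreal (norm (indicator \<Omega> x *\<^sub>R (norm (u x))\<^sup>2)) \<partial>lebesgue)"
    by (simp add: nn_integral_completion)
  also have "\<dots> < \<infinity>"
    using u by (simp add: L2_on_def set_integrable_def integrable_iff_bounded)
  finally show ?thesis using f ae(2) by blast
qed

abbreviation multi_index :: "nat \<Rightarrow> nat \<Rightarrow> complex list" where
  "multi_index i j \<equiv> replicate i 1 @ replicate j \<i>"

lemma multi_index_props:
  "set (multi_index i j) \<subseteq> Basis" "length (multi_index i j) = i + j"
  "count_list (multi_index i j) 1 = i" "count_list (multi_index i j) \<i> = j"
proof -
  have c: "count_list (replicate n y) z = (if y = z then n else 0)" for n and y z :: complex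
    by (induction n) auto
  have "(1::complex) \<noteq> \<i>" by (simp add: complex_eq_iff)
  then show "count_list (multi_index i j) 1 = i" "count_list (multi_index i j) \<i> = j"
    by (simp_all add: c)
qed (auto simp: Basis_complex_def)

lemma has_weak_partial_AE_cong:
  fixes u v w :: "'a::euclidean_space \<Rightarrow> real"
  assumes w: "has_weak_partial \<Omega> es u w" and v: "v locally_integrable_on \<Omega>"
    and ae: "AE x in lebesgue. x \<in> \<Omega> \<longrightarrow> v x = w x" and es: "set es \<subseteq> Basis"
  shows "has_weak_partial \<Omega> es u v"
proof -
  have "(LINT x:\<Omega>|lebesgue. \<phi> x *\<^sub>R v x) = (LINT x:\<Omega>|lebesgue. \<phi> x *\<^sub>R w x)" if \<phi>: "\<phi> \<in> test_functions \<Omega>" for \<phi>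
    unfolding set_lebesgue_integral_def
  proof (rule integral_cong_AE)
    have wl: "w locally_integrable_on \<Omega>" using w by (simp add: has_weak_partial_def)
    show "(\<lambda>x. indicator \<Omega> x *\<^sub>R \<phi> x *\<^sub>R v x) \<in> borel_measurable lebesgue"
      using test_function_integrable[OF v \<phi>, of "[]"] by (auto simp: set_integrable_def)
    show "(\<lambda>x. indicator \<Omega> x *\<^sub>R \<phi> x *\<^sub>R w x) \<in> borel_measurable lebesgue"
      using test_function_integrable[OF wl \<phi>, of "[]"] by (auto simp: set_integrable_def)
    show "AE x in lebesgue. indicator \<Omega> x *\<^sub>R \<phi> x *\<^sub>R v x = indicator \<Omega> x *\<^sub>R \<phi> x *\<^sub>R w x"
      using ae by eventually_elim (auto simp: indicator_def)
  qed
  then show ?thesis using w v by (simp add: has_weak_partial_def)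
qed

text \<open>Two normalisations matter: the entry of order zero is u itself and not a representative,
  and one function \<open>v 1 1\<close> serves as mixed derivative in both orders.\<close>

lemma sobolev_derivatives:
  fixes u :: "complex \<Rightarrow> real"
  assumes \<Omega>: "open \<Omega>" and u: "u \<in> sobolev_Wk2 2 \<Omega>"
  obtains v where "v 0 0 = u" "\<And>i j. i + j \<le> 2 \<Longrightarrow> v i j \<in> L2_on \<Omega>"
    "\<And>i j. i + j \<le> 2 \<Longrightarrow> has_weak_partial \<Omega> (multi_index i j) u (v i j)"
    "has_weak_partial \<Omega> [\<i>, 1] u (v 1 1)"
proof -
  have ex: "\<exists>w \<in> L2_on \<Omega>. has_weak_partial \<Omega> es u w" if "set es \<subseteq> Basis" "length es \<le> 2" for es
    using u that by (auto simp: sobolev_Wk2_def)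
  have uL: "u \<in> L2_on \<Omega>" using u by (simp add: sobolev_Wk2_def)
  \<comment> \<open>The derivative for the empty list supplies local integrability of u, so u is its
    own derivative of order zero.\<close>
  obtain w0 where "has_weak_partial \<Omega> [] u w0" using ex[of "[]"] by auto
  then have "has_weak_partial \<Omega> [] u u" by (simp add: has_weak_partial_def)
  then have "\<exists>w. (i + j \<le> 2 \<longrightarrow> w \<in> L2_on \<Omega> \<and> has_weak_partial \<Omega> (multi_index i j) u w) \<and> (i = 0 \<and> j = 0 \<longrightarrow> w = u)" for i j
    using ex[OF multi_index_props(1), of i j] uL multi_index_props(2)[of i j] by (cases "i = 0 \<and> j = 0") auto
  then obtain v where v: "\<And>i j. i + j \<le> 2 \<Longrightarrow> v i j \<in> L2_on \<Omega>"
    "\<And>i j. i + j \<le> 2 \<Longrightarrow> has_weak_partial \<Omega> (multi_index i j) u (v i j)" "v 0 0 = u"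
    by metis
  have B: "set [\<i>, 1] \<subseteq> (Basis :: complex set)" by (simp add: Basis_complex_def)
  obtain w where w: "has_weak_partial \<Omega> [\<i>, 1] u w" using ex[OF B] by auto
  have v11: "has_weak_partial \<Omega> [1, \<i>] u (v 1 1)" using v(2)[of 1 1] by simp
  have "has_weak_partial \<Omega> [\<i>, 1] u (v 1 1)"
    by (rule has_weak_partial_AE_cong[OF w _ _ B])
       (use v11 mixed_weak_partials_AE_eq[OF \<Omega> v11 w] in \<open>auto simp: has_weak_partial_def\<close>)
  with v that show ?thesis by blast
qed

section \<open>The operators in terms of the conjugated gradient and Hessian\<close>

lemma grad_identity:
  "(norm (Complex p q + (k * u) *\<^sub>R (x /\<^sub>R (norm x)\<^sup>2)))\<^sup>2 = (p + k * rinv x * u)\<^sup>2 + (q + k * iinv x * u)\<^sup>2"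
  by (simp add: cmod_power2 rinv_def iinv_def divide_inverse mult_ac)

lemma inner_identity: "(x /\<^sub>R (norm x)\<^sup>2) \<bullet> Complex p q = rinv x * p + iinv x * q"
  by (simp add: inner_complex_def rinv_def iinv_def divide_inverse mult_ac)

text \<open>The trace of the conjugated Hessian: the zeroth-order coefficients sum to (2k + k^2 -
  2k)/|x|^2 = k^2/|x|^2.\<close>

lemma laplace_identity:
  "(v 2 0 x + v 0 2 x) + 2 * k * (rinv x * v 1 0 x + iinv x * v 0 1 x) + k\<^sup>2 / (norm x)\<^sup>2 * v 0 0 x
    = conj_hess11 k v x + conj_hess22 k v x"
proof -
  have r: "k\<^sup>2 / (norm x)\<^sup>2 = k\<^sup>2 * ((rinv x)\<^sup>2 + (iinv x)\<^sup>2)" by (simp add: rinv_iinv_power2)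
  show ?thesis unfolding r conj_hess11_def conj_hess22_def by algebra
qed

text \<open>With r^k as a product of powers k/2 of z and its conjugate, one differentiation of r^k
  in z gives the factor k/(2z) and two give k(k-2)/(4z^2), the coefficients of the operator for m -
  1 = k. The right side is (h11 - h22 - 2\<i> h12)/4, the second z-derivative in terms of the
  Hessian h.\<close>

lemma dz_identity:
  assumes "x \<noteq> 0"
  shows "(of_real (v 2 0 x) - of_real (v 0 2 x) - 2 * \<i> * of_real (v 1 1 x)) / 4
      + of_real k / x * ((of_real (v 1 0 x) - \<i> * of_real (v 0 1 x)) / 2)
      + of_real (k * (k - 2)) / (4 * x\<^sup>2) * of_real (v 0 0 x)
    = Complex ((conj_hess11 k v x - conj_hess22 k v x) / 4) (- conj_hess12 k v x / 2)"
proof -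
  have i: "1 / x = Complex (rinv x) (- iinv x)"
    by (simp add: complex_eq_iff rinv_def iinv_def cmod_power2 Re_divide Im_divide)
  have "of_real k / x = of_real k * (1 / x)" by simp
  then have a: "of_real k / x = of_real k * Complex (rinv x) (- iinv x)" unfolding i .
  have "of_real (k * (k - 2)) / (4 * x\<^sup>2) = of_real (k * (k - 2)) / 4 * (1 / x)\<^sup>2"
    by (simp add: power_divide)
  then have b: "of_real (k * (k - 2)) / (4 * x\<^sup>2) = of_real (k * (k - 2)) / 4 * (Complex (rinv x) (- iinv x))\<^sup>2"
    unfolding i .
  show ?thesis
    unfolding a b conj_hess11_def conj_hess12_def conj_hess22_def
    by (simp add: complex_eq_iff power2_eq_square field_simps)
qed

text \<open>The inner \<open>weak_dz\<close> is built from arbitrary representatives and is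
  differentiated weakly once more. Its derivatives are therefore obtained from second-order
  derivatives of u by \<open>has_weak_partial_iterate\<close>.\<close>

lemma weak_operators_AE:
  fixes u :: "complex \<Rightarrow> real"
  assumes \<Omega>: "open \<Omega>" and v: "v 0 0 = u"
    "\<forall>i j. i + j \<le> 2 \<longrightarrow> has_weak_partial \<Omega> (multi_index i j) u (v i j)"
    "has_weak_partial \<Omega> [\<i>, 1] u (v 1 1)"
  shows "AE x in lebesgue. x \<in> \<Omega> \<longrightarrow> weak_grad \<Omega> u x = Complex (v 1 0 x) (v 0 1 x)"
    and "AE x in lebesgue. x \<in> \<Omega> \<longrightarrow> weak_laplacian \<Omega> u x = v 2 0 x + v 0 2 x"
    and "AE x in lebesgue. x \<in> \<Omega> \<longrightarrow> weak_dz \<Omega> (\<lambda>z. of_real (u z)) x = (of_real (v 1 0 x) - \<i> * of_real (v 0 1 x)) / 2"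
    and "AE x in lebesgue. x \<in> \<Omega> \<longrightarrow> weak_dz \<Omega> (weak_dz \<Omega> (\<lambda>z. of_real (u z))) x =
      (of_real (v 2 0 x) - of_real (v 0 2 x) - 2 * \<i> * of_real (v 1 1 x)) / 4"
proof -
  have w1: "has_weak_partial \<Omega> [1] u (v 1 0)" and w2: "has_weak_partial \<Omega> [\<i>] u (v 0 1)"
    and w11: "has_weak_partial \<Omega> [1, 1] u (v 2 0)" and w12: "has_weak_partial \<Omega> [1, \<i>] u (v 1 1)"
    and w22: "has_weak_partial \<Omega> [\<i>, \<i>] u (v 0 2)"
    using v(2)[rule_format, of 1 0] v(2)[rule_format, of 0 1] v(2)[rule_format, of 2 0]
      v(2)[rule_format, of 1 1] v(2)[rule_format, of 0 2] by (simp_all add: numeral_2_eq_2)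
  have B: "(1::complex) \<in> Basis" "\<i> \<in> Basis" and B': "(1::complex) \<noteq> \<i>"
    by (simp_all add: Basis_complex_def complex_eq_iff)
  note e = weak_partial_AE_eq[OF \<Omega>]
  have e1: "AE x in lebesgue. x \<in> \<Omega> \<longrightarrow> weak_partial \<Omega> [1] u x = v 1 0 x"
    and e2: "AE x in lebesgue. x \<in> \<Omega> \<longrightarrow> weak_partial \<Omega> [\<i>] u x = v 0 1 x"
    and e11: "AE x in lebesgue. x \<in> \<Omega> \<longrightarrow> weak_partial \<Omega> [1, 1] u x = v 2 0 x"
    and e22: "AE x in lebesgue. x \<in> \<Omega> \<longrightarrow> weak_partial \<Omega> [\<i>, \<i>] u x = v 0 2 x"
    by (rule e, use B w1 w2 w11 w22 in auto)+
  show "AE x in lebesgue. x \<in> \<Omega> \<longrightarrow> weak_grad \<Omega> u x = Complex (v 1 0 x) (v 0 1 x)"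
    using e1 e2 by eventually_elim (use B' in \<open>auto simp: weak_grad_def Basis_complex_def complex_eq_iff\<close>)
  show "AE x in lebesgue. x \<in> \<Omega> \<longrightarrow> weak_laplacian \<Omega> u x = v 2 0 x + v 0 2 x"
    using e11 e22 by eventually_elim (use B' in \<open>auto simp: weak_laplacian_def Basis_complex_def\<close>)
  let ?f = "\<lambda>z. complex_of_real (u z)"
  let ?D = "\<lambda>b. weak_partial \<Omega> [b] ?f"
  have cw: "has_weak_partial \<Omega> es ?f (\<lambda>x. complex_of_real (w x))" if "has_weak_partial \<Omega> es u w" "set es \<subseteq> Basis" for es w
    by (rule has_weak_partial_bounded_linear[OF bounded_linear_of_real that])
  have c1: "has_weak_partial \<Omega> [1] ?f (\<lambda>x. of_real (v 1 0 x))" and c2: "has_weak_partial \<Omega> [\<i>] ?f (\<lambda>x. of_real (v 0 1 x))"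
    by (rule cw, use B w1 w2 in auto)+
  have f1: "AE x in lebesgue. x \<in> \<Omega> \<longrightarrow> ?D 1 x = of_real (v 1 0 x)"
    and f2: "AE x in lebesgue. x \<in> \<Omega> \<longrightarrow> ?D \<i> x = of_real (v 0 1 x)"
    by (rule e, use B c1 c2 in auto)+
  then show "AE x in lebesgue. x \<in> \<Omega> \<longrightarrow> weak_dz \<Omega> ?f x = (of_real (v 1 0 x) - \<i> * of_real (v 0 1 x)) / 2"
    by eventually_elim (auto simp: weak_dz_def)
  \<comment> \<open>The chosen representatives are themselves weak derivatives, so they can be
    differentiated further.\<close>
  have D1: "has_weak_partial \<Omega> [1] ?f (?D 1)" and D2: "has_weak_partial \<Omega> [\<i>] ?f (?D \<i>)"
    unfolding weak_partial_def by (rule someI[where P = "has_weak_partial \<Omega> _ ?f", OF c1], rule someI[where P = "has_weak_partial \<Omega> _ ?f", OF c2])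
  have D: "has_weak_partial \<Omega> [a] (weak_dz \<Omega> ?f) (\<lambda>x. (1/2) * of_real (w1 x) + (- \<i> / 2) * of_real (w2 x))"
    if w: "has_weak_partial \<Omega> [1, a] u w1" "has_weak_partial \<Omega> [\<i>, a] u w2" and a: "a \<in> Basis" for a w1 w2
  proof -
    have s: "set [a] \<subseteq> Basis" "set [1, a] \<subseteq> Basis" "set [\<i>, a] \<subseteq> Basis" using a B by auto
    have "has_weak_partial \<Omega> [a] (?D 1) (\<lambda>x. of_real (w1 x))" "has_weak_partial \<Omega> [a] (?D \<i>) (\<lambda>x. of_real (w2 x))"
      using has_weak_partial_iterate[OF D1 cw[OF w(1) s(2)] a B(1)] has_weak_partial_iterate[OF D2 cw[OF w(2) s(3)] a B(2)] .
    then have "has_weak_partial \<Omega> [a] (\<lambda>x. (1/2) * ?D 1 x + (- \<i> / 2) * ?D \<i> x) (\<lambda>x. (1/2) * of_real (w1 x) + (- \<i> / 2) * of_real (w2 x))"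
      by (intro has_weak_partial_add[OF _ _ s(1)] has_weak_partial_bounded_linear[OF bounded_linear_mult_right _ s(1)])
    moreover have "(\<lambda>x. (1/2) * ?D 1 x + (- \<i> / 2) * ?D \<i> x) = weak_dz \<Omega> ?f"
      by (rule ext) (simp add: weak_dz_def algebra_simps)
    ultimately show ?thesis by (simp only:)
  qed
  have g1: "AE x in lebesgue. x \<in> \<Omega> \<longrightarrow> weak_partial \<Omega> [1] (weak_dz \<Omega> ?f) x = (1/2) * of_real (v 2 0 x) + (- \<i> / 2) * of_real (v 1 1 x)"
    by (rule e[OF _ D[OF w11 v(3) B(1)]]) (use B in simp)
  have g2: "AE x in lebesgue. x \<in> \<Omega> \<longrightarrow> weak_partial \<Omega> [\<i>] (weak_dz \<Omega> ?f) x = (1/2) * of_real (v 1 1 x) + (- \<i> / 2) * of_real (v 0 2 x)"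
    by (rule e[OF _ D[OF w12 w22 B(2)]]) (use B in simp)
  show "AE x in lebesgue. x \<in> \<Omega> \<longrightarrow> weak_dz \<Omega> (weak_dz \<Omega> ?f) x =
      (of_real (v 2 0 x) - of_real (v 0 2 x) - 2 * \<i> * of_real (v 1 1 x)) / 4"
    using g1 g2
  proof eventually_elim
    case (elim x)
    show ?case
    proof
      assume x: "x \<in> \<Omega>"
      show "weak_dz \<Omega> (weak_dz \<Omega> ?f) x = (of_real (v 2 0 x) - of_real (v 0 2 x) - 2 * \<i> * of_real (v 1 1 x)) / 4"
        unfolding weak_dz_def[of \<Omega> "weak_dz \<Omega> ?f"] elim(1)[rule_format, OF x] elim(2)[rule_format, OF x]
        by (simp add: complex_eq_iff)
    qed
  qed
qed

text \<open>Without finiteness the real integral would be the default 0 and the equality could fail.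
  Measurability of \<Phi> follows from completeness of Lebesgue measure.\<close>

lemma set_integral_eq_nn_integral:
  fixes F \<Phi> :: "complex \<Rightarrow> real"
  assumes F[measurable]: "F \<in> borel_measurable borel" "S \<in> sets borel" and nn: "\<And>x. F x \<ge> 0"
    and fin: "(set_int S F) < \<infinity>"
    and ae: "AE x in lebesgue. x \<in> S \<longrightarrow> \<Phi> x = F x"
  shows "ennreal (LINT x:S|lebesgue. \<Phi> x) = (set_int S F)"
    and "0 \<le> (LINT x:S|lebesgue. \<Phi> x)"
proof -
  have eq: "(set_int S F) = (\<integral>\<^sup>+x. ennreal (indicator S x * F x) \<partial>lborel)"
    by (intro nn_integral_cong) (auto simp: indicator_def)
  have i: "integrable lborel (\<lambda>x. indicator S x * F x)"
    using fin nn unfolding eq by (intro integrableI_nonneg) auto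
  have m: "(\<lambda>x. indicator S x * F x) \<in> borel_measurable lebesgue"
    by (intro measurable_completion) simp
  have ae': "AE x in lebesgue. indicator S x * F x = indicator S x *\<^sub>R \<Phi> x"
    using ae by eventually_elim (auto simp: indicator_def)
  have "(LINT x:S|lebesgue. \<Phi> x) = (\<integral>x. indicator S x * F x \<partial>lebesgue)"
    unfolding set_lebesgue_integral_def
    by (rule integral_cong_AE[OF borel_measurable_AE[OF m ae'] m]) (use ae' in \<open>auto elim: eventually_mono\<close>)
  also have "\<dots> = (\<integral>x. indicator S x * F x \<partial>lborel)"
    by (rule integral_completion) simp
  finally have L: "(LINT x:S|lebesgue. \<Phi> x) = (\<integral>x. indicator S x * F x \<partial>lborel)" .
  then show "ennreal (LINT x:S|lebesgue. \<Phi> x) = (set_int S F)"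
    unfolding eq using nn_integral_eq_integral[OF i] nn by simp
  show "0 \<le> (LINT x:S|lebesgue. \<Phi> x)"
    unfolding L by (intro integral_nonneg_AE AE_I2) (simp add: nn)
qed

text \<open>Continuity from below of the measure with density F. The condition 12a <= b keeps the
  smaller annuli admissible: with A <= 3a/2 and B >= b/2 >= 6a one has 3A <= 9a/2 < B.\<close>

lemma annulus_exhaustion:
  fixes F :: "complex \<Rightarrow> ennreal"
  assumes [measurable]: "F \<in> borel_measurable borel" and ab: "0 < a" "12 * a \<le> b"
    and le: "\<And>A B. a < A \<Longrightarrow> A \<le> 2 * a \<Longrightarrow> 3 * A < B \<Longrightarrow> B < b \<Longrightarrow>
      (\<integral>\<^sup>+x. F x * indicator (annulus A B) x \<partial>lborel) \<le> c"
  shows "(\<integral>\<^sup>+x. F x * indicator (annulus a b) x \<partial>lborel) \<le> c"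
proof -
  \<comment> \<open>Relative margins starting at 1/2 and decreasing to 0; the shift by 2 keeps them
    at most 1/2 from the first index on.\<close>
  define t where "t = (\<lambda>n::nat. 1 / (real n + 2))"
  have t: "0 < t n" "t n \<le> 1 / 2" for n by (auto simp: t_def field_simps)
  have tmono: "t n \<le> t m" if "m \<le> n" for m n using that by (simp add: t_def frac_le)
  define S where "S = (\<lambda>n. annulus (a * (1 + t n)) (b * (1 - t n)))"
  have b: "b > 0" using ab by linarith
  have inc: "incseq S"
  proof (rule incseq_SucI, rule subsetI)
    fix n x assume x: "x \<in> S n"
    have "a * (1 + t (Suc n)) \<le> a * (1 + t n)" "b * (1 - t n) \<le> b * (1 - t (Suc n))"
      using ab b tmono[of n "Suc n"] by (auto intro!: mult_left_mono)
    then show "x \<in> S (Suc n)" using x by (auto simp: S_def mem_annulus)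
  qed
  have U: "(\<Union>n. S n) = annulus a b"
  proof (rule equalityI; rule subsetI)
    fix x assume "x \<in> (\<Union>n. S n)"
    then obtain n where "a * (1 + t n) < norm x" "norm x < b * (1 - t n)" by (auto simp: S_def mem_annulus)
    moreover have "a * 1 \<le> a * (1 + t n)" "b * (1 - t n) \<le> b * 1"
      using ab b t[of n] by (intro mult_left_mono; simp)+
    ultimately show "x \<in> annulus a b" by (simp add: mem_annulus)
  next
    fix x assume x: "x \<in> annulus a b"
    have tl: "t \<longlonglongrightarrow> 0" 
      using LIMSEQ_ignore_initial_segment[OF lim_1_over_n[where 'a = real], of 2] by (simp add: t_def add.commute)
    have "(\<lambda>n. a * (1 + t n)) \<longlonglongrightarrow> a * (1 + 0)" "(\<lambda>n. b * (1 - t n)) \<longlonglongrightarrow> b * (1 - 0)"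
      by (intro tendsto_intros tl)+
    then have "eventually (\<lambda>n. a * (1 + t n) < norm x) sequentially" "eventually (\<lambda>n. norm x < b * (1 - t n)) sequentially"
      using x by (auto intro: order_tendstoD simp: mem_annulus)
    then have "eventually (\<lambda>n. x \<in> S n) sequentially"
      by eventually_elim (simp add: S_def mem_annulus)
    then show "x \<in> (\<Union>n. S n)" using eventually_happens by fastforce
  qed
  have "(\<integral>\<^sup>+x. F x * indicator (annulus a b) x \<partial>lborel) = emeasure (density lborel F) (\<Union>n. S n)"
    unfolding U by (subst emeasure_density) auto
  also have "\<dots> = (SUP n. emeasure (density lborel F) (S n))"
    using inc by (intro SUP_emeasure_incseq[symmetric]) (auto simp: S_def)
  also have "\<dots> \<le> c"
  proof (rule SUP_least)
    fix n
    have "emeasure (density lborel F) (S n) = (\<integral>\<^sup>+x. F x * indicator (S n) x \<partial>lborel)"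
      by (subst emeasure_density) (auto simp: S_def)
    also have "\<dots> \<le> c" unfolding S_def
    proof (rule le)
      have h: "a * (1 + t n) \<le> a * (3 / 2)" "b * (1 / 2) \<le> b * (1 - t n)"
        using ab b t[of n] by (intro mult_left_mono; simp)+
      show "a < a * (1 + t n)" "b * (1 - t n) < b" using ab b t[of n] by (auto simp: algebra_simps)
      show "a * (1 + t n) \<le> 2 * a" using h(1) ab(1) by linarith
      show "3 * (a * (1 + t n)) < b * (1 - t n)" using h ab by linarith
    qed
    finally show "emeasure (density lborel F) (S n) \<le> c" .
  qed
  finally show ?thesis .
qed

section \<open>The neck estimate\<close>

lemma jet_square_integral_finite:
  assumes int: "\<And>i j. i + j \<le> 2 \<Longrightarrow> integrable lborel (V i j)"
    and L2: "\<And>i j. i + j \<le> 2 \<Longrightarrow> Lp_int 2 (V i j) < \<infinity>" and S: "S \<in> sets borel"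
  shows "(set_int S (\<lambda>x. jet_square V x)) < \<infinity>"
proof -
  let ?I = "{p::nat \<times> nat. fst p + snd p \<le> 2}"
  have fin: "finite ?I"
    by (rule finite_subset[of _ "{..2} \<times> {..2}"]) auto
  define c where "c = (\<Sum>p\<in>?I. Lp_int 2 (V (fst p) (snd p)))"
  have c: "c < \<infinity>" unfolding c_def using fin L2 by auto
  have "(set_int S (\<lambda>x. jet_square V x)) \<le> 6 * c"
  proof (rule nn_integral_jet_square[OF _ S])
    fix i j :: nat assume ij: "i + j \<le> 2"
    show "V i j \<in> borel_measurable borel" using int[OF ij] by auto
    have "(set_int S (\<lambda>x. (V i j x)\<^sup>2)) \<le> Lp_int 2 (V i j)"
      unfolding Lp_int_def by (intro nn_integral_mono) (auto simp: indicator_def)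
    also have "\<dots> \<le> c"
      unfolding c_def using member_le_sum[of "(i, j)" ?I "\<lambda>p. Lp_int 2 (V (fst p) (snd p))"] fin ij by simp
    finally show "(set_int S (\<lambda>x. (V i j x)\<^sup>2)) \<le> c" .
  qed
  also have "\<dots> < \<infinity>" using c by (simp add: ennreal_mult_less_top)
  finally show ?thesis .
qed

lemma jet_dominated_finite:
  fixes F :: "complex \<Rightarrow> real"
  assumes J: "(set_int S (\<lambda>x. jet_square V x)) < \<infinity>"
    and m: "jet_square V \<in> borel_measurable borel" "S \<in> sets borel"
    and M: "0 \<le> M" "\<And>x. x \<in> S \<Longrightarrow> F x \<le> M * jet_square V x"
  shows "(set_int S F) < \<infinity>"
proof -
  have "(set_int S F) \<le>
      2 * (set_int S (\<lambda>x. 0)) + ennreal M * (set_int S (\<lambda>x. jet_square V x))"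
    by (rule nn_integral_linear_bound) (use M m jet_square_nonneg in auto)
  also have "\<dots> < \<infinity>" using J by (simp add: ennreal_mult_less_top)
  finally show ?thesis .
qed

lemma neck_estimate:
  fixes u :: "complex \<Rightarrow> real"
  assumes ab: "0 < a" "12 * a \<le> b" and \<gamma>: "0 \<le> \<gamma>" "\<gamma> \<le> 1" and \<beta>: "0 \<le> \<beta>" and m: "3 \<le> m"
    and u: "u \<in> sobolev_Wk2 2 (annulus a b)"
  shows "(LINT x:annulus a b|lebesgue. 1 / (norm x)\<^sup>2
              * (norm (weak_grad (annulus a b) u x + ((m - 1) * u x) *\<^sub>R (x /\<^sub>R (norm x)\<^sup>2)))\<^sup>2
              * neck_weight (2 * \<gamma>) a b x)
          \<le> 32 * neck_const (m - 1) \<beta> \<gamma> * ((LINT x:annulus a b|lebesgue.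
                    (u x)\<^sup>2 / (norm x) ^ 4 * neck_weight (4 * \<beta>) a b x)
               + (LINT x:annulus a b|lebesgue.
                    (real_L_op m (annulus a b) u x)\<^sup>2 * neck_weight (2 * \<gamma>) a b x)
               + (LINT x:annulus a b|lebesgue.
                    (cmod (complex_L_op m (annulus a b) (\<lambda>z. of_real (u z)) x))\<^sup>2
                    * neck_weight (2 * \<gamma>) a b x))"
    (is "?LHS \<le> 32 * ?K * (?IX + ?IL + ?ID)")
proof -
  define k where "k = m - 1"
  have k: "2 \<le> k" using m by (simp add: k_def)
  define \<Omega> where "\<Omega> = annulus a b"
  have \<Omega>: "open \<Omega>" unfolding \<Omega>_def by (rule annulus_open)
  have bnd: "bounded \<Omega>" unfolding \<Omega>_def annulus_def by (rule bounded_subset[OF bounded_ball]) auto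
  have [measurable]: "\<Omega> \<in> sets borel" unfolding \<Omega>_def by measurable
  have b: "b > 0" using ab by linarith
  have nz: "x \<noteq> 0" "0 < norm x" if "x \<in> \<Omega>" for x
    using that ab unfolding \<Omega>_def mem_annulus by auto
  obtain v where v: "v 0 0 = u" "\<And>i j. i + j \<le> 2 \<Longrightarrow> v i j \<in> L2_on \<Omega>"
    "\<And>i j. i + j \<le> 2 \<Longrightarrow> has_weak_partial \<Omega> (multi_index i j) u (v i j)"
    "has_weak_partial \<Omega> [\<i>, 1] u (v 1 1)"
    using sobolev_derivatives[OF \<Omega>] u unfolding \<Omega>_def by blast
  have "\<exists>f. i + j \<le> 2 \<longrightarrow> integrable lborel f \<and> Lp_int 2 f < \<infinity> \<and> (AE x in lebesgue. indicator \<Omega> x * v i j x = f x)" for i j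
    using L2_borel_rep[OF v(2) bnd \<Omega>, of i j] by blast
  then obtain V where V0: "\<And>i j. i + j \<le> 2 \<longrightarrow> integrable lborel (V i j) \<and> Lp_int 2 (V i j) < \<infinity> \<and>
      (AE x in lebesgue. indicator \<Omega> x * v i j x = V i j x)"
    by metis
  have int: "integrable lborel (V i j)" and L2: "Lp_int 2 (V i j) < \<infinity>"
    and ae: "AE x in lebesgue. indicator \<Omega> x * v i j x = V i j x" if "i + j \<le> 2" for i j
    using V0 that by auto
  have rep: "(LINT y:\<Omega>|lebesgue. prod_bump s 0 i' j' (x - y) * v i j y) = convol (prod_bump s 0 i' j') (V i j) x"
    if "i + j \<le> 2" for i j i' j' s x
    unfolding convol_def
    by (rule set_integral_borel_rep[OF L2_set_integrable[OF v(2)[OF that] bnd \<Omega>] int[OF that] ae[OF that] bump_continuous])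
  have link: "(1 / e) ^ (i + j) * convol (bump e i j) (V 0 0) x = convol (bump e 0 0) (V i j) x"
    if ij: "i + j \<le> 2" and e: "e > 0" and sub: "cball x (2 * e) \<subseteq> annulus a b" for i j x e
  proof -
    have "(1 / e) ^ (i + j) * (LINT y:\<Omega>|lebesgue. bump e i j (x - y) * v 0 0 y) =
        (LINT y:\<Omega>|lebesgue. bump e 0 0 (x - y) * v i j y)"
      using weak_partial_bump[OF v(3)[OF ij] multi_index_props(1) e, of x] sub
      unfolding multi_index_props v(1) \<Omega>_def by blast
    then show ?thesis using rep[OF ij] rep[of 0 0] by simp
  qed
  have Vm: "V i j \<in> borel_measurable borel" if "i + j \<le> 2" for i j using int[OF that] by auto
  have six[measurable]: "V 0 0 \<in> borel_measurable borel" "V 1 0 \<in> borel_measurable borel" "V 0 1 \<in> borel_measurable borel"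
    "V 2 0 \<in> borel_measurable borel" "V 1 1 \<in> borel_measurable borel" "V 0 2 \<in> borel_measurable borel"
    by (rule Vm, simp)+
  note [measurable] = conj_measurable[of V, OF Vm]
  have jm: "jet_square V \<in> borel_measurable borel" unfolding jet_square_def by measurable
  have J: "(set_int \<Omega> (\<lambda>x. jet_square V x)) < \<infinity>"
    by (rule jet_square_integral_finite[OF int L2]) auto
  define C where "C = coeff_bound k a"
  have cb: "(conj_hess11 k V x)\<^sup>2 \<le> 4 * C\<^sup>2 * jet_square V x" "(conj_hess12 k V x)\<^sup>2 \<le> 4 * C\<^sup>2 * jet_square V x"
    "(conj_hess22 k V x)\<^sup>2 \<le> 4 * C\<^sup>2 * jet_square V x" if "x \<in> \<Omega>" for x
    unfolding C_def using conj_bounds[of a x k V] that ab k by (auto simp: mem_annulus \<Omega>_def)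
  define F0 where "F0 = (\<lambda>x. conj_grad_sq k V x * radial_weight (- 2) (2 * \<gamma>) a b x)"
  define FX where "FX = (\<lambda>x. (V 0 0 x)\<^sup>2 * radial_weight (- 4) (4 * \<beta>) a b x)"
  define FL where "FL = (\<lambda>x. (conj_hess11 k V x + conj_hess22 k V x)\<^sup>2 * radial_weight 0 (2 * \<gamma>) a b x)"
  \<comment> \<open>The squared modulus of (h11 - h22)/4 - \<i> h12/2, which is the value of the
    complex operator.\<close>
  define FD where "FD = (\<lambda>x. ((conj_hess11 k V x - conj_hess22 k V x)\<^sup>2 / 16 + (conj_hess12 k V x)\<^sup>2 / 4) * radial_weight 0 (2 * \<gamma>) a b x)"
  define FH where "FH = (\<lambda>x. conj_hess_sq k V x * radial_weight 0 (2 * \<gamma>) a b x)"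
  have Fm[measurable]: "F0 \<in> borel_measurable borel" "FX \<in> borel_measurable borel" "FL \<in> borel_measurable borel"
    "FD \<in> borel_measurable borel" "FH \<in> borel_measurable borel"
    unfolding F0_def FX_def FL_def FD_def FH_def by measurable
  have Fnn: "F0 x \<ge> 0" "FX x \<ge> 0" "FL x \<ge> 0" "FD x \<ge> 0" for x
    unfolding F0_def FX_def FL_def FD_def by (intro mult_nonneg_nonneg radial_weight_nonneg; simp)+
  let ?N = "\<lambda>F. set_int \<Omega> F"
  have w: "radial_weight e s a b x \<le> 2 * a powr e" if "x \<in> \<Omega>" "e \<le> 0" "0 \<le> s" for x e s
    using that ab by (intro radial_weight_le) (auto simp: mem_annulus \<Omega>_def)
  have w0: "radial_weight 0 (2 * \<gamma>) a b x \<le> 2" if "x \<in> \<Omega>" for x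
    using w[OF that, of 0 "2 * \<gamma>"] \<gamma> ab by simp
  \<comment> \<open>Away from 0 the weights and coefficients are bounded, so L^2 control of the
    derivatives makes every integral on the right finite; their real versions are then genuine
    integrals.\<close>
  have finX: "?N FX < \<infinity>"
  proof (rule jet_dominated_finite[OF J jm])
    fix x assume x: "x \<in> \<Omega>"
    have "FX x \<le> jet_square V x * (2 * a powr (- 4))"
      unfolding FX_def using w[OF x] \<beta> jet_square_nonneg radial_weight_nonneg
      by (intro mult_mono) (auto simp: jet_square_def)
    then show "FX x \<le> (2 * a powr (- 4)) * jet_square V x" by (simp add: mult.commute)
  qed auto
  have finL: "?N FL < \<infinity>"
  proof (rule jet_dominated_finite[OF J jm])
    fix x assume x: "x \<in> \<Omega>"
    have "(conj_hess11 k V x + conj_hess22 k V x)\<^sup>2 \<le> 16 * C\<^sup>2 * jet_square V x"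
      using square_add_le(1)[of "conj_hess11 k V x" "conj_hess22 k V x"] cb[OF x] by linarith
    then have "FL x \<le> 16 * C\<^sup>2 * jet_square V x * 2"
      unfolding FL_def using w0[OF x] jet_square_nonneg radial_weight_nonneg by (intro mult_mono) auto
    then show "FL x \<le> 32 * C\<^sup>2 * jet_square V x" by simp
  qed auto
  have finD: "?N FD < \<infinity>"
  proof (rule jet_dominated_finite[OF J jm])
    fix x assume x: "x \<in> \<Omega>"
    have "(conj_hess11 k V x - conj_hess22 k V x)\<^sup>2 / 16 + (conj_hess12 k V x)\<^sup>2 / 4 \<le> 16 * C\<^sup>2 * jet_square V x"
      using square_add_le(2)[of "conj_hess11 k V x" "conj_hess22 k V x"] cb[OF x] zero_le_power2[of "conj_hess11 k V x"]
        zero_le_power2[of "conj_hess12 k V x"] by linarith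
    then have "FD x \<le> 16 * C\<^sup>2 * jet_square V x * 2"
      unfolding FD_def using w0[OF x] jet_square_nonneg radial_weight_nonneg by (intro mult_mono) auto
    then show "FD x \<le> 32 * C\<^sup>2 * jet_square V x" by simp
  qed auto
  have H: "?N FH \<le> 8 * (?N FL + ?N FD)"
  proof -
    have "?N FH \<le> (\<integral>\<^sup>+x. 8 * (ennreal (FL x) * indicator \<Omega> x + ennreal (FD x) * indicator \<Omega> x) \<partial>lborel)"
    proof (rule nn_integral_mono)
      fix x
      have "conj_hess_sq k V x \<le>
          8 * ((conj_hess11 k V x + conj_hess22 k V x)\<^sup>2 + ((conj_hess11 k V x - conj_hess22 k V x)\<^sup>2 / 16 + (conj_hess12 k V x)\<^sup>2 / 4))"
      proof -
        \<comment> \<open>Splitting a symmetric matrix into trace and trace-free part. The factor 8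
          is forced by the latter: 8/16 = 1/2 and 8/4 = 2.\<close>
        have *: "p\<^sup>2 + 2 * q\<^sup>2 + r\<^sup>2 = (p + r)\<^sup>2 / 2 + (p - r)\<^sup>2 / 2 + 2 * q\<^sup>2" for p q r :: real
          by (simp add: power2_eq_square field_simps)
        show ?thesis unfolding * using zero_le_power2[of "conj_hess11 k V x + conj_hess22 k V x"]
          unfolding distrib_left by linarith
      qed
      then have "FH x \<le> 8 * ((conj_hess11 k V x + conj_hess22 k V x)\<^sup>2 + ((conj_hess11 k V x - conj_hess22 k V x)\<^sup>2 / 16 + (conj_hess12 k V x)\<^sup>2 / 4)) * radial_weight 0 (2 * \<gamma>) a b x"
        unfolding FH_def by (intro mult_right_mono radial_weight_nonneg)
      also have "\<dots> = 8 * (FL x + FD x)" unfolding FL_def FD_def by (simp add: algebra_simps)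
      finally have "ennreal (FH x) \<le> ennreal (8 * (FL x + FD x))" by (rule ennreal_leI)
      also have "\<dots> = 8 * (ennreal (FL x) + ennreal (FD x))"
        using ennreal_mult'[of 8 "FL x + FD x"] by (simp only: ennreal_numeral zero_le_numeral ennreal_plus[OF Fnn(3,4)])
      finally show "ennreal (FH x) * indicator \<Omega> x \<le> 8 * (ennreal (FL x) * indicator \<Omega> x + ennreal (FD x) * indicator \<Omega> x)"
        by (cases "x \<in> \<Omega>") simp_all
    qed
    also have "\<dots> = 8 * (?N FL + ?N FD)"
      by (subst nn_integral_cmult) (auto simp: nn_integral_add)
    finally show ?thesis .
  qed
  have K: "?K \<ge> 0" by (simp add: neck_const_def)
  let ?c = "ennreal (32 * ?K) * (?N FX + ?N FL + ?N FD)"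
  have bound: "?N F0 \<le> ?c"
    unfolding \<Omega>_def
  proof (rule annulus_exhaustion[OF _ ab])
    fix A B assume AB: "a < A" "A \<le> 2 * a" "3 * A < B" "B < b"
    have mono: "(set_int (annulus A B) F) \<le> ?N F" for F
      using AB by (intro nn_integral_mono) (auto simp: indicator_def \<Omega>_def mem_annulus)
    have "(set_int (annulus A B) F0) \<le>
        ennreal (4 * neck_const k \<beta> \<gamma>) * ((set_int (annulus A B) FX)
        + (set_int (annulus A B) FH))"
      unfolding F0_def FX_def FH_def
      by (rule weak_conj_estimate[OF ab(1) AB \<gamma> \<beta> k int L2 link])
    also have "\<dots> \<le> ennreal (4 * neck_const k \<beta> \<gamma>) * (?N FX + 8 * (?N FL + ?N FD))"
      by (intro mult_left_mono add_mono mono order_trans[OF mono H]) auto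
    also have "\<dots> \<le> ennreal (4 * neck_const k \<beta> \<gamma>) * (8 * (?N FX + ?N FL + ?N FD))"
    proof (intro mult_left_mono)
      have "?N FX \<le> 8 * ?N FX" using mult_right_mono[of 1 8 "?N FX"] by simp
      then show "?N FX + 8 * (?N FL + ?N FD) \<le> 8 * (?N FX + ?N FL + ?N FD)"
        by (simp add: distrib_left add.assoc add_right_mono)
    qed auto
    also have "\<dots> = ?c"
    proof -
      \<comment> \<open>32 = 4 * 8: the 4 comes from the approximation, the 8 from recovering the
        Hessian from the two operators.\<close>
      have "ennreal (32 * ?K) = ennreal (4 * ?K) * 8"
        using K ennreal_mult''[of 8 "4 * ?K"] by (simp add: mult.commute)
      then show ?thesis by (simp add: k_def mult.assoc)
    qed
    finally show "(set_int (annulus A B) F0) \<le> ennreal (32 * ?K) *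
        ((set_int (annulus a b) FX) + (set_int (annulus a b) FL)
          + (set_int (annulus a b) FD))"
      unfolding \<Omega>_def .
  qed measurable
  have cfin: "?c < \<infinity>" using finX finL finD by (simp add: ennreal_mult_less_top)
  \<comment> \<open>Finiteness on the left is a consequence of the estimate itself, already proved
    for nonnegative integrals.\<close>
  have fin0: "?N F0 < \<infinity>" using bound cfin by (rule le_less_trans)
  have aeV: "AE x in lebesgue. x \<in> \<Omega> \<longrightarrow> v 0 0 x = V 0 0 x \<and> v 1 0 x = V 1 0 x \<and> v 0 1 x = V 0 1 x \<and>
      v 2 0 x = V 2 0 x \<and> v 1 1 x = V 1 1 x \<and> v 0 2 x = V 0 2 x"
  proof -
    have 1: "AE x in lebesgue. x \<in> \<Omega> \<longrightarrow> v i j x = V i j x" if "i + j \<le> 2" for i j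
      using ae[OF that] by eventually_elim auto
    have six: "AE x in lebesgue. x \<in> \<Omega> \<longrightarrow> v 0 0 x = V 0 0 x" "AE x in lebesgue. x \<in> \<Omega> \<longrightarrow> v 1 0 x = V 1 0 x"
      "AE x in lebesgue. x \<in> \<Omega> \<longrightarrow> v 0 1 x = V 0 1 x" "AE x in lebesgue. x \<in> \<Omega> \<longrightarrow> v 2 0 x = V 2 0 x"
      "AE x in lebesgue. x \<in> \<Omega> \<longrightarrow> v 1 1 x = V 1 1 x" "AE x in lebesgue. x \<in> \<Omega> \<longrightarrow> v 0 2 x = V 0 2 x"
      by (rule 1, simp)+
    show ?thesis using six by eventually_elim blast
  qed
  have "\<forall>i j. i + j \<le> 2 \<longrightarrow> has_weak_partial \<Omega> (multi_index i j) u (v i j)" using v(3) by blast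
  note ops = weak_operators_AE[OF \<Omega> v(1) this v(4)]
  have cv: "conj_grad1 k V x = conj_grad1 k v x" "conj_grad2 k V x = conj_grad2 k v x"
    "conj_hess11 k V x = conj_hess11 k v x" "conj_hess12 k V x = conj_hess12 k v x" "conj_hess22 k V x = conj_hess22 k v x"
    if "v 0 0 x = V 0 0 x \<and> v 1 0 x = V 1 0 x \<and> v 0 1 x = V 0 1 x \<and>
      v 2 0 x = V 2 0 x \<and> v 1 1 x = V 1 1 x \<and> v 0 2 x = V 0 2 x" for x
    using that by (simp_all add: conj_grad1_def conj_grad2_def conj_hess11_def conj_hess12_def conj_hess22_def)
  have pw: "norm x powr (- 2) = 1 / (norm x)\<^sup>2" "norm x powr (- 4) = 1 / (norm x) ^ 4" "norm x powr 0 = 1" if "x \<in> \<Omega>" for x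
    using nz[OF that] by (simp_all add: powr_minus powr_numeral divide_inverse)
  have ae0: "AE x in lebesgue. x \<in> \<Omega> \<longrightarrow> 1 / (norm x)\<^sup>2
              * (norm (weak_grad \<Omega> u x + ((m - 1) * u x) *\<^sub>R (x /\<^sub>R (norm x)\<^sup>2)))\<^sup>2
              * neck_weight (2 * \<gamma>) a b x = F0 x"
    using aeV ops(1)
  proof eventually_elim
    case (elim x)
    show ?case
    proof
      assume x: "x \<in> \<Omega>"
      note e = elim(1)[rule_format, OF x] and g = elim(2)[rule_format, OF x]
      have eqs: "u x = V 0 0 x" "v 1 0 x = V 1 0 x" "v 0 1 x = V 0 1 x" using e v(1) by auto
      have "weak_grad \<Omega> u x + ((m - 1) * u x) *\<^sub>R (x /\<^sub>R (norm x)\<^sup>2) =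
          Complex (V 1 0 x) (V 0 1 x) + (k * V 0 0 x) *\<^sub>R (x /\<^sub>R (norm x)\<^sup>2)"
        by (simp only: g eqs k_def)
      then show "1 / (norm x)\<^sup>2 * (norm (weak_grad \<Omega> u x + ((m - 1) * u x) *\<^sub>R (x /\<^sub>R (norm x)\<^sup>2)))\<^sup>2
              * neck_weight (2 * \<gamma>) a b x = F0 x"
        by (simp only: grad_identity F0_def radial_weight_def pw[OF x] conj_grad1_def conj_grad2_def mult_ac)
    qed
  qed
  have aeX: "AE x in lebesgue. x \<in> \<Omega> \<longrightarrow> (u x)\<^sup>2 / (norm x) ^ 4 * neck_weight (4 * \<beta>) a b x = FX x"
    using aeV
  proof eventually_elim
    case (elim x)
    then show ?case using pw(2)[of x] v(1) by (auto simp: FX_def radial_weight_def)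
  qed
  have aeL: "AE x in lebesgue. x \<in> \<Omega> \<longrightarrow> (real_L_op m \<Omega> u x)\<^sup>2 * neck_weight (2 * \<gamma>) a b x = FL x"
    using aeV ops(1,2)
  proof eventually_elim
    case (elim x)
    show ?case
    proof
      assume x: "x \<in> \<Omega>"
      note e = elim(1)[rule_format, OF x] and g = elim(2)[rule_format, OF x] and l = elim(3)[rule_format, OF x]
      have "real_L_op m \<Omega> u x = (v 2 0 x + v 0 2 x) + 2 * k * (rinv x * v 1 0 x + iinv x * v 0 1 x) + k\<^sup>2 / (norm x)\<^sup>2 * v 0 0 x"
        by (simp only: real_L_op_def g l k_def inner_identity v(1))
      then show "(real_L_op m \<Omega> u x)\<^sup>2 * neck_weight (2 * \<gamma>) a b x = FL x"
        unfolding laplace_identity FL_def cv[OF e] radial_weight_def pw[OF x] by simp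
    qed
  qed
  have aeD: "AE x in lebesgue. x \<in> \<Omega> \<longrightarrow> (cmod (complex_L_op m \<Omega> (\<lambda>z. of_real (u z)) x))\<^sup>2 * neck_weight (2 * \<gamma>) a b x = FD x"
    using aeV ops(3,4)
  proof eventually_elim
    case (elim x)
    show ?case
    proof
      assume x: "x \<in> \<Omega>"
      note e = elim(1)[rule_format, OF x] and g = elim(2)[rule_format, OF x] and l = elim(3)[rule_format, OF x]
      have m3: "m - 3 = k - 2" by (simp add: k_def)
      have "complex_L_op m \<Omega> (\<lambda>z. of_real (u z)) x = Complex ((conj_hess11 k v x - conj_hess22 k v x) / 4) (- conj_hess12 k v x / 2)"
        unfolding dz_identity[OF nz(1)[OF x], of v k, symmetric]
        by (simp only: complex_L_op_def g l m3 k_def[symmetric] v(1))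
      then show "(cmod (complex_L_op m \<Omega> (\<lambda>z. of_real (u z)) x))\<^sup>2 * neck_weight (2 * \<gamma>) a b x = FD x"
        unfolding FD_def cv[OF e] radial_weight_def pw[OF x] by (simp add: cmod_power2 power_divide)
    qed
  qed
  note s0 = set_integral_eq_nn_integral[OF Fm(1) _ Fnn(1) fin0 ae0]
    and sX = set_integral_eq_nn_integral[OF Fm(2) _ Fnn(2) finX aeX]
    and sL = set_integral_eq_nn_integral[OF Fm(3) _ Fnn(3) finL aeL]
    and sD = set_integral_eq_nn_integral[OF Fm(4) _ Fnn(4) finD aeD]
  have \<Omega>m: "\<Omega> \<in> sets borel" by measurable
  note s0 = s0[OF \<Omega>m, unfolded \<Omega>_def] and sX = sX[OF \<Omega>m, unfolded \<Omega>_def] and sL = sL[OF \<Omega>m, unfolded \<Omega>_def]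
    and sD = sD[OF \<Omega>m, unfolded \<Omega>_def]
  have "ennreal ?LHS \<le> ennreal (32 * ?K) * (ennreal ?IX + ennreal ?IL + ennreal ?ID)"
    using bound unfolding \<Omega>_def s0(1)[symmetric] sX(1)[symmetric] sL(1)[symmetric] sD(1)[symmetric] .
  also have "\<dots> = ennreal (32 * ?K * (?IX + ?IL + ?ID))"
    using K sX(2) sL(2) sD(2) by (simp only: ennreal_plus[symmetric] ennreal_mult[symmetric] add_nonneg_nonneg mult_nonneg_nonneg zero_le_numeral)
  finally show ?thesis
    using K sX(2) sL(2) sD(2) by (subst (asm) ennreal_le_iff) auto
qed

theorem corollary4p1:
  fixes \<gamma> :: real
  assumes "0 < \<gamma>" and "\<gamma> < 1"
  shows "\<exists>\<Lambda>::real. \<forall>m::real. 3 \<le> m \<longrightarrow>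
    (\<forall>\<beta>::real. \<gamma> / 2 \<le> \<beta> \<and> \<beta> < min ((m - 1) / 4) 1 \<longrightarrow>
      (\<exists>C::real. \<forall>a b :: real. 0 < a \<and> a < b \<and> ln (b / a) \<ge> \<Lambda> \<longrightarrow>
        (\<forall>u :: complex \<Rightarrow> real. u \<in> sobolev_Wk2 2 (annulus a b) \<longrightarrow>
          (LINT x:annulus a b|lebesgue. 1 / (norm x)\<^sup>2
              * (norm (weak_grad (annulus a b) u x + ((m - 1) * u x) *\<^sub>R (x /\<^sub>R (norm x)\<^sup>2)))\<^sup>2
              * neck_weight (2 * \<gamma>) a b x)
          \<le> C * ((LINT x:annulus a b|lebesgue.
                    (u x)\<^sup>2 / (norm x) ^ 4 * neck_weight (4 * \<beta>) a b x)
               + (LINT x:annulus a b|lebesgue.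
                    (real_L_op m (annulus a b) u x)\<^sup>2 * neck_weight (2 * \<gamma>) a b x)
               + (LINT x:annulus a b|lebesgue.
                    (cmod (complex_L_op m (annulus a b) (\<lambda>z. of_real (u z)) x))\<^sup>2
                    * neck_weight (2 * \<gamma>) a b x)))))"
proof (intro exI allI impI)
  \<comment> \<open>Both witnesses are left open by \<open>exI\<close>: \<Lambda> becomes ln 12
    through the assumption on a and b, which gives 12a <= b, and C becomes
    \<open>32 * neck_const (m - 1) \<beta> \<gamma>\<close> through the inequality shown.\<close>
  fix m \<beta> a b :: real and u :: "complex \<Rightarrow> real"
  assume m: "3 \<le> m" and \<beta>: "\<gamma> / 2 \<le> \<beta> \<and> \<beta> < min ((m - 1) / 4) 1"
    and ab: "0 < a \<and> a < b \<and> ln 12 \<le> ln (b / a)" and u: "u \<in> sobolev_Wk2 2 (annulus a b)"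
  have "0 < b / a" using ab by (intro divide_pos_pos) linarith+
  then have "12 \<le> b / a" using ab ln_le_cancel_iff[of 12 "b / a"] by linarith
  then have "12 * a \<le> b" using ab by (simp add: field_simps)
  moreover have "0 \<le> \<beta>" using \<beta> assms by linarith
  ultimately show "(LINT x:annulus a b|lebesgue. 1 / (norm x)\<^sup>2
              * (norm (weak_grad (annulus a b) u x + ((m - 1) * u x) *\<^sub>R (x /\<^sub>R (norm x)\<^sup>2)))\<^sup>2
              * neck_weight (2 * \<gamma>) a b x)
          \<le> (32 * neck_const (m - 1) \<beta> \<gamma>) * ((LINT x:annulus a b|lebesgue.
                    (u x)\<^sup>2 / (norm x) ^ 4 * neck_weight (4 * \<beta>) a b x)
               + (LINT x:annulus a b|lebesgue.
                    (real_L_op m (annulus a b) u x)\<^sup>2 * neck_weight (2 * \<gamma>) a b x)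
               + (LINT x:annulus a b|lebesgue.
                    (cmod (complex_L_op m (annulus a b) (\<lambda>z. of_real (u z)) x))\<^sup>2
                    * neck_weight (2 * \<gamma>) a b x))"
    using neck_estimate[OF _ _ _ _ _ m u, of \<gamma> \<beta>] ab assms by simp
qed

end
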